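(* Let $(Z_j)_{j\ge 0}$ be i.i.d. random vectors in $\mathbb{R}^p$, with generic element $Z$, and let $(A_j)_{j\ge 0}$ be random $d\times p$ matrices. Assume that there is a filtration $(\mathcal{F}_j, j\ge 0)$ such that, for every $j\ge 0$, $A_j$ is $\mathcal{F}_j$-measurable, $Z_j$ is $\mathcal{F}_{j+1}$-measurable, and $\mathcal{F}_j$ is independent of $\sigma(Z_j,Z_{j+1},\ldots)$. Suppose that $Z\in \mathrm{RV}(\mu,\alpha)$ and, if $\alpha>1$, additionally that $\mathrm{E}Z=0$. Suppose that $P\big(\bigcap_{j\ge 0}\{\|A_j\|=0\}\big)=0$ and that there is some $0<\varepsilon<\alpha$ such that $$\sum_{j\ge 0} \mathrm{E}\|A_j\|^{\alpha-\varepsilon}<\infty \ \text{ and }\ \sum_{j\ge 0} \mathrm{E}\|A_j\|^{\alpha+\varepsilon}<\infty,\qquad \text{if } \alpha\in(0,1)\cup(1,2);$$ $$\mathrm{E}\Big(\sum_{j\ge 0} \|A_j\|^{\alpha-\varepsilon}\Big)^{(\alpha+\varepsilon)/(\alpha-\varepsilon)}<\infty,\qquad \text{if } \alpha\in\{1,2\};$$ $$\mathrm{E}\Big(\sum_{j\ge 0} \|A_j\|^{2}\Big)^{(\alpha+\varepsilon)/2}<\infty,\qquad \text{if } \alpha\in(2,\infty).$$ Then the series $X=\sum_{j=0}^\infty A_jZ_j$ converges a.s. and, as $u\to\infty$, $$\frac{P(u^{-1}X\in\cdot)}{P(|Z|>u)}\xrightarrow{v}\mathrm{E}\Big[\sum_{j\ge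 0}\mu\circ A_j^{-1}(\cdot)\Big]\qquad\text{on } \overline{\mathbb{R}}^d\setminus\{0\}.$$
   Context: $|\cdot|$ is the Euclidean norm and $\|\cdot\|$ is the operator norm of a matrix. $\overline{\mathbb{R}}=[-\infty,\infty]$ and $\xrightarrow{v}$ denotes vague convergence of measures. A random vector $Z$ in $\mathbb{R}^p$ is regularly varying, written $Z\in\mathrm{RV}(\mu,\alpha)$, if there is a non-null Radon measure $\mu$ on $\overline{\mathbb{R}}^p\setminus\{0\}$ with $\mu(\overline{\mathbb{R}}^p\setminus\mathbb{R}^p)=0$ such that $P(u^{-1}Z\in\cdot)/P(|Z|>u)\xrightarrow{v}\mu(\cdot)$ on $\overline{\mathbb{R}}^p\setminus\{0\}$ as $u\to\infty$; then $\mu$ necessarily satisfies $\mu(uB)=u^{-\alpha}\mu(B)$ for some $\alpha>0$, all $u>0$ and all Borel sets $B\subset\overline{\mathbb{R}}^p\setminus\{0\}$, and this is the $\alpha$ in the notation. For a $d\times p$ matrix $A$, $\mu\circ A^{-1}$ is the measure $\mu\circ A^{-1}(B)=\mu\{z: Az\in B\}$, regarded as a measure on $\overline{\mathbb{R}}^d\setminus\{0\}$ (any mass at the origin is dropped), and $\mathrm{E}[\mu\circ A_j^{-1}(B)]=\mathrm{E}[\mu\{z:A_jz\in B\}]$, the expectation being over $A_j$. *)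

theory Defs
  imports "HOL-Probability.Probability"
begin

section \<open>The punctured extended space and vague convergence\<close>

text \<open>The product topology of \<^typ>\<open>ereal ^ 'n\<close> is that of the compactified space, and its subset
  \<open>punctured\<close> is the locally compact space obtained by removing the origin.  The compact subsets of
  \<open>punctured\<close> are the closed sets bounded away from the origin; they may contain points at infinity.\<close>

definition ext_vec :: "real ^ 'n \<Rightarrow> ereal ^ 'n" where
  "ext_vec x = (\<chi> i. ereal (x $ i))"

definition punctured :: "(ereal ^ 'n) set" where
  "punctured = UNIV - {0}"

definition radon_on :: "'a::topological_space set \<Rightarrow> 'a measure \<Rightarrow> bool" where
  "radon_on E \<nu> \<longleftrightarrow>
     sets \<nu> = sets (restrict_space borel E) \<and>
     (\<forall>K. compact K \<and> K \<subseteq> E \<longrightarrow> emeasure \<nu> K < \<infinity>)"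

definition test_functions :: "'a::topological_space set \<Rightarrow> ('a \<Rightarrow> real) set" where
  "test_functions E =
     {f. continuous_on E f \<and> (\<exists>K. compact K \<and> K \<subseteq> E \<and> (\<forall>x\<in>E - K. f x = 0))}"

definition vague_convergence ::
    "'a::topological_space set \<Rightarrow> ('b \<Rightarrow> 'a measure) \<Rightarrow> 'a measure \<Rightarrow> 'b filter \<Rightarrow> bool" where
  "vague_convergence E N \<nu> F \<longleftrightarrow>
     (\<forall>\<^sub>F u in F. radon_on E (N u)) \<and> radon_on E \<nu> \<and>
     (\<forall>f\<in>test_functions E. ((\<lambda>u. integral\<^sup>L (N u) f) \<longlongrightarrow> integral\<^sup>L \<nu> f) F)"

section \<open>Regular variation\<close>

text \<open>\<open>scaled_law M X c u\<close> is the measure \<open>P (X / u \<in> \<cdot>) / c\<close> on the punctured extended space.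
  In the degenerate case \<open>c = 0\<close> it is the null measure.\<close>

definition scaled_law ::
    "'a measure \<Rightarrow> ('a \<Rightarrow> real ^ 'n) \<Rightarrow> real \<Rightarrow> real \<Rightarrow> (ereal ^ 'n) measure" where
  "scaled_law M X c u =
     scale_measure (ennreal (1 / c))
       (restrict_space (distr M borel (\<lambda>\<omega>. ext_vec (X \<omega> /\<^sub>R u))) punctured)"

definition norm_tail :: "'a measure \<Rightarrow> ('a \<Rightarrow> real ^ 'n) \<Rightarrow> real \<Rightarrow> real" where
  "norm_tail M Z u = measure M {\<omega> \<in> space M. norm (Z \<omega>) > u}"

text \<open>If \<open>Z\<close> is bounded, then \<open>norm_tail M Z u\<close> vanishes for large \<open>u\<close> and the scaled laws are
  eventually null, so that the non-nullity of the limit excludes this case.  The homogeneity clause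
  is what identifies the index \<open>\<alpha>\<close>.\<close>

definition regularly_varying ::
    "'a measure \<Rightarrow> ('a \<Rightarrow> real ^ 'n) \<Rightarrow> (ereal ^ 'n) measure \<Rightarrow> real \<Rightarrow> bool" where
  "regularly_varying M Z \<mu> \<alpha> \<longleftrightarrow>
     Z \<in> borel_measurable M \<and>
     radon_on punctured \<mu> \<and>
     emeasure \<mu> punctured \<noteq> 0 \<and>
     emeasure \<mu> (punctured - range ext_vec) = 0 \<and>
     vague_convergence punctured (\<lambda>u. scaled_law M Z (norm_tail M Z u) u) \<mu> at_top \<and>
     \<alpha> > 0 \<and>
     (\<forall>u>0. \<forall>B\<in>sets \<mu>.
        emeasure \<mu> ((\<lambda>x. \<chi> i. ereal u * x $ i) ` B) = ennreal (u powr (- \<alpha>)) * emeasure \<mu> B)"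

section \<open>Random coefficient matrices and the limit measure\<close>

text \<open>A linear map is only applied to the finite points; the remaining ones are \<open>\<mu>\<close>-null for the
  measures occurring in \<^const>\<open>regularly_varying\<close>.\<close>

definition preimage_mass ::
    "(ereal ^ 'p) measure \<Rightarrow> real ^ 'p ^ 'd \<Rightarrow> (ereal ^ 'd) set \<Rightarrow> ennreal" where
  "preimage_mass \<mu> A B = emeasure \<mu> {ext_vec z | z. ext_vec (A *v z) \<in> B}"

definition limit_measure ::
    "'a measure \<Rightarrow> (ereal ^ 'p) measure \<Rightarrow> (nat \<Rightarrow> 'a \<Rightarrow> real ^ 'p ^ 'd) \<Rightarrow> (ereal ^ 'd) measure" where
  "limit_measure M \<mu> A =
     measure_of punctured (sets (restrict_space borel punctured))
       (\<lambda>B. \<integral>\<^sup>+\<omega>. (\<Sum>j. preimage_mass \<mu> (A j \<omega>) B) \<partial>M)"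

definition op_norm :: "real ^ 'p ^ 'd \<Rightarrow> real" where
  "op_norm A = onorm ((*v) A)"

definition ennreal_powr :: "ennreal \<Rightarrow> real \<Rightarrow> ennreal" where
  "ennreal_powr x r = (if x = \<infinity> then \<infinity> else ennreal (enn2real x powr r))"

text \<open>\<open>coefficient_filtration M F A Z\<close>: \<open>A j\<close> is \<open>F j\<close>-measurable, \<open>Z j\<close> is \<open>F (j + 1)\<close>-measurable
  and \<open>F j\<close> is independent of \<open>\<sigma>(Z j, Z (j + 1), \<dots>)\<close>.\<close>

definition coefficient_filtration ::
    "'a measure \<Rightarrow> (nat \<Rightarrow> 'a measure) \<Rightarrow> (nat \<Rightarrow> 'a \<Rightarrow> real ^ 'p ^ 'd) \<Rightarrow>
     (nat \<Rightarrow> 'a \<Rightarrow> real ^ 'p) \<Rightarrow> bool" where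
  "coefficient_filtration M F A Z \<longleftrightarrow>
     filtration (space M) F \<and>
     (\<forall>j. subalgebra M (F j)) \<and>
     (\<forall>j. A j \<in> borel_measurable (F j)) \<and>
     (\<forall>j. Z j \<in> borel_measurable (F (Suc j))) \<and>
     (\<forall>j. prob_space.indep_set M (sets (F j))
        (sigma_sets (space M) (\<Union>i\<in>{j..}. sets (vimage_algebra (space M) (Z i) borel))))"

section \<open>The limit measure evaluates as expected\<close>

lemma punctured_borel [measurable]: "punctured \<in> sets borel"
proof -
  have "closed {x :: ereal ^ 'n. x = 0}"
    unfolding vec_eq_iff by (intro closed_Collect_all closed_Collect_eq continuous_intros)
  then show ?thesis unfolding punctured_def by (auto intro: borel_closed)
qed

lemma continuous_ext_vec: "continuous_on S ext_vec"
  unfolding ext_vec_def by (intro continuous_intros)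

lemma ext_vec_measurable [measurable]: "ext_vec \<in> borel_measurable borel"
  by (intro borel_measurable_continuous_onI continuous_ext_vec)

lemma ext_vec_0 [simp]: "ext_vec 0 = 0"
  by (simp add: ext_vec_def vec_eq_iff)

lemma ext_vec_inj: "ext_vec x = ext_vec y \<longleftrightarrow> x = y"
  by (simp add: ext_vec_def vec_eq_iff)

lemma vec_nth_borel_measurable: "(\<lambda>x::'a::topological_space ^ 'n. x $ i) \<in> borel_measurable borel"
  by (intro borel_measurable_continuous_onI continuous_intros)

lemma range_ext_vec: "range ext_vec = {x. \<forall>i. \<bar>x $ i\<bar> \<noteq> \<infinity>}"
proof (intro equalityI subsetI)
  fix x :: "ereal ^ 'n" assume "x \<in> {x. \<forall>i. \<bar>x $ i\<bar> \<noteq> \<infinity>}"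
  then have "x = ext_vec (\<chi> i. real_of_ereal (x $ i))"
    by (simp add: ext_vec_def vec_eq_iff ereal_real)
  then show "x \<in> range ext_vec" by blast
qed (auto simp: ext_vec_def)

lemma range_ext_vec_borel [measurable]: "range (ext_vec :: real ^ 'n \<Rightarrow> _) \<in> sets borel"
proof -
  have "{x \<in> space borel. \<forall>i. \<bar>x $ i\<bar> \<noteq> (\<infinity>::ereal)} \<in> sets (borel :: (ereal ^ 'n) measure)"
    using vec_nth_borel_measurable [measurable] by measurable
  then show ?thesis by (simp add: range_ext_vec)
qed

definition fin_part :: "ereal ^ 'n \<Rightarrow> real ^ 'n" where
  "fin_part x = (if x \<in> range ext_vec then \<chi> i. real_of_ereal (x $ i) else 0)"

lemma fin_part_ext_vec [simp]: "fin_part (ext_vec z) = z"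
  by (simp add: fin_part_def vec_eq_iff) (simp add: ext_vec_def)

lemma fin_part_measurable [measurable]: "fin_part \<in> borel_measurable borel"
proof -
  have "(\<lambda>x::ereal ^ 'n. \<chi> i. real_of_ereal (x $ i)) \<in> borel_measurable borel"
    unfolding borel_measurable_euclidean_space [where 'c = "real ^ 'n"]
    using vec_nth_borel_measurable [measurable]
    by (auto simp: Basis_vec_def inner_axis)
  then show ?thesis
    unfolding fin_part_def by measurable
qed

lemma radon_distr_fin_part:
  assumes rad: "radon_on punctured \<mu>"
    and null: "emeasure \<mu> (punctured - range ext_vec) = 0"
  shows "sigma_finite_measure (distr \<mu> borel (fin_part :: _ \<Rightarrow> real ^ 'p))"
    and "0 \<notin> B \<Longrightarrow> B \<in> sets borel \<Longrightarrow>
      emeasure (distr \<mu> borel (fin_part :: _ \<Rightarrow> real ^ 'p)) {z. ext_vec (A *v z) \<in> B} =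
        preimage_mass \<mu> A B"
proof -
  have sets: "sets \<mu> = sets (restrict_space borel punctured)" using rad by (simp add: radon_on_def)
  have space: "space \<mu> = punctured" using sets_eq_imp_space_eq [OF sets] by (simp add: space_restrict_space)
  have fin: "fin_part \<in> measurable \<mu> borel"
    by (subst measurable_cong_sets [OF sets refl]) (intro measurable_restrict_space1 fin_part_measurable)
  let ?N = "distr \<mu> borel (fin_part :: _ \<Rightarrow> real ^ 'p)"
  have N: "emeasure ?N C = emeasure \<mu> {x \<in> punctured. fin_part x \<in> C}" if "C \<in> sets borel" for C
    using that by (subst emeasure_distr [OF fin]) (auto intro!: arg_cong [where f = "emeasure \<mu>"] simp: space)
  have eq: "{x \<in> punctured. fin_part x \<in> C} = ext_vec ` C" if "0 \<notin> C" for C :: "(real ^ 'p) set"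
  proof (intro equalityI subsetI)
    fix x assume x: "x \<in> {x \<in> punctured. fin_part x \<in> C}"
    then have "x \<in> range ext_vec" using that by (auto simp: fin_part_def split: if_splits)
    then show "x \<in> ext_vec ` C" using x by auto
  next
    fix x assume "x \<in> ext_vec ` C"
    then obtain z where z: "z \<in> C" "x = ext_vec z" by auto
    with that have "z \<noteq> 0" by auto
    then have "ext_vec z \<noteq> 0" using ext_vec_inj [of z 0] by simp
    with z show "x \<in> {x \<in> punctured. fin_part x \<in> C}" by (simp add: punctured_def)
  qed
  show "sigma_finite_measure ?N"
  proof
    let ?K = "\<lambda>n::nat. cball 0 (real n) - ball 0 (1 / Suc n) :: (real ^ 'p) set"
    let ?\<A> = "insert {0} (range ?K)"
    have fin0: "emeasure ?N {0} = 0"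
    proof -
      have "{x \<in> punctured. fin_part x \<in> {0 :: real ^ 'p}} = punctured - range ext_vec"
        by (auto simp: fin_part_def punctured_def vec_eq_iff ext_vec_def)
      then show ?thesis using null by (simp add: N)
    qed
    have finK: "emeasure ?N (?K n) < \<infinity>" for n
    proof -
      have cpt: "compact (?K n)" by (intro compact_diff compact_cball open_ball)
      have n0: "0 \<notin> ?K n" by simp
      have "compact (ext_vec ` ?K n)" by (intro compact_continuous_image continuous_ext_vec cpt)
      moreover have "ext_vec ` ?K n \<subseteq> punctured"
        using eq [OF n0] by blast
      ultimately have "emeasure \<mu> (ext_vec ` ?K n) < \<infinity>"
        using rad unfolding radon_on_def by blast
      then show ?thesis using N [of "?K n"] eq [OF n0] cpt by (simp add: compact_imp_closed borel_closed)
    qed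
    have cover: "z \<in> \<Union> ?\<A>" for z
    proof (cases "z = 0")
      case False
      then have "0 < norm z" by simp
      obtain a where a: "norm z \<le> real a" using real_arch_simple by blast
      obtain b where b: "1 / Suc b < norm z" using \<open>0 < norm z\<close> nat_approx_posE by blast
      have "1 / real (Suc (max a b)) \<le> 1 / Suc b" by (intro divide_left_mono) auto
      then have "z \<in> ?K (max a b)" using a b by (auto simp: not_less)
      then show ?thesis by blast
    qed simp
    have "countable ?\<A>" by simp
    moreover have "?\<A> \<subseteq> sets ?N" by auto
    moreover have "\<Union> ?\<A> = space ?N" using cover by (subst space_distr, subst space_borel) blast
    moreover have "\<forall>a\<in>?\<A>. emeasure ?N a \<noteq> \<infinity>"
      using fin0 finK by (auto simp: less_top)
    ultimately show "\<exists>\<A>. countable \<A> \<and> \<A> \<subseteq> sets ?N \<and> \<Union> \<A> = space ?N \<and> (\<forall>a\<in>\<A>. emeasure ?N a \<noteq> \<infinity>)"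
      by blast
  qed
  assume B: "0 \<notin> B" "B \<in> sets borel"
  have cont: "(\<lambda>z. A *v z) \<in> borel_measurable borel"
    by (intro borel_measurable_continuous_onI matrix_vector_mult_linear_continuous_on)
  let ?D = "{z. ext_vec (A *v z) \<in> B}"
  have "{z \<in> space borel. ext_vec (A *v z) \<in> B} \<in> sets borel"
    using B(2) cont by measurable
  then have D: "?D \<in> sets borel" by (simp only: space_borel UNIV_I simp_thms)
  have D0: "0 \<notin> ?D" using B(1) by simp
  have "emeasure ?N ?D = emeasure \<mu> (ext_vec ` ?D)"
    by (simp only: N [OF D] eq [OF D0])
  then show "emeasure ?N ?D = preimage_mass \<mu> A B"
    by (simp only: preimage_mass_def setcompr_eq_image)
qed

lemma suminf_swap_ennreal:
  fixes f :: "nat \<Rightarrow> nat \<Rightarrow> ennreal"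
  shows "(\<Sum>i. \<Sum>j. f i j) = (\<Sum>j. \<Sum>i. f i j)"
  using nn_integral_suminf [of f "count_space UNIV"] by (simp add: nn_integral_count_space_nat)

lemma limit_measure_eval:
  fixes A :: "nat \<Rightarrow> 'a \<Rightarrow> real ^ 'p ^ 'd"
  assumes rad: "radon_on punctured \<mu>"
    and null: "emeasure \<mu> (punctured - range ext_vec) = 0"
    and A: "\<And>j. A j \<in> borel_measurable M"
  shows "sets (limit_measure M \<mu> A) = sets (restrict_space borel punctured)"
    and "B \<in> sets borel \<Longrightarrow> B \<subseteq> punctured \<Longrightarrow>
      emeasure (limit_measure M \<mu> A) B = (\<integral>\<^sup>+\<omega>. (\<Sum>j. preimage_mass \<mu> (A j \<omega>) B) \<partial>M)"
proof -
  let ?S = "restrict_space borel (punctured :: (ereal ^ 'd) set)"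
  let ?N = "distr \<mu> borel (fin_part :: _ \<Rightarrow> real ^ 'p)"
  let ?m = "\<lambda>B. \<integral>\<^sup>+\<omega>. (\<Sum>j. preimage_mass \<mu> (A j \<omega>) B) \<partial>M"
  interpret N: sigma_finite_measure ?N by (rule radon_distr_fin_part [OF rad null])
  have space: "space ?S = punctured" by (simp add: space_restrict_space)
  have sub: "sets ?S \<subseteq> Pow punctured" using sets.space_closed [of ?S] by (simp add: space)
  have S: "B \<in> sets ?S \<longleftrightarrow> B \<in> sets borel \<and> B \<subseteq> punctured" for B
    by (subst sets_restrict_space_iff) auto
  show sets: "sets (limit_measure M \<mu> A) = sets ?S"
    unfolding limit_measure_def using sub sets.sigma_sets_eq [of ?S] by (simp add: space)
  have mass: "preimage_mass \<mu> (A j \<omega>) B = emeasure ?N {z. ext_vec (A j \<omega> *v z) \<in> B}"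
    if "B \<in> sets ?S" for B j \<omega>
  proof -
    have "0 \<notin> B" "B \<in> sets borel" using that S [of B] by (auto simp: punctured_def)
    then show ?thesis by (rule radon_distr_fin_part(2) [OF rad null, symmetric])
  qed
  have mv: "(\<lambda>p. ext_vec (A j (fst p) *v snd p)) \<in> borel_measurable (M \<Otimes>\<^sub>M ?N)" for j
  proof -
    have "continuous_on UNIV (\<lambda>p :: (real ^ 'p ^ 'd) \<times> (real ^ 'p). fst p *v snd p)"
      unfolding matrix_vector_mult_def by (intro continuous_intros)
    then have "(\<lambda>p. fst p *v snd p) \<in> borel_measurable (borel :: ((real ^ 'p ^ 'd) \<times> (real ^ 'p)) measure)"
      by (rule borel_measurable_continuous_onI)
    moreover have "(\<lambda>p. (A j (fst p), snd p)) \<in> measurable (M \<Otimes>\<^sub>M ?N) (borel \<Otimes>\<^sub>M borel)"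
    proof (rule measurable_Pair)
      show "(\<lambda>p. A j (fst p)) \<in> borel_measurable (M \<Otimes>\<^sub>M ?N)"
        by (rule measurable_compose [OF measurable_fst A])
      have "snd \<in> measurable (M \<Otimes>\<^sub>M ?N) ?N" by (rule measurable_snd)
      then show "snd \<in> borel_measurable (M \<Otimes>\<^sub>M ?N)" by simp
    qed
    ultimately have "(\<lambda>p. fst (A j (fst p), snd p) *v snd (A j (fst p), snd p))
        \<in> borel_measurable (M \<Otimes>\<^sub>M ?N)"
      unfolding borel_prod by (rule measurable_compose [rotated])
    then have "(\<lambda>p. A j (fst p) *v snd p) \<in> borel_measurable (M \<Otimes>\<^sub>M ?N)" by simp
    then show ?thesis by (rule measurable_compose [OF _ ext_vec_measurable])
  qed
  have meas: "(\<lambda>\<omega>. preimage_mass \<mu> (A j \<omega>) B) \<in> borel_measurable M" if B: "B \<in> sets ?S" for B j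
  proof -
    let ?Q = "(\<lambda>p. ext_vec (A j (fst p) *v snd p)) -` B \<inter> space (M \<Otimes>\<^sub>M ?N)"
    have "?Q \<in> sets (M \<Otimes>\<^sub>M ?N)" using B S by (intro measurable_sets [OF mv]) blast
    then have "(\<lambda>\<omega>. emeasure ?N (Pair \<omega> -` ?Q)) \<in> borel_measurable M"
      by (rule N.measurable_emeasure_Pair)
    moreover have "emeasure ?N (Pair \<omega> -` ?Q) = preimage_mass \<mu> (A j \<omega>) B" if "\<omega> \<in> space M" for \<omega>
      unfolding mass [OF B] using that
      by (intro arg_cong [where f = "emeasure ?N"]) (auto simp: space_pair_measure)
    ultimately show ?thesis by (simp cong: measurable_cong)
  qed
  have "measure_space punctured (sets ?S) ?m"
    unfolding measure_space_def
  proof (intro conjI)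
    show "sigma_algebra punctured (sets ?S)" using sets.sigma_algebra_axioms [of ?S] by (simp add: space)
    show "positive (sets ?S) ?m" by (simp add: positive_def mass)
    show "countably_additive (sets ?S) ?m"
    proof (rule countably_additiveI)
      fix C :: "nat \<Rightarrow> (ereal ^ 'd) set"
      assume C: "range C \<subseteq> sets ?S" and disj: "disjoint_family C" and U: "\<Union> (range C) \<in> sets ?S"
      have Ci: "C i \<in> sets ?S" for i using C by auto
      have add: "(\<Sum>i. preimage_mass \<mu> (A j \<omega>) (C i)) = preimage_mass \<mu> (A j \<omega>) (\<Union> (range C))" for j \<omega>
      proof -
        have cont: "(\<lambda>z. A j \<omega> *v z) \<in> borel_measurable borel"
          by (intro borel_measurable_continuous_onI matrix_vector_mult_linear_continuous_on)
        have "{z \<in> space borel. ext_vec (A j \<omega> *v z) \<in> C i} \<in> sets borel" for i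
        proof -
          have [measurable]: "C i \<in> sets borel" using Ci [of i] S [of "C i"] by blast
          show ?thesis using cont by measurable
        qed
        then have "range (\<lambda>i. {z. ext_vec (A j \<omega> *v z) \<in> C i}) \<subseteq> sets ?N" by auto
        moreover have "disjoint_family (\<lambda>i. {z. ext_vec (A j \<omega> *v z) \<in> C i})"
          using disj by (auto simp: disjoint_family_on_def)
        ultimately have "(\<Sum>i. emeasure ?N {z. ext_vec (A j \<omega> *v z) \<in> C i}) =
            emeasure ?N (\<Union>i. {z. ext_vec (A j \<omega> *v z) \<in> C i})"
          by (rule suminf_emeasure)
        also have "(\<Union>i. {z. ext_vec (A j \<omega> *v z) \<in> C i}) = {z. ext_vec (A j \<omega> *v z) \<in> \<Union> (range C)}"
          by auto
        finally show ?thesis using mass Ci U by simp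
      qed
      have "(\<Sum>i. ?m (C i)) = (\<integral>\<^sup>+\<omega>. (\<Sum>i. \<Sum>j. preimage_mass \<mu> (A j \<omega>) (C i)) \<partial>M)"
        using meas Ci by (subst nn_integral_suminf) (auto intro: borel_measurable_suminf_order)
      also have "\<dots> = (\<integral>\<^sup>+\<omega>. (\<Sum>j. \<Sum>i. preimage_mass \<mu> (A j \<omega>) (C i)) \<partial>M)"
        by (subst suminf_swap_ennreal) (rule refl)
      also have "\<dots> = ?m (\<Union> (range C))" by (simp add: add)
      finally show "(\<Sum>i. ?m (C i)) = ?m (\<Union> (range C))" .
    qed
  qed
  then show "emeasure (limit_measure M \<mu> A) B = ?m B" if "B \<in> sets borel" "B \<subseteq> punctured"
    unfolding limit_measure_def
    using that S [of B] sub sets.sigma_sets_eq [of ?S]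
    by (subst emeasure_measure_of_sigma) (auto simp: measure_space_def)
qed

end

theory Submission
  imports Defs
begin

text \<open>Write \<open>T u = P (\<bar>Z\<bar> > u)\<close>.  Regular variation gives Potter's bound
  \<open>P (a \<bar>Z\<bar> > u) \<le> C T(u) (a\<^bsup>\<alpha> - \<eta>\<^esup> + a\<^bsup>\<alpha> + \<eta>\<^esup>)\<close> for all \<open>a \<ge> 0\<close> and large \<open>u\<close>, and dyadic
  summation of it controls all truncated moments of \<open>a \<bar>Z\<bar>\<close>.  For a single term \<open>A\<^sub>j Z\<^sub>j\<close> the limit
  follows by conditioning on \<open>A\<^sub>j\<close> and dominated convergence; two terms of a finite sum are
  simultaneously of order \<open>u\<close> only with probability \<open>o(T(u))\<close>, so a test function of the sum is
  asymptotically the sum of the test function over the terms.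

  What remains is that the tails of the series are negligible relative to \<open>T(u)\<close>.  Truncate
  \<open>\<parallel>A\<^sub>j\<parallel> \<bar>Z\<^sub>j\<bar>\<close> at a level \<open>c\<close> proportional to \<open>u\<close>.  If \<open>\<alpha> \<in> (0,1) \<union> (1,2)\<close>, first moments of the conditional
  means and second moments of the martingale part suffice.  If \<open>\<alpha> \<in> {1,2}\<close> or \<open>\<alpha> > 2\<close>, conditional means
  and variances are at most \<open>c\<^bsup>1 - \<gamma>\<^esup>\<close> and \<open>c\<^bsup>2 - \<gamma>\<^esup>\<close> times \<open>\<Sum>\<parallel>A\<^sub>j\<parallel>\<^bsup>\<gamma>\<^esup>\<close>, with \<open>\<gamma> = \<alpha> - \<epsilon>\<close> resp. \<open>\<gamma> = 2\<close>; the
  moment assumption makes this sum small compared with \<open>u\<^bsup>\<gamma>\<^esup>\<close> outside an event of probability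
  \<open>o(T(u))\<close>, and on the complement an exponential supermartingale bounds the probability that
  the truncated sum exceeds \<open>u\<close> by an arbitrary negative power of \<open>u\<close>.\<close>

section \<open>Test functions on the punctured space\<close>

text \<open>The coefficients may depend on the past noise, so the terms need not be independent, nor
  \<open>A j\<close> and an earlier \<open>Z i\<close>. What is available is the independence of
  \<open>F j\<close> and \<open>Z j\<close>, and every estimate integrates out one
  \<open>Z j\<close> at a time with \<open>F j\<close> frozen. The case distinction reflects how
  truncated moments of Z compare with T(u). For \<alpha> < 1 and for 1 < \<alpha> < 2 the first
  moments (below the level u, resp. above it) are at most of order u T(u) and the second ones of
  order u^2 T(u), so Markov and Chebyshev give O(T(u)). At \<alpha> = 1 the first and at \<alpha> =
  2 the second moment is borderline, and Potter's bound loses a power of u; for \<alpha> > 2 the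
  truncated second moment converges and Chebyshev gives only u^(-2), far above T(u). The exponential
  inequality repairs this, at the price of a moment of the whole sum instead of a sum of moments. A
  second obstacle: vague convergence tests functions that extend continuously to the points at
  infinity, and z -> g(Bz) need not do so. The limit for Z is therefore first extended to all
  bounded continuous functions vanishing near 0.\<close>

text \<open>In tangent coordinates the compactified space is a continuous image of a cube, and bounded
  continuous functions on it become uniformly continuous in the coordinates \<open>arctan x\<close>.\<close>

definition ereal_tan :: "real \<Rightarrow> ereal" where
  "ereal_tan t = (if t \<ge> pi / 2 then \<infinity> else if t \<le> - (pi / 2) then - \<infinity> else ereal (tan t))"

lemma ereal_tan_arctan: "ereal_tan (arctan x) = ereal x"
  using arctan_lbound [of x] arctan_ubound [of x] by (simp add: ereal_tan_def tan_arctan)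

lemma ereal_tan_pi_half: "ereal_tan (pi / 2) = \<infinity>" "ereal_tan (- (pi / 2)) = - \<infinity>"
proof -
  have *: "\<not> pi / 2 \<le> - (pi / 2)" using pi_gt_zero by linarith
  show "ereal_tan (- (pi / 2)) = - \<infinity>"
    by (simp only: ereal_tan_def * if_False if_True order_refl)
qed (simp add: ereal_tan_def)

lemma ereal_tan_cases:
  obtains t where "- (pi / 2) \<le> t" "t \<le> pi / 2" "ereal_tan t = y"
proof (cases y)
  case (real r)
  then show ?thesis
    using ereal_tan_arctan [of r] arctan_lbound [of r] arctan_ubound [of r]
    by (intro that [of "arctan r"]) auto
next
  case PInf
  have "- (pi / 2) \<le> pi / 2" using pi_gt_zero by linarith
  then show ?thesis using PInf ereal_tan_pi_half(1) by (intro that [of "pi / 2"]) (simp_all only: order_refl)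
next
  case MInf
  have "- (pi / 2) \<le> pi / 2" using pi_gt_zero by linarith
  then show ?thesis using MInf ereal_tan_pi_half(2) by (intro that [of "- (pi / 2)"]) (simp_all only: order_refl)
qed

lemma surj_ereal_tan: "range ereal_tan = UNIV"
proof -
  have "y \<in> range ereal_tan" for y by (rule ereal_tan_cases [of y]) blast
  then show ?thesis by blast
qed

text \<open>A monotone map with open image cannot jump, so surjectivity replaces any limit
  computation at the points pi/2 and -pi/2.\<close>

lemma continuous_ereal_tan: "continuous_on UNIV ereal_tan"
proof (rule continuous_onI_mono)
  show "open (ereal_tan ` UNIV)" by (simp add: surj_ereal_tan)
  fix x y :: real assume "x \<le> y"
  then show "ereal_tan x \<le> ereal_tan y"
    using tan_monotone [of x y] by (cases "x = y") (auto simp: ereal_tan_def)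
qed

definition vec_tan :: "real ^ 'n \<Rightarrow> ereal ^ 'n" where
  "vec_tan t = (\<chi> i. ereal_tan (t $ i))"

lemma continuous_vec_tan: "continuous_on UNIV vec_tan"
  unfolding vec_tan_def
  by (intro continuous_intros continuous_on_compose2 [OF continuous_ereal_tan]) auto

lemma vec_tan_arctan: "vec_tan (\<chi> i. arctan (x $ i)) = ext_vec x"
  by (simp add: vec_tan_def ext_vec_def ereal_tan_arctan)

lemma arctan_in_cbox: "(\<chi> i. arctan (x $ i)) \<in> cbox (\<chi> i. - (pi / 2)) (\<chi> i. pi / 2)"
  using arctan_lbound arctan_ubound by (simp add: mem_box_cart less_imp_le)

lemma compact_ereal_vec: "compact (UNIV :: (ereal ^ 'n) set)"
proof -
  have "vec_tan ` cbox (\<chi> i. - (pi / 2)) (\<chi> i. pi / 2) = (UNIV :: (ereal ^ 'n) set)"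
  proof -
    have "x \<in> vec_tan ` cbox (\<chi> i. - (pi / 2)) (\<chi> i. pi / 2)" for x :: "ereal ^ 'n"
    proof -
      have "\<forall>i. \<exists>t. - (pi / 2) \<le> t \<and> t \<le> pi / 2 \<and> ereal_tan t = x $ i"
      proof
        show "\<exists>t. - (pi / 2) \<le> t \<and> t \<le> pi / 2 \<and> ereal_tan t = x $ i" for i
          by (rule ereal_tan_cases [of "x $ i"]) blast
      qed
      from choice [OF this]
      obtain t where "\<forall>i. - (pi / 2) \<le> t i \<and> t i \<le> pi / 2 \<and> ereal_tan (t i) = x $ i" ..
      then have "(\<chi> i. t i) \<in> cbox (\<chi> i. - (pi / 2)) (\<chi> i. pi / 2)" "vec_tan (\<chi> i. t i) = x"
        by (simp_all add: mem_box_cart vec_tan_def vec_eq_iff)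
      then show ?thesis by blast
    qed
    then show ?thesis by blast
  qed
  then show ?thesis
    using compact_continuous_image [OF continuous_on_subset [OF continuous_vec_tan subset_UNIV] compact_cbox]
    by metis
qed

lemma uniformly_continuous_arctan_vec:
  "uniformly_continuous_on UNIV (\<lambda>x :: real ^ 'n. \<chi> i. arctan (x $ i))"
proof -
  have lip: "\<bar>arctan a - arctan b\<bar> \<le> \<bar>a - b\<bar>" for a b :: real
  proof -
    have "norm (arctan a - arctan b) \<le> 1 * norm (a - b)"
    proof (rule field_differentiable_bound [of UNIV])
      show "norm (inverse (1 + x\<^sup>2)) \<le> 1" for x :: real
        by (simp add: inverse_le_1_iff)
    qed (auto intro: DERIV_arctan)
    then show ?thesis by simp
  qed
  have "dist (\<chi> i. arctan (x $ i)) (\<chi> i. arctan (y $ i)) \<le> dist x y" for x y :: "real ^ 'n"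
    unfolding dist_vec_def by (intro L2_set_mono) (auto simp: dist_real_def lip)
  then show ?thesis
    unfolding uniformly_continuous_on_def by (blast intro: order_le_less_trans)
qed

section \<open>Compact subsets of the punctured space and their distance from the origin\<close>

lemma open_far: "open {x :: ereal ^ 'n. \<exists>i. ereal R < \<bar>x $ i\<bar>}"
proof -
  have "open (\<Union>i. {x :: ereal ^ 'n. ereal R < \<bar>x $ i\<bar>})"
    by (intro open_UN ballI open_Collect_less continuous_intros)
  also have "(\<Union>i. {x :: ereal ^ 'n. ereal R < \<bar>x $ i\<bar>}) = {x. \<exists>i. ereal R < \<bar>x $ i\<bar>}" by auto
  finally show ?thesis .
qed


text \<open>The open sets on which some coordinate exceeds 1 / Suc n in absolute value increase with
  n and cover the punctured space, so compactness selects one of them.\<close>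

lemma compact_punctured_far:
  fixes K :: "(ereal ^ 'n) set"
  assumes "compact K" "K \<subseteq> punctured"
  obtains \<delta> where "\<delta> > 0" "K \<subseteq> {x. \<exists>i. ereal \<delta> < \<bar>x $ i\<bar>}"
proof -
  let ?U = "\<lambda>n. {x :: ereal ^ 'n. \<exists>i. ereal (1 / Suc n) < \<bar>x $ i\<bar>}"
  have "K \<subseteq> (\<Union>n. ?U n)"
  proof
    fix x assume "x \<in> K"
    then have "x \<noteq> 0" using assms(2) by (auto simp: punctured_def)
    then obtain i where i: "x $ i \<noteq> 0" by (auto simp: vec_eq_iff)
    have "\<exists>n. ereal (1 / Suc n) < \<bar>x $ i\<bar>"
    proof (cases "x $ i")
      case (real r)
      then have "0 < \<bar>r\<bar>" using i by auto
      then obtain n where "1 / Suc n < \<bar>r\<bar>" using nat_approx_posE by blast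
      then show ?thesis using real by auto
    qed auto
    then show "x \<in> (\<Union>n. ?U n)" by blast
  qed
  then obtain I where I: "finite I" "K \<subseteq> (\<Union>n\<in>I. ?U n)"
    by (rule compactE_image [OF assms(1), of UNIV ?U, OF open_far]) blast
  \<comment> \<open>Inserting 0 gives the maximum a meaning when the subcover is empty, which can
    happen for empty K.\<close>
  have "?U n \<subseteq> ?U (Max (insert 0 I))" if "n \<in> I" for n
  proof -
    have "n \<le> Max (insert 0 I)" using that I(1) by simp
    then have "1 / real (Suc (Max (insert 0 I))) \<le> 1 / Suc n" by (intro divide_left_mono) auto
    then have "ereal (1 / Suc (Max (insert 0 I))) \<le> ereal (1 / Suc n)" by simp
    then show ?thesis using order_le_less_trans by blast
  qed
  then have "K \<subseteq> ?U (Max (insert 0 I))" using I(2) by blast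
  then show ?thesis by (intro that [of "1 / Suc (Max (insert 0 I))"]) auto
qed

lemma compact_far:
  assumes "\<delta> > 0"
  shows "compact {x :: ereal ^ 'n. \<exists>i. ereal \<delta> \<le> \<bar>x $ i\<bar>}" "{x :: ereal ^ 'n. \<exists>i. ereal \<delta> \<le> \<bar>x $ i\<bar>} \<in> sets borel" "{x :: ereal ^ 'n. \<exists>i. ereal \<delta> \<le> \<bar>x $ i\<bar>} \<subseteq> punctured"
proof -
  have "closed (\<Union>i. {x :: ereal ^ 'n. ereal \<delta> \<le> \<bar>x $ i\<bar>})"
    by (intro closed_UN ballI closed_Collect_le continuous_intros) auto
  also have "(\<Union>i. {x :: ereal ^ 'n. ereal \<delta> \<le> \<bar>x $ i\<bar>}) = {x. \<exists>i. ereal \<delta> \<le> \<bar>x $ i\<bar>}" by auto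
  finally have cl: "closed {x :: ereal ^ 'n. \<exists>i. ereal \<delta> \<le> \<bar>x $ i\<bar>}" .
  then show "{x :: ereal ^ 'n. \<exists>i. ereal \<delta> \<le> \<bar>x $ i\<bar>} \<in> sets borel" by (rule borel_closed)
  show "compact {x :: ereal ^ 'n. \<exists>i. ereal \<delta> \<le> \<bar>x $ i\<bar>}"
    using compact_Int_closed [OF compact_ereal_vec cl] by simp
  show "{x :: ereal ^ 'n. \<exists>i. ereal \<delta> \<le> \<bar>x $ i\<bar>} \<subseteq> punctured"
    using assms by (auto simp: punctured_def)
qed

section \<open>Test functions as functions of finite vectors\<close>

lemma open_punctured: "open (punctured :: (ereal ^ 'n) set)"
proof -
  have "closed {x :: ereal ^ 'n. x = 0}"
    unfolding vec_eq_iff by (intro closed_Collect_all closed_Collect_eq continuous_intros)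
  then show ?thesis unfolding punctured_def by (simp add: open_Diff)
qed

text \<open>The value of a test function at the origin is arbitrary; 0 is the choice that makes the
  pullback continuous.\<close>

definition pull :: "(ereal ^ 'n \<Rightarrow> real) \<Rightarrow> real ^ 'n \<Rightarrow> real" where
  "pull f z = (if z = 0 then 0 else f (ext_vec z))"

text \<open>Compactness keeps the support away from 0, so the function vanishes on a punctured
  neighbourhood of 0, and the extension is continuous on each of two open sets that cover the
  space.\<close>

lemma test_function_extend:
  fixes f :: "ereal ^ 'n \<Rightarrow> real"
  assumes "f \<in> test_functions punctured"
  shows "continuous_on UNIV (\<lambda>x. if x = 0 then 0 else f x)"
proof -
  obtain K where K: "compact K" "K \<subseteq> punctured" "\<And>x. x \<in> punctured - K \<Longrightarrow> f x = 0"
    and f: "continuous_on punctured f"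
    using assms by (auto simp: test_functions_def)
  obtain \<delta> where d: "\<delta> > 0" "K \<subseteq> {x. \<exists>i. ereal \<delta> < \<bar>x $ i\<bar>}"
    using compact_punctured_far [OF K(1,2)] by blast
  let ?f = "\<lambda>x. if x = 0 then 0 else f x"
  let ?V = "{x :: ereal ^ 'n. \<not> (\<exists>i. ereal (\<delta> / 2) \<le> \<bar>x $ i\<bar>)}"
  have V: "open ?V"
  proof -
    have "closed (\<Union>i. {x :: ereal ^ 'n. ereal (\<delta> / 2) \<le> \<bar>x $ i\<bar>})"
      by (intro closed_UN ballI closed_Collect_le continuous_intros) auto
    then have "open (- (\<Union>i. {x :: ereal ^ 'n. ereal (\<delta> / 2) \<le> \<bar>x $ i\<bar>}))" by blast
    moreover have "- (\<Union>i. {x :: ereal ^ 'n. ereal (\<delta> / 2) \<le> \<bar>x $ i\<bar>}) = ?V" by auto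
    ultimately show ?thesis by simp
  qed
  have "?f x = 0" if "x \<in> ?V" for x
  proof (cases "x = 0")
    case False
    have "x \<notin> K"
    proof
      assume "x \<in> K"
      then obtain i where "ereal \<delta> < \<bar>x $ i\<bar>" using d(2) by blast
      moreover have "ereal (\<delta> / 2) \<le> ereal \<delta>" using d(1) by simp
      ultimately show False using that by (metis (mono_tags, lifting) mem_Collect_eq order_le_less_trans order_less_imp_le)
    qed
    then show ?thesis using K(3) False by (simp add: punctured_def)
  qed simp
  then have "continuous_on ?V ?f"
    by (subst continuous_on_cong [OF refl, where g = "\<lambda>_. 0"]) auto
  moreover have "continuous_on punctured ?f"
    using f by (subst continuous_on_cong [OF refl, where g = f]) (auto simp: punctured_def)
  ultimately have "continuous_on (?V \<union> punctured) ?f"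
    by (intro continuous_on_open_Un V open_punctured)
  moreover have "?V \<union> punctured = UNIV"
    using d(1) by (auto simp: punctured_def)
  ultimately show ?thesis by simp
qed

lemma pull_eq: "pull f z = (\<lambda>x. if x = 0 then 0 else f x) (ext_vec z)"
  using ext_vec_inj [of z 0] by (simp add: pull_def)

text \<open>Composed with \<open>vec_tan\<close> the extended test function is continuous on a
  compact cube, and the arctangent is 1-Lipschitz. Uniformity over the whole space is what later
  allows a sum to be replaced by its largest term, however large that term is.\<close>

lemma uniformly_continuous_pull:
  assumes "f \<in> test_functions punctured"
  shows "uniformly_continuous_on UNIV (pull f)"
proof -
  let ?f = "\<lambda>x. if x = 0 then 0 else f x"
  let ?B = "cbox (\<chi> i. - (pi / 2)) (\<chi> i. pi / 2) :: (real ^ 'a) set"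
  have "continuous_on ?B (\<lambda>t. ?f (vec_tan t))"
    by (rule continuous_on_compose2 [OF test_function_extend [OF assms]
          continuous_on_subset [OF continuous_vec_tan]]) auto
  then have "uniformly_continuous_on ?B (\<lambda>t. ?f (vec_tan t))"
    by (rule compact_uniformly_continuous) (rule compact_cbox)
  moreover have "(\<lambda>x :: real ^ 'a. \<chi> i. arctan (x $ i)) ` UNIV \<subseteq> ?B"
    using arctan_in_cbox by auto
  ultimately have "uniformly_continuous_on ((\<lambda>x :: real ^ 'a. \<chi> i. arctan (x $ i)) ` UNIV) (\<lambda>t. ?f (vec_tan t))"
    unfolding uniformly_continuous_on_def by (fast dest: subsetD)
  then have "uniformly_continuous_on UNIV (\<lambda>x. ?f (vec_tan (\<chi> i. arctan (x $ i))))"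
    by (rule uniformly_continuous_on_compose [OF uniformly_continuous_arctan_vec])
  then show ?thesis by (simp only: vec_tan_arctan pull_eq [abs_def])
qed

lemma bounded_pull:
  assumes "f \<in> test_functions punctured"
  obtains G where "G > 0" "\<And>z. \<bar>pull f z\<bar> \<le> G"
proof -
  let ?f = "\<lambda>x. if x = 0 then 0 else f x"
  have "bounded (?f ` UNIV)"
    by (intro compact_imp_bounded compact_continuous_image test_function_extend assms compact_ereal_vec)
  then obtain G where "G > 0" "\<And>x. \<bar>?f x\<bar> \<le> G"
    by (auto simp: bounded_pos)
  then show ?thesis by (intro that [of G]) (simp_all only: pull_eq)
qed

lemma pull_vanishes:
  assumes "f \<in> test_functions punctured"
  obtains \<delta> where "\<delta> > 0" "\<And>z. norm z \<le> \<delta> \<Longrightarrow> pull f z = 0"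
proof -
  obtain K where K: "compact K" "K \<subseteq> punctured" "\<And>x. x \<in> punctured - K \<Longrightarrow> f x = 0"
    using assms by (auto simp: test_functions_def)
  obtain \<delta> where d: "\<delta> > 0" "K \<subseteq> {x. \<exists>i. ereal \<delta> < \<bar>x $ i\<bar>}"
    using compact_punctured_far [OF K(1,2)] by blast
  have "pull f z = 0" if "norm z \<le> \<delta>" for z
  proof (cases "z = 0")
    case False
    have "ext_vec z \<notin> K"
    proof
      assume "ext_vec z \<in> K"
      then obtain i where "\<delta> < \<bar>z $ i\<bar>" using d(2) by (auto simp: ext_vec_def)
      then show False using that component_le_norm_cart [of z i] by simp
    qed
    then show ?thesis
      using K(3) [of "ext_vec z"] False ext_vec_inj [of z 0] by (simp add: punctured_def pull_def)
  qed (simp add: pull_def)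
  with d(1) show ?thesis by (rule that)
qed

section \<open>Integrals of test functions against scaled laws and against \<mu>\<close>

lemma scale_measure_eq_density: "scale_measure (ennreal r) M = density M (\<lambda>_. ennreal r)"
  by (rule measure_eqI) (auto simp: emeasure_density_const)

text \<open>The value c = 0 is covered: the scaled measure is then null and the quotient is 0 by the
  convention on division.\<close>

lemma integral_scaled_law:
  assumes X: "X \<in> borel_measurable M" and c: "c \<ge> 0"
    and f: "f \<in> test_functions punctured"
  shows "integral\<^sup>L (scaled_law M X c u) f = (\<integral>\<omega>. pull f (X \<omega> /\<^sub>R u) \<partial>M) / c"
proof -
  let ?f = "\<lambda>x. if x = 0 then 0 else f x"
  have f0: "?f \<in> borel_measurable borel"
    by (intro borel_measurable_continuous_onI test_function_extend f)
  have m: "(\<lambda>\<omega>. ext_vec (X \<omega> /\<^sub>R u)) \<in> borel_measurable M"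
    using X by measurable
  let ?L = "distr M borel (\<lambda>\<omega>. ext_vec (X \<omega> /\<^sub>R u))"
  have fr: "f \<in> borel_measurable (restrict_space ?L punctured)"
  proof -
    have "?f \<in> borel_measurable (restrict_space ?L punctured)"
      using f0 by (intro measurable_restrict_space1) simp
    then show ?thesis
      by (rule measurable_cong [THEN iffD1, rotated]) (auto simp: space_restrict_space punctured_def)
  qed
  have "integral\<^sup>L (scaled_law M X c u) f = (\<integral>x. (1 / c) *\<^sub>R f x \<partial>restrict_space ?L punctured)"
    unfolding scaled_law_def scale_measure_eq_density
    by (rule integral_density) (use fr c in auto)
  also have "\<dots> = (1 / c) * (\<integral>x. f x \<partial>restrict_space ?L punctured)" by simp
  also have "(\<integral>x. f x \<partial>restrict_space ?L punctured) = (\<integral>x. indicator punctured x *\<^sub>R f x \<partial>?L)"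
    by (rule integral_restrict_space) simp
  also have "\<dots> = (\<integral>x. ?f x \<partial>?L)"
    by (intro Bochner_Integration.integral_cong) (auto simp: punctured_def)
  also have "\<dots> = (\<integral>\<omega>. ?f (ext_vec (X \<omega> /\<^sub>R u)) \<partial>M)"
    by (rule integral_distr [OF m f0])
  finally show ?thesis by (simp only: pull_eq) simp
qed

text \<open>The points at infinity are null for \<mu>, so sending them to 0 through
  \<open>fin_part\<close> does not change the integral.\<close>

lemma integral_punctured:
  assumes sets: "sets \<mu> = sets (restrict_space borel punctured)"
    and null: "emeasure \<mu> (punctured - range ext_vec) = 0"
    and f: "f \<in> test_functions punctured"
  shows "integral\<^sup>L \<mu> f = integral\<^sup>L (distr \<mu> borel fin_part) (pull f)"
proof -
  have space: "space \<mu> = punctured" using sets_eq_imp_space_eq [OF sets] by (simp add: space_restrict_space)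
  have fin: "fin_part \<in> measurable \<mu> borel"
    by (subst measurable_cong_sets [OF sets refl]) (intro measurable_restrict_space1 fin_part_measurable)
  have pm: "pull f \<in> borel_measurable borel"
    by (intro borel_measurable_continuous_onI uniformly_continuous_imp_continuous uniformly_continuous_pull f)
  have "punctured - range ext_vec \<in> null_sets \<mu>"
    using null by (auto simp: null_sets_def sets sets_restrict_space_iff)
  then have "AE x in \<mu>. x \<notin> punctured - range ext_vec" by (rule AE_not_in)
  then have ae: "AE x in \<mu>. f x = pull f (fin_part x)"
    using AE_space
    by eventually_elim (auto simp: space pull_def punctured_def ext_vec_inj [of _ 0, simplified])
  have fm: "f \<in> borel_measurable \<mu>"
  proof -
    have "(\<lambda>x. if x = 0 then 0 else f x) \<in> borel_measurable \<mu>"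
      by (subst measurable_cong_sets [OF sets refl])
        (intro measurable_restrict_space1 borel_measurable_continuous_onI test_function_extend f)
    then show ?thesis
      by (rule measurable_cong [THEN iffD1, rotated]) (auto simp: space punctured_def)
  qed
  have "integral\<^sup>L \<mu> f = (\<integral>x. pull f (fin_part x) \<partial>\<mu>)"
    by (rule integral_cong_AE [OF fm _ ae]) (rule measurable_compose [OF fin pm])
  also have "\<dots> = integral\<^sup>L (distr \<mu> borel fin_part) (pull f)"
    by (rule integral_distr [OF fin pm, symmetric])
  finally show ?thesis .
qed

section \<open>Extending functions of finite vectors to the points at infinity\<close>

lemma continuous_fin_part: "continuous_on (range ext_vec) (fin_part :: ereal ^ 'n \<Rightarrow> _)"
proof -
  have "continuous_on (range ext_vec) (\<lambda>x :: ereal ^ 'n. \<chi> i. real_of_ereal (x $ i))"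
    by (intro continuous_intros continuous_on_compose2 [OF continuous_on_real])
      (auto simp: ext_vec_def)
  then show ?thesis
    by (rule continuous_on_eq) (simp add: fin_part_def)
qed

lemma not_in_range_ext_vec: "x \<notin> range ext_vec \<longleftrightarrow> (\<exists>i. \<bar>x $ i\<bar> = \<infinity>)"
  by (simp only: range_ext_vec mem_Collect_eq not_all not_not)

lemma open_range_ext_vec: "open (range ext_vec :: (ereal ^ 'n) set)"
proof -
  have "open (\<Inter>i. {x :: ereal ^ 'n. \<bar>x $ i\<bar> \<noteq> \<infinity>})"
    by (rule open_INT) (auto intro!: open_Collect_neq continuous_intros)
  moreover have "(\<Inter>i. {x :: ereal ^ 'n. \<bar>x $ i\<bar> \<noteq> \<infinity>}) = range ext_vec"
    by (simp add: range_ext_vec Collect_all_eq)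
  ultimately show ?thesis by (simp only:)
qed

lemma far_ext_vec: "ext_vec z \<in> {x. \<exists>i. ereal r < \<bar>x $ i\<bar>} \<Longrightarrow> r < norm z"
  by (auto simp: ext_vec_def intro: order_less_le_trans component_le_norm_cart)

text \<open>Constancy outside a ball permits the extension by k to every point at infinity. The
  vague convergence of the law of Z is applied to functions of this kind; \<open>rv_limit\<close>
  reaches the others by cutting them off.\<close>

lemma test_function_of_eventually_constant:
  fixes g :: "real ^ 'n \<Rightarrow> real"
  assumes g: "continuous_on UNIV g" and \<delta>: "\<delta> > 0"
    and van: "\<And>z. norm z \<le> \<delta> \<Longrightarrow> g z = 0"
    and const: "\<And>z. norm z \<ge> R \<Longrightarrow> g z = k"
  obtains f where "f \<in> test_functions punctured" "pull f = g"
proof -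
  let ?f = "\<lambda>x. if x \<in> range ext_vec then g (fin_part x) else k"
  let ?U = "{x :: ereal ^ 'n. \<exists>i. ereal (max R 0) < \<bar>x $ i\<bar>}"
  \<comment> \<open>If all n coordinates are below \<delta> / n in absolute value, the l1 norm and
    hence the Euclidean norm is at most \<delta>, where g vanishes.\<close>
  let ?K = "{x :: ereal ^ 'n. \<exists>i. ereal (\<delta> / CARD('n)) \<le> \<bar>x $ i\<bar>}"
  have c1: "continuous_on (range ext_vec) ?f"
    by (rule continuous_on_eq [OF continuous_on_compose2 [OF g continuous_fin_part subset_UNIV]])
      (simp only: if_True)
  have c2: "continuous_on ?U ?f"
  proof (rule continuous_on_eq [OF continuous_on_const])
    fix x assume x: "x \<in> ?U"
    show "k = ?f x"
    proof (cases "x \<in> range ext_vec")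
      case True
      then obtain z where z: "x = ext_vec z" by (rule rangeE)
      have "R \<le> norm z" using far_ext_vec [OF x [unfolded z]] by simp
      then have "g z = k" by (rule const)
      then show ?thesis unfolding z by (simp only: rangeI if_True fin_part_ext_vec)
    next
      case False
      then show ?thesis by (simp only: if_False)
    qed
  qed
  have "continuous_on (?U \<union> range ext_vec) ?f"
    by (rule continuous_on_open_Un [OF open_far open_range_ext_vec c2 c1])
  moreover have "x \<in> ?U" if out: "x \<notin> range ext_vec" for x
  proof -
    from not_in_range_ext_vec [THEN iffD1, OF out] obtain i where i: "\<bar>x $ i\<bar> = \<infinity>" ..
    have "ereal (max R 0) < \<bar>x $ i\<bar>" unfolding i by (rule less_ereal.simps(4) [THEN iffD2, OF TrueI])
    then show ?thesis by blast
  qed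
  then have "?U \<union> range ext_vec = UNIV" by (intro set_eqI iffI UNIV_I UnCI)
  ultimately have "continuous_on UNIV ?f" by (simp only:)
  then have c: "continuous_on punctured ?f" by (rule continuous_on_subset) simp
  have d: "\<delta> / CARD('n) > 0" using \<delta> by simp
  have "?f x = 0" if "x \<in> punctured - ?K" for x
  proof -
    have x: "\<bar>x $ i\<bar> < ereal (\<delta> / CARD('n))" for i using that by (auto simp: not_le)
    have "\<bar>x $ i\<bar> \<noteq> \<infinity>" for i using x [of i] by auto
    then have "x \<in> range ext_vec" by (simp add: range_ext_vec)
    then obtain z where z: "x = ext_vec z" by blast
    have "norm z \<le> (\<Sum>i\<in>UNIV. \<bar>z $ i\<bar>)" by (rule norm_le_l1_cart)
    also have "\<dots> \<le> (\<Sum>i\<in>(UNIV :: 'n set). \<delta> / CARD('n))"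
      using x by (intro sum_mono) (auto simp: z ext_vec_def less_imp_le)
    also have "\<dots> = \<delta>" by simp
    finally show ?thesis using van z by simp
  qed
  then have "?f \<in> test_functions punctured"
    unfolding test_functions_def using c compact_far [OF d]
    by (intro CollectI conjI exI [of _ ?K] ballI)
  moreover have "pull ?f = g"
    using van [of 0] \<delta> by (auto simp: pull_def fun_eq_iff)
  ultimately show ?thesis by (rule that)
qed

section \<open>The law of the noise\<close>

definition tail :: "(real ^ 'n) measure \<Rightarrow> real \<Rightarrow> real" where
  "tail D u = measure D {z. norm z > u}"

text \<open>\<open>N\<close> stands for the limit measure on the finite points; the normalisation by \<open>tail\<close> forces
  \<open>N {z. norm z > 1} = 1\<close>.\<close>

locale tail_law = prob_space D for D :: "(real ^ 'p) measure" +
  fixes N :: "(real ^ 'p) measure" and \<alpha> :: real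
  assumes sets_D: "sets D = sets borel" and sets_N: "sets N = sets borel"
    and sigma_finite_N: "sigma_finite_measure N"
    and alpha_pos: "\<alpha> > 0"
    and tail_pos: "tail D u > 0"
    and tail_ratio: "t > 0 \<Longrightarrow> ((\<lambda>u. tail D (t * u) / tail D u) \<longlongrightarrow> t powr - \<alpha>) at_top"
    and N_far: "t > 0 \<Longrightarrow> emeasure N {z. norm z > t} = ennreal (t powr - \<alpha>)"
    and law_limit: "\<lbrakk>continuous_on UNIV g; \<delta> > 0; \<And>z. norm z \<le> \<delta> \<Longrightarrow> g z = 0; \<And>z. \<bar>g z\<bar> \<le> G\<rbrakk> \<Longrightarrow>
      ((\<lambda>u. (\<integral>z. g (z /\<^sub>R u) \<partial>D) / tail D u) \<longlongrightarrow> integral\<^sup>L N g) at_top"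

section \<open>Continuous cutoffs of the norm\<close>

lemma norm_far_borel [measurable]: "{z :: 'a :: real_normed_vector. norm z > t} \<in> sets borel"
  by (intro borel_open open_Collect_less continuous_intros)

text \<open>For s < t this lies between the indicators of norms above t and above s, and it is
  constant outside a ball, so vague convergence applies to it.\<close>

definition ramp :: "real \<Rightarrow> real \<Rightarrow> 'a::real_normed_vector \<Rightarrow> real" where
  "ramp s t z = max 0 (min 1 ((norm z - s) / (t - s)))"

lemma continuous_ramp: "s < t \<Longrightarrow> continuous_on UNIV (ramp s t)"
  unfolding ramp_def by (intro continuous_intros) auto

lemma ramp_measurable [measurable]: "ramp s t \<in> borel_measurable borel"
  unfolding ramp_def by measurable

lemma ramp_eq_0: "s < t \<Longrightarrow> norm z \<le> s \<Longrightarrow> ramp s t z = 0"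
  using divide_nonpos_pos [of "norm z - s" "t - s"] by (simp add: ramp_def)

lemma ramp_eq_1: "s < t \<Longrightarrow> t \<le> norm z \<Longrightarrow> ramp s t z = 1"
  by (simp add: ramp_def)

lemma ramp_bounds: "0 \<le> ramp s t z" "ramp s t z \<le> 1"
  by (simp_all add: ramp_def)

lemma ramp_le_indicator: "s < t \<Longrightarrow> ramp s t z \<le> indicator {z. norm z > s} z"
  using ramp_bounds [of s t z] ramp_eq_0 [of s t z] by (auto simp: indicator_def)

lemma indicator_le_ramp: "s < t \<Longrightarrow> indicator {z. norm z > t} z \<le> ramp s t z"
  using ramp_bounds [of s t z] ramp_eq_1 [of s t z] by (auto simp: indicator_def)

lemma scaleR_far: "u > 0 \<Longrightarrow> norm (z /\<^sub>R u) > t \<longleftrightarrow> norm z > t * u"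
  by (simp add: field_simps)

lemma indicator_scaleR_far: "u > 0 \<Longrightarrow> indicator {z. norm z > t} (z /\<^sub>R u) = indicator {z. norm z > t * u} z"
  using scaleR_far [of u t z] by (simp only: indicator_def mem_Collect_eq)

lemma abs_ramp_le: "\<bar>ramp s t z\<bar> \<le> 1"
  using ramp_bounds [of s t z] by simp

lemma integrable_vanishing:
  fixes g :: "'a :: real_normed_vector \<Rightarrow> real"
  assumes "sets N = sets borel" "emeasure N {z. norm z > \<delta>} < \<infinity>" "g \<in> borel_measurable borel"
    and "\<And>z. norm z \<le> \<delta> \<Longrightarrow> g z = 0" "\<And>z. \<bar>g z\<bar> \<le> G"
  shows "integrable N g"
proof (rule Bochner_Integration.integrable_bound)
  show "integrable N (\<lambda>z. G * indicator {z. norm z > \<delta>} z :: real)"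
    using assms(1,2) by (intro integrable_mult_right) (simp add: integrable_indicator_iff sets_eq_imp_space_eq [OF assms(1)])
  show "g \<in> borel_measurable N" using assms(3) by (simp add: measurable_cong_sets [OF assms(1) refl])
  have "0 \<le> G" using assms(5) [of undefined] by simp
  then have "norm (g z) \<le> norm (G * indicator {z. norm z > \<delta>} z)" for z
    using assms(4) [of z] assms(5) [of z] by (auto simp: indicator_def)
  then show "AE z in N. norm (g z) \<le> norm (G * indicator {z. norm z > \<delta>} z)" by simp
qed

section \<open>From regular variation to \<open>tail_law\<close>\<close>

context
  fixes M :: "'a measure" and Z :: "'a \<Rightarrow> real ^ 'p" and \<mu> :: "(ereal ^ 'p) measure" and \<alpha> :: real
    and D N :: "(real ^ 'p) measure"
  assumes prob: "prob_space M" and rv: "regularly_varying M Z \<mu> \<alpha>"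
  defines "D \<equiv> distr M borel Z" and "N \<equiv> distr \<mu> borel fin_part"
begin

lemma rv_meas: "Z \<in> borel_measurable M"
  and rv_radon: "radon_on punctured \<mu>"
  and rv_nonnull: "emeasure \<mu> punctured \<noteq> 0"
  and rv_null: "emeasure \<mu> (punctured - range ext_vec) = 0"
  and rv_vague: "vague_convergence punctured (\<lambda>u. scaled_law M Z (norm_tail M Z u) u) \<mu> at_top"
  and rv_alpha: "\<alpha> > 0"
  and rv_hom: "u > 0 \<Longrightarrow> B \<in> sets \<mu> \<Longrightarrow>
    emeasure \<mu> ((\<lambda>x. \<chi> i. ereal u * x $ i) ` B) = ennreal (u powr (- \<alpha>)) * emeasure \<mu> B"
  using rv unfolding regularly_varying_def by blast+

lemma rv_sets: "sets \<mu> = sets (restrict_space borel punctured)"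
  using rv_radon by (simp add: radon_on_def)

lemma rv_space: "space \<mu> = punctured"
  using sets_eq_imp_space_eq [OF rv_sets] by (simp add: space_restrict_space)

lemma prob_D: "prob_space D"
  unfolding D_def by (rule prob_space.prob_space_distr [OF prob rv_meas])

lemma sets_DN: "sets D = sets borel" "sets N = sets borel"
  by (simp_all add: D_def N_def)

lemma space_DN [simp]: "space D = UNIV" "space N = UNIV"
  by (simp_all add: D_def N_def)

lemma tail_eq: "norm_tail M Z u = tail D u"
  unfolding norm_tail_def tail_def D_def using rv_meas
  by (subst measure_distr) (auto intro!: arg_cong [where f = "measure M"])

text \<open>\<open>fin_part\<close> sends every point at infinity to 0, hence the condition on C:
  away from 0 the preimage consists of finite points only.\<close>

lemma emeasure_N: 
  assumes "C \<in> sets borel" "0 \<notin> C"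
  shows "emeasure N C = emeasure \<mu> (ext_vec ` C)"
proof -
  have fin: "fin_part \<in> measurable \<mu> borel"
    by (subst measurable_cong_sets [OF rv_sets refl]) (intro measurable_restrict_space1 fin_part_measurable)
  have "fin_part -` C \<inter> space \<mu> = ext_vec ` C"
  proof (intro equalityI subsetI)
    fix x assume x: "x \<in> fin_part -` C \<inter> space \<mu>"
    then have "x \<in> range ext_vec" using assms(2) by (auto simp: fin_part_def split: if_splits)
    then show "x \<in> ext_vec ` C" using x by auto
  next
    fix x assume "x \<in> ext_vec ` C"
    then obtain z where z: "z \<in> C" "x = ext_vec z" by (rule imageE) simp
    with assms(2) have "z \<noteq> 0" by auto
    then have "ext_vec z \<noteq> 0" using ext_vec_inj [of z 0] by simp
    with z show "x \<in> fin_part -` C \<inter> space \<mu>" by (simp add: punctured_def rv_space)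
  qed
  then show ?thesis unfolding N_def by (simp add: emeasure_distr [OF fin assms(1)])
qed

lemma ext_vec_image_sets:
  assumes "C \<in> sets borel" "0 \<notin> C"
  shows "ext_vec ` C \<in> sets \<mu>"
proof -
  have z: "ext_vec z \<in> punctured" if "z \<in> C" for z
    using that assms(2) ext_vec_inj [of z 0] by (cases "z = 0") (auto simp: punctured_def)
  have "ext_vec ` C = (fin_part -` C \<inter> space borel) \<inter> range ext_vec"
  proof (intro equalityI subsetI)
    fix x assume "x \<in> (fin_part -` C \<inter> space borel) \<inter> range ext_vec"
    then obtain y where "x = ext_vec y" "fin_part x \<in> C" by (auto elim: rangeE)
    then show "x \<in> ext_vec ` C" by simp
  qed auto
  moreover have "(fin_part -` C \<inter> space borel) \<inter> range ext_vec \<in> sets borel"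
    by (rule sets.Int [OF measurable_sets [OF fin_part_measurable assms(1)] range_ext_vec_borel])
  ultimately have "ext_vec ` C \<in> sets borel" by (simp only:)
  moreover have "ext_vec ` C \<subseteq> punctured" using z by (rule image_subsetI)
  ultimately show ?thesis by (simp add: rv_sets sets_restrict_space_iff)
qed

text \<open>Multiplication by \<open>ereal t\<close> commutes with \<open>ext_vec\<close>, so
  \<open>N\<close> inherits the homogeneity of \<mu>, and its tail at radius 1 determines all
  others.\<close>

lemma N_far_hom:
  assumes "t > 0"
  shows "emeasure N {z. norm z > t} = ennreal (t powr - \<alpha>) * emeasure N {z. norm z > 1}"
proof -
  have "(\<lambda>x. \<chi> i. ereal t * x $ i) ` ext_vec ` {z :: real ^ 'p. norm z > 1} = ext_vec ` (*\<^sub>R) t ` {z. norm z > 1}"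
    by (auto simp: image_image ext_vec_def intro!: image_cong)
  also have "(*\<^sub>R) t ` {z :: real ^ 'p. norm z > 1} = {z. norm z > t}"
  proof (intro equalityI subsetI)
    fix z :: "real ^ 'p" assume "z \<in> {z. norm z > t}"
    then have "z = t *\<^sub>R (z /\<^sub>R t)" "z /\<^sub>R t \<in> {z. norm z > 1}" using assms by (auto simp: field_simps)
    then show "z \<in> (*\<^sub>R) t ` {z. norm z > 1}" by blast
  qed (use assms in auto)
  finally show ?thesis
    using rv_hom [OF assms ext_vec_image_sets [of "{z. norm z > 1}"]] assms
    by (simp add: emeasure_N)
qed

text \<open>A vector in dimension p of norm greater than t has a coordinate of size at least t / p,
  which places the set inside a compact subset of the punctured space.\<close>

lemma N_far_finite:
  assumes "t > 0"
  shows "emeasure N {z. norm z > t} < \<infinity>"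
proof -
  let ?K = "{x :: ereal ^ 'p. \<exists>i. ereal (t / CARD('p)) \<le> \<bar>x $ i\<bar>}"
  have t: "t / CARD('p) > 0" using assms by simp
  have "ext_vec ` {z. norm z > t} \<subseteq> ?K"
  proof
    fix x assume "x \<in> ext_vec ` {z :: real ^ 'p. norm z > t}"
    then obtain z :: "real ^ 'p" where z: "x = ext_vec z" "norm z > t" by blast
    have "\<exists>i. t / CARD('p) \<le> \<bar>z $ i\<bar>"
    proof (rule ccontr)
      assume "\<not> ?thesis"
      then have "(\<Sum>i\<in>UNIV. \<bar>z $ i\<bar>) \<le> (\<Sum>i\<in>(UNIV :: 'p set). t / CARD('p))"
        by (intro sum_mono) (auto simp: not_le less_imp_le)
      then show False using norm_le_l1_cart [of z] z(2) by simp
    qed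
    then show "x \<in> ?K" by (simp add: z(1) ext_vec_def)
  qed
  moreover have "?K \<in> sets \<mu>"
    using compact_far(2,3) [OF t] by (simp add: rv_sets sets_restrict_space_iff)
  ultimately have "emeasure \<mu> (ext_vec ` {z. norm z > t}) \<le> emeasure \<mu> ?K"
    by (rule emeasure_mono)
  also have "\<dots> < \<infinity>"
    using rv_radon compact_far [OF t] by (auto simp: radon_on_def)
  finally show ?thesis using assms by (simp add: emeasure_N)
qed

lemma limit_const:
  assumes "continuous_on UNIV g" "\<delta> > 0" "\<And>z. norm z \<le> \<delta> \<Longrightarrow> g z = 0" "\<And>z. norm z \<ge> R \<Longrightarrow> g z = k"
  shows "((\<lambda>u. (\<integral>z. g (z /\<^sub>R u) \<partial>D) / tail D u) \<longlongrightarrow> integral\<^sup>L N g) at_top"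
proof -
  obtain f where f: "f \<in> test_functions punctured" "pull f = g"
    using test_function_of_eventually_constant [OF assms] by blast
  have "((\<lambda>u. integral\<^sup>L (scaled_law M Z (norm_tail M Z u) u) f) \<longlongrightarrow> integral\<^sup>L \<mu> f) at_top"
    using rv_vague f by (auto simp: vague_convergence_def)
  moreover have "integral\<^sup>L (scaled_law M Z (norm_tail M Z u) u) f = (\<integral>z. g (z /\<^sub>R u) \<partial>D) / tail D u" for u
  proof -
    have "0 \<le> norm_tail M Z u" by (simp add: norm_tail_def)
    from integral_scaled_law [OF rv_meas this f(1), of u] show ?thesis
      unfolding f tail_eq D_def using rv_meas assms(1)
      by (subst integral_distr) (auto intro!: borel_measurable_continuous_onI continuous_intros continuous_on_compose2 [OF assms(1)])
  qed
  moreover have "integral\<^sup>L \<mu> f = integral\<^sup>L N g"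
    unfolding N_def integral_punctured [OF rv_sets rv_null f(1)] f(2) ..
  ultimately show ?thesis by simp
qed

lemma limit_ramp: "0 < s \<Longrightarrow> s < t \<Longrightarrow>
    ((\<lambda>u. (\<integral>z. ramp s t (z /\<^sub>R u) \<partial>D) / tail D u) \<longlongrightarrow> integral\<^sup>L N (ramp s t)) at_top"
  by (rule limit_const [where R = t and k = 1]) (auto intro: continuous_ramp ramp_eq_0 ramp_eq_1)

lemma integrable_ramp: "0 < s \<Longrightarrow> s < t \<Longrightarrow> integrable N (ramp s t)"
  by (rule integrable_vanishing [of _ s _ 1])
    (use ramp_bounds [of s t] N_far_finite [of s] in \<open>simp_all add: sets_DN ramp_eq_0 abs_ramp_le\<close>)

lemma emeasure_N_far_eq: "t > 0 \<Longrightarrow> emeasure N {z. norm z > t} = ennreal (measure N {z. norm z > t})"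
  using N_far_finite by (simp add: emeasure_eq_ennreal_measure less_top)

lemma measure_N_far: "t > 0 \<Longrightarrow> measure N {z. norm z > t} = t powr - \<alpha> * measure N {z. norm z > 1}"
  using N_far_hom [of t] by (simp add: measure_def enn2real_mult)

lemma integral_indicator_far:
  assumes "t > 0" shows "integral\<^sup>L N (indicator {z. norm z > t}) = t powr - \<alpha> * measure N {z. norm z > 1}"
    and "integrable N (indicator {z. norm z > t} :: _ \<Rightarrow> real)"
proof -
  show "integral\<^sup>L N (indicator {z. norm z > t}) = t powr - \<alpha> * measure N {z. norm z > 1}"
    using measure_N_far [OF assms] by (simp add: sets_eq_imp_space_eq [OF sets_DN(2)])
  show "integrable N (indicator {z. norm z > t} :: _ \<Rightarrow> real)"
    using N_far_finite [OF assms] by (simp add: integrable_indicator_iff sets_eq_imp_space_eq [OF sets_DN(2)] sets_DN)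
qed

lemma ramp_N_bounds:
  assumes "0 < s" "s < t"
  shows "integral\<^sup>L N (ramp s t) \<le> s powr - \<alpha> * measure N {z. norm z > 1}"
    and "t powr - \<alpha> * measure N {z. norm z > 1} \<le> integral\<^sup>L N (ramp s t)"
proof -
  have "integral\<^sup>L N (ramp s t) \<le> integral\<^sup>L N (indicator {z. norm z > s})"
    using assms by (intro integral_mono integrable_ramp integral_indicator_far ramp_le_indicator) auto
  then show "integral\<^sup>L N (ramp s t) \<le> s powr - \<alpha> * measure N {z. norm z > 1}"
    using assms by (simp add: measure_N_far [of s])
  have "integral\<^sup>L N (indicator {z. norm z > t}) \<le> integral\<^sup>L N (ramp s t)"
    using assms by (intro integral_mono integrable_ramp integral_indicator_far indicator_le_ramp) auto
  then show "t powr - \<alpha> * measure N {z. norm z > 1} \<le> integral\<^sup>L N (ramp s t)"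
    using assms by (simp add: measure_N_far [of t])
qed

lemma ramp_D_bounds:
  assumes "0 < s" "s < t" "0 < u"
  shows "(\<integral>z. ramp s t (z /\<^sub>R u) \<partial>D) \<le> tail D (s * u)"
    and "tail D (t * u) \<le> (\<integral>z. ramp s t (z /\<^sub>R u) \<partial>D)"
proof -
  interpret D: prob_space D by (rule prob_D)
  have m: "A \<in> sets borel \<Longrightarrow> A \<in> sets D" for A by (simp add: sets_DN)
  have i: "integrable D (\<lambda>z. ramp s t (z /\<^sub>R u))"
    by (rule D.integrable_const_bound [where B = 1])
      (simp_all add: measurable_cong_sets [OF sets_DN(1) refl] abs_ramp_le)
  have j: "integrable D (indicator {z. norm z > r} :: _ \<Rightarrow> real)" for r
    by (auto intro!: integrable_real_indicator m simp: D.emeasure_eq_measure)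
  have e: "integral\<^sup>L D (indicator {z. norm z > r}) = tail D r" for r
    by (simp add: tail_def sets_eq_imp_space_eq [OF sets_DN(1)])
  have "(\<integral>z. ramp s t (z /\<^sub>R u) \<partial>D) \<le> integral\<^sup>L D (indicator {z. norm z > s * u})"
    by (intro integral_mono i j)
      (simp only: indicator_scaleR_far [OF assms(3), symmetric] ramp_le_indicator [OF assms(2)])
  then show "(\<integral>z. ramp s t (z /\<^sub>R u) \<partial>D) \<le> tail D (s * u)" by (simp only: e)
  have "integral\<^sup>L D (indicator {z. norm z > t * u}) \<le> (\<integral>z. ramp s t (z /\<^sub>R u) \<partial>D)"
    by (intro integral_mono i j)
      (simp only: indicator_scaleR_far [OF assms(3), symmetric] indicator_le_ramp [OF assms(2)])
  then show "tail D (t * u) \<le> (\<integral>z. ramp s t (z /\<^sub>R u) \<partial>D)" by (simp only: e)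
qed

section \<open>Limits of tail ratios and the normalisation of \<open>N\<close>\<close>

lemma tail_antimono: "u \<le> v \<Longrightarrow> tail D v \<le> tail D u"
proof -
  interpret D: prob_space D by (rule prob_D)
  show "u \<le> v \<Longrightarrow> tail D v \<le> tail D u"
    unfolding tail_def by (intro D.finite_measure_mono) (auto simp: sets_DN)
qed

text \<open>If one tail vanished, so would all later ones, the quotients would be 0 by the
  convention on division, and so would their limit. Homogeneity then makes every tail of
  \<open>N\<close> null; together with the null points at infinity these sets exhaust the space,
  against the non-nullity of \<mu>.\<close>

lemma rv_tail_pos: "tail D u > 0"
proof (rule ccontr)
  assume "\<not> tail D u > 0"
  then have "tail D u \<le> 0" by simp
  then have "tail D v = 0" if "v \<ge> u" for v
    using tail_antimono [OF that] by (auto simp: tail_def intro: antisym)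
  then have "\<forall>\<^sub>F v in at_top. (\<integral>z. ramp 1 2 (z /\<^sub>R v) \<partial>D) / tail D v = 0"
    by (auto simp: eventually_at_top_linorder)
  then have "((\<lambda>v. (\<integral>z. ramp 1 2 (z /\<^sub>R v) \<partial>D) / tail D v) \<longlongrightarrow> 0) at_top"
    by (rule tendsto_eventually)
  then have "integral\<^sup>L N (ramp 1 2) = 0"
    using tendsto_unique [OF _ limit_ramp [of 1 2]] by simp
  then have "2 powr - \<alpha> * measure N {z. norm z > 1} \<le> 0"
    using ramp_N_bounds(2) [of 1 2] by simp
  then have "measure N {z. norm z > 1} = 0"
    by (simp add: mult_le_0_iff antisym)
  then have z: "emeasure N {z. norm z > t} = 0" if "t > 0" for t
    using emeasure_N_far_eq [OF that] measure_N_far [OF that] by simp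
  let ?U = "\<Union>n. ext_vec ` {z :: real ^ 'p. norm z > 1 / Suc n}"
  let ?I = "punctured - range ext_vec :: (ereal ^ 'p) set"
  have "emeasure \<mu> (ext_vec ` {z. norm z > 1 / Suc n}) = 0" for n
    using z [of "1 / Suc n"] by (simp add: emeasure_N)
  then have 0: "emeasure \<mu> ?U = 0"
    by (intro emeasure_UN_eq_0) (auto intro!: ext_vec_image_sets)
  have sub: "punctured \<subseteq> ?U \<union> ?I"
  proof
    fix x :: "ereal ^ 'p" assume x: "x \<in> punctured"
    show "x \<in> ?U \<union> ?I"
    proof (cases "x \<in> range ext_vec")
      case True
      then obtain z where z: "x = ext_vec z" by (rule rangeE)
      then have "0 < norm z" using x by (auto simp: punctured_def)
      then obtain n where "1 / Suc n < norm z" using nat_approx_posE by blast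
      then have "ext_vec z \<in> ext_vec ` {z :: real ^ 'p. norm z > 1 / Suc n}" by (intro imageI CollectI)
      then show ?thesis unfolding z by (intro UnI1 UN_I UNIV_I)
    next
      case False
      then show ?thesis using x by (intro UnI2 DiffI)
    qed
  qed
  have "ext_vec ` {z :: real ^ 'p. norm z > 1 / Suc n} \<in> sets \<mu>" for n
    by (rule ext_vec_image_sets) simp_all
  then have U: "?U \<in> sets \<mu>" by (intro sets.countable_UN) blast
  have "?I \<in> sets borel" by simp
  then have "?I \<in> sets \<mu>" by (auto simp: rv_sets sets_restrict_space_iff)
  note sets = U this
  have "emeasure \<mu> punctured \<le> emeasure \<mu> (?U \<union> ?I)"
    by (rule emeasure_mono [OF sub sets.Un [OF sets]])
  also have "\<dots> \<le> emeasure \<mu> ?U + emeasure \<mu> ?I"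
    by (rule emeasure_subadditive [OF sets])
  finally show False using 0 rv_null rv_nonnull by simp
qed

lemma powr_neg_tendsto:
  assumes "b > (0::real)" shows "((\<lambda>s. c * s powr - \<alpha>) \<longlongrightarrow> c * b powr - \<alpha>) (at b within S)"
  using assms by (intro tendsto_intros) auto

text \<open>A ramp from s to b with s slightly below b dominates the indicator beyond b, and its
  limit is at most the mass outside the unit ball times s^(-\<alpha>), which is close to the value
  at b. \<open>ratio_ge\<close> uses a ramp from b to a slightly larger radius.\<close>

lemma ratio_le:
  assumes "0 < b" "c > measure N {z. norm z > 1} * b powr - \<alpha>"
  shows "\<forall>\<^sub>F u in at_top. tail D (b * u) / tail D u < c"
proof -
  have "\<forall>\<^sub>F s in at_left b. measure N {z. norm z > 1} * s powr - \<alpha> < c \<and> s < b \<and> 0 < s"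
    by (intro eventually_conj order_tendstoD(2) [OF powr_neg_tendsto] assms)
      (use assms in \<open>auto simp: eventually_at_left_field intro: exI [of _ 0]\<close>)
  then obtain s where s: "measure N {z. norm z > 1} * s powr - \<alpha> < c" "s < b" "0 < s"
    using eventually_happens [of _ "at_left b"] by (auto simp: trivial_limit_at_left_real)
  have "integral\<^sup>L N (ramp s b) < c" using ramp_N_bounds(1) [of s b] s by (simp add: mult.commute)
  then have "\<forall>\<^sub>F u in at_top. (\<integral>z. ramp s b (z /\<^sub>R u) \<partial>D) / tail D u < c"
    using limit_ramp [of s b] s by (intro order_tendstoD) auto
  then show ?thesis
    using eventually_gt_at_top [of 0]
  proof eventually_elim
    case (elim u)
    have "tail D (b * u) / tail D u \<le> (\<integral>z. ramp s b (z /\<^sub>R u) \<partial>D) / tail D u"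
      using ramp_D_bounds(2) [of s b u] s elim rv_tail_pos [of u] by (intro divide_right_mono) auto
    then show ?case using elim by linarith
  qed
qed

lemma ratio_ge:
  assumes "0 < b" "c < measure N {z. norm z > 1} * b powr - \<alpha>"
  shows "\<forall>\<^sub>F u in at_top. c < tail D (b * u) / tail D u"
proof -
  have "\<forall>\<^sub>F s in at_right b. c < measure N {z. norm z > 1} * s powr - \<alpha> \<and> b < s"
    by (intro eventually_conj order_tendstoD(1) [OF powr_neg_tendsto] assms eventually_at_right_less)
  then obtain s where s: "c < measure N {z. norm z > 1} * s powr - \<alpha>" "b < s"
    using eventually_happens [of _ "at_right b"] by (auto simp: trivial_limit_at_right_real)
  have "c < integral\<^sup>L N (ramp b s)" using ramp_N_bounds(2) [of b s] s assms by (simp add: mult.commute)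
  then have "\<forall>\<^sub>F u in at_top. c < (\<integral>z. ramp b s (z /\<^sub>R u) \<partial>D) / tail D u"
    using limit_ramp [of b s] s assms by (intro order_tendstoD) auto
  then show ?thesis
    using eventually_gt_at_top [of 0]
  proof eventually_elim
    case (elim u)
    have "(\<integral>z. ramp b s (z /\<^sub>R u) \<partial>D) / tail D u \<le> tail D (b * u) / tail D u"
      using ramp_D_bounds(1) [of b s u] s assms elim rv_tail_pos [of u] by (intro divide_right_mono) auto
    then show ?case using elim by linarith
  qed
qed

lemma ratio_tendsto:
  "0 < b \<Longrightarrow> ((\<lambda>u. tail D (b * u) / tail D u) \<longlongrightarrow> measure N {z. norm z > 1} * b powr - \<alpha>) at_top"
  by (rule order_tendstoI) (auto intro: ratio_le ratio_ge)

text \<open>For b = 1 the tail ratio is constantly 1, so the normalisation by the tail of Z fixes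
  this mass.\<close>

lemma measure_N_1: "measure N {z. norm z > 1} = 1"
proof -
  have "((\<lambda>u. tail D (1 * u) / tail D u) \<longlongrightarrow> 1) at_top"
  proof (intro tendsto_eventually always_eventually allI)
    show "tail D (1 * u) / tail D u = 1" for u using rv_tail_pos [of u] by simp
  qed
  then show ?thesis using tendsto_unique [OF _ ratio_tendsto [of 1]] by simp
qed

text \<open>A cutoff makes g vanish outside a ball, where \<open>limit_const\<close> applies. The
  error is at most G times the tail beyond R, which after normalisation contributes about
  \<open>G * R powr - \<alpha>\<close> on both sides of the limit, and this tends to 0 as R
  grows.\<close>

lemma rv_limit:
  assumes g: "continuous_on UNIV g" "\<delta> > 0" "\<And>z. norm z \<le> \<delta> \<Longrightarrow> g z = 0" "\<And>z. \<bar>g z\<bar> \<le> G"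
  shows "((\<lambda>u. (\<integral>z. g (z /\<^sub>R u) \<partial>D) / tail D u) \<longlongrightarrow> integral\<^sup>L N g) at_top"
proof (rule tendstoI)
  interpret D: prob_space D by (rule prob_D)
  fix e :: real assume e: "e > 0"
  have G: "0 \<le> G" using g(4) [of 0] by simp
  have "((\<lambda>R. G * R powr - \<alpha>) \<longlongrightarrow> 0) at_top"
    using rv_alpha by (intro tendsto_mult_right_zero tendsto_neg_powr filterlim_ident) auto
  then have "\<forall>\<^sub>F R in at_top. G * R powr - \<alpha> < e / 3 \<and> R > 0"
    using e by (intro eventually_conj eventually_gt_at_top order_tendstoD(2)) auto
  then obtain R where R: "G * R powr - \<alpha> < e / 3" "R > 0"
    using eventually_happens by fastforce
  let ?h = "\<lambda>z. g z * (1 - ramp R (R + 1) z)"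
  have gm: "g \<in> borel_measurable borel" by (rule borel_measurable_continuous_onI [OF g(1)])
  have h: "((\<lambda>u. (\<integral>z. ?h (z /\<^sub>R u) \<partial>D) / tail D u) \<longlongrightarrow> integral\<^sup>L N ?h) at_top"
    by (rule limit_const [where R = "R + 1" and k = 0])
      (use g in \<open>auto intro!: continuous_intros continuous_ramp simp: ramp_eq_1\<close>)
  have le: "\<bar>g z - ?h z\<bar> \<le> G * indicator {z. norm z > R} z" for z
  proof -
    have "\<bar>g z - ?h z\<bar> = \<bar>g z\<bar> * ramp R (R + 1) z"
      using ramp_bounds [of R "R + 1" z] by (simp add: algebra_simps abs_mult)
    also have "\<dots> \<le> G * indicator {z. norm z > R} z"
      using g(4) [of z] ramp_bounds [of R "R + 1" z] ramp_le_indicator [of R "R + 1" z] G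
      by (intro mult_mono) auto
    finally show ?thesis .
  qed
  have hb: "\<bar>?h z\<bar> \<le> G" for z
    using mult_mono [OF g(4) [of z], of "\<bar>1 - ramp R (R + 1) z\<bar>" 1] ramp_bounds [of R "R + 1" z] G
    by (simp add: abs_mult)
  have gi: "integrable N g"
    by (rule integrable_vanishing [OF sets_DN(2) N_far_finite [OF g(2)] gm g(3,4)])
  have hi: "integrable N ?h"
    by (rule integrable_vanishing [OF sets_DN(2) N_far_finite [OF g(2)] _ _ hb]) (use gm g(3) in auto)
  have N: "\<bar>integral\<^sup>L N g - integral\<^sup>L N ?h\<bar> < e / 3"
  proof -
    have "\<bar>integral\<^sup>L N g - integral\<^sup>L N ?h\<bar> = \<bar>\<integral>z. g z - ?h z \<partial>N\<bar>"
      using gi hi by (subst Bochner_Integration.integral_diff) auto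
    also have "\<dots> \<le> (\<integral>z. \<bar>g z - ?h z\<bar> \<partial>N)" by (rule integral_abs_bound)
    also have "\<dots> \<le> (\<integral>z. G * indicator {z. norm z > R} z \<partial>N)"
      by (intro integral_mono integrable_abs Bochner_Integration.integrable_diff gi hi le
          integrable_mult_right integral_indicator_far R)
    also have "\<dots> = G * R powr - \<alpha>"
      using integral_indicator_far(1) [OF R(2)] measure_N_1 by simp
    finally show ?thesis using R(1) by simp
  qed
  have Dm: "f \<in> borel_measurable borel \<Longrightarrow> f \<in> borel_measurable D" for f :: "real ^ 'p \<Rightarrow> real"
    by (simp add: measurable_cong_sets [OF sets_DN(1) refl])
  have "((\<lambda>u. G * (tail D (R * u) / tail D u)) \<longlongrightarrow> G * R powr - \<alpha>) at_top"
    using ratio_tendsto [OF R(2)] measure_N_1 by (intro tendsto_mult_left) simp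
  then have "\<forall>\<^sub>F u in at_top. G * (tail D (R * u) / tail D u) < e / 3"
    using R(1) by (rule order_tendstoD)
  moreover have "\<forall>\<^sub>F u in at_top. dist ((\<integral>z. ?h (z /\<^sub>R u) \<partial>D) / tail D u) (integral\<^sup>L N ?h) < e / 3"
    using e by (intro tendstoD [OF h]) auto
  ultimately show "\<forall>\<^sub>F u in at_top. dist ((\<integral>z. g (z /\<^sub>R u) \<partial>D) / tail D u) (integral\<^sup>L N g) < e"
    using eventually_gt_at_top [of 0]
  proof eventually_elim
    case (elim u)
    have gi: "integrable D (\<lambda>z. g (z /\<^sub>R u))"
      by (rule D.integrable_const_bound [where B = G]) (use g(4) gm in \<open>auto intro!: Dm\<close>)
    have hi: "integrable D (\<lambda>z. ?h (z /\<^sub>R u))"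
      by (rule D.integrable_const_bound [where B = G]) (use hb gm in \<open>auto intro!: Dm\<close>)
    have ii: "integrable D (indicator {z. norm z > R * u} :: _ \<Rightarrow> real)"
      by (auto intro!: integrable_real_indicator simp: D.emeasure_eq_measure sets_DN)
    have "\<bar>(\<integral>z. g (z /\<^sub>R u) \<partial>D) - (\<integral>z. ?h (z /\<^sub>R u) \<partial>D)\<bar> = \<bar>\<integral>z. g (z /\<^sub>R u) - ?h (z /\<^sub>R u) \<partial>D\<bar>"
      using gi hi by (subst Bochner_Integration.integral_diff) auto
    also have "\<dots> \<le> (\<integral>z. \<bar>g (z /\<^sub>R u) - ?h (z /\<^sub>R u)\<bar> \<partial>D)" by (rule integral_abs_bound)
    also have "\<dots> \<le> (\<integral>z. G * indicator {z. norm z > R * u} z \<partial>D)"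
    proof (intro integral_mono integrable_abs Bochner_Integration.integrable_diff gi hi integrable_mult_right ii)
      show "\<bar>g (z /\<^sub>R u) - ?h (z /\<^sub>R u)\<bar> \<le> G * indicator {z. norm z > R * u} z" for z
        using le [of "z /\<^sub>R u"] scaleR_far [OF elim(3), of R z] by (simp add: indicator_def)
    qed
    also have "\<dots> = G * tail D (R * u)"
      by (simp add: tail_def sets_eq_imp_space_eq [OF sets_DN(1)])
    finally have "\<bar>(\<integral>z. g (z /\<^sub>R u) \<partial>D) - (\<integral>z. ?h (z /\<^sub>R u) \<partial>D)\<bar> / tail D u \<le> G * tail D (R * u) / tail D u"
      using rv_tail_pos [of u] by (intro divide_right_mono) auto
    then have "\<bar>(\<integral>z. g (z /\<^sub>R u) \<partial>D) / tail D u - (\<integral>z. ?h (z /\<^sub>R u) \<partial>D) / tail D u\<bar> < e / 3"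
      using elim(1) rv_tail_pos [of u] unfolding diff_divide_distrib [symmetric] abs_divide
      by (simp only: abs_of_pos times_divide_eq_right)
    then show ?case using elim(2) N unfolding dist_real_def by linarith
  qed
qed

lemma rv_tail_law: "tail_law D N \<alpha>"
proof (intro tail_law.intro prob_D tail_law_axioms.intro)
  show "t > 0 \<Longrightarrow> emeasure N {z. norm z > t} = ennreal (t powr - \<alpha>)" for t
    using emeasure_N_far_eq [of t] measure_N_far [of t] measure_N_1 by simp
  show "sigma_finite_measure N"
    unfolding N_def by (rule radon_distr_fin_part(1) [OF rv_radon rv_null])
  show "((\<lambda>u. tail D (t * u) / tail D u) \<longlongrightarrow> t powr - \<alpha>) at_top" if "t > 0" for t
    using ratio_tendsto [OF that] measure_N_1 by simp
  show "((\<lambda>u. (\<integral>z. g (z /\<^sub>R u) \<partial>D) / tail D u) \<longlongrightarrow> integral\<^sup>L N g) at_top"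
    if "continuous_on UNIV g" "\<delta> > 0" "\<And>z. norm z \<le> \<delta> \<Longrightarrow> g z = 0" "\<And>z. \<bar>g z\<bar> \<le> G" for g \<delta> G
    using that by (rule rv_limit)
qed (rule sets_DN rv_alpha rv_tail_pos)+

end

section \<open>Potter bounds and truncated moments\<close>

lemma dyadic_bracket:
  assumes "(1::real) \<le> y"
  obtains k :: nat where "2 ^ k \<le> y" "y < 2 ^ Suc k"
proof -
  define k where "k = nat \<lfloor>log 2 y\<rfloor>"
  have "0 \<le> log 2 y" using assms by simp
  then have k: "real k \<le> log 2 y" "log 2 y < real k + 1"
    unfolding k_def by linarith+
  have "2 powr real k \<le> y" using k(1) assms by (simp add: le_log_iff)
  moreover have "y < 2 powr (real k + 1)" using k(2) assms by (simp add: log_less_iff)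
  ultimately show ?thesis
    by (intro that [of k]) (simp_all add: powr_realpow powr_add)
qed

lemma powr_minus_mult_le:
  fixes x :: real
  assumes "x > 0" "x powr - s * A \<le> B"
  shows "A \<le> x powr s * B"
proof -
  have "x powr s * (x powr - s * A) \<le> x powr s * B" by (rule mult_left_mono [OF assms(2)]) simp
  then show ?thesis using assms(1) by (simp add: mult.assoc [symmetric] powr_add [symmetric])
qed

lemma term_le_suminf_ennreal: "(f k :: ennreal) \<le> (\<Sum>k. f k)"
  using sum_le_suminf [of f "{k}"] by simp

lemma suminf_geometric_ennreal:
  assumes "0 \<le> K" "0 \<le> q" "q < 1"
  shows "(\<Sum>k. ennreal (K * q ^ k)) = ennreal (K / (1 - q))"
proof -
  have "(\<lambda>k. K * q ^ k) sums (K * (1 / (1 - q)))"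
    using assms by (intro sums_mult geometric_sums) auto
  then show ?thesis
    using assms by (subst suminf_ennreal2) (auto simp: sums_iff)
qed

context tail_law
begin

declare sets_D [simp, measurable_cong] sets_N [simp, measurable_cong]

lemma space_D [simp]: "space D = UNIV" and space_N [simp]: "space N = UNIV"
  using sets_eq_imp_space_eq [OF sets_D] sets_eq_imp_space_eq [OF sets_N] by simp_all

abbreviation T where "T \<equiv> tail D"

lemma T_antimono: "u \<le> v \<Longrightarrow> T v \<le> T u"
  unfolding tail_def by (intro finite_measure_mono) auto

lemma T_le_1: "T u \<le> 1"
  unfolding tail_def by simp

lemma T_double:
  assumes "0 < \<eta>"
  obtains u0 where "u0 \<ge> 1" "\<And>u. u \<ge> u0 \<Longrightarrow> 2 powr - (\<alpha> + \<eta>) * T u \<le> T (2 * u)"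
    "\<And>u. u \<ge> u0 \<Longrightarrow> T (2 * u) \<le> 2 powr - (\<alpha> - \<eta>) * T u"
proof -
  have r: "((\<lambda>u. T (2 * u) / T u) \<longlongrightarrow> 2 powr - \<alpha>) at_top" by (rule tail_ratio) simp
  have "2 powr - (\<alpha> + \<eta>) < 2 powr - \<alpha>" "2 powr - \<alpha> < 2 powr - (\<alpha> - \<eta>)"
    using assms by (intro powr_less_mono; simp)+
  from order_tendstoD(1) [OF r this(1)] order_tendstoD(2) [OF r this(2)]
  have "\<forall>\<^sub>F u in at_top. 2 powr - (\<alpha> + \<eta>) < T (2 * u) / T u \<and> T (2 * u) / T u < 2 powr - (\<alpha> - \<eta>)"
    by eventually_elim simp
  then obtain u0 where u0: "\<And>u. u \<ge> u0 \<Longrightarrow>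
      2 powr - (\<alpha> + \<eta>) < T (2 * u) / T u \<and> T (2 * u) / T u < 2 powr - (\<alpha> - \<eta>)"
    unfolding eventually_at_top_linorder by blast
  show ?thesis
  proof (rule that [of "max u0 1"])
    fix u assume "max u0 1 \<le> u"
    then have "2 powr - (\<alpha> + \<eta>) < T (2 * u) / T u" "T (2 * u) / T u < 2 powr - (\<alpha> - \<eta>)"
      using u0 [of u] by auto
    then show "2 powr - (\<alpha> + \<eta>) * T u \<le> T (2 * u)" "T (2 * u) \<le> 2 powr - (\<alpha> - \<eta>) * T u"
      using tail_pos [of u] by (simp_all only: less_divide_eq divide_less_eq if_True less_imp_le)
  qed simp
qed

text \<open>The two powers serve the two regimes of the scale a: the exponent \<alpha> - \<eta>
  dominates for a < 1 and \<alpha> + \<eta> for a > 1.\<close>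

definition wt :: "real \<Rightarrow> real \<Rightarrow> real" where
  "wt \<eta> a = a powr (\<alpha> - \<eta>) + a powr (\<alpha> + \<eta>)"

lemma wt_nonneg [simp]: "0 \<le> wt \<eta> a"
  by (simp add: wt_def)

lemma wt_measurable [measurable]: "wt \<eta> \<in> borel_measurable borel"
  unfolding wt_def by measurable

lemma wt_0 [simp]: "wt \<eta> 0 = 0"
  by (simp add: wt_def)

lemma wt_scale_up:
  assumes "1 \<le> c" "0 \<le> a" "0 \<le> \<eta>"
  shows "wt \<eta> (c * a) \<le> c powr (\<alpha> + \<eta>) * wt \<eta> a"
proof -
  have "c powr (\<alpha> - \<eta>) \<le> c powr (\<alpha> + \<eta>)" using assms by (intro powr_mono) auto
  then have "c powr (\<alpha> - \<eta>) * a powr (\<alpha> - \<eta>) \<le> c powr (\<alpha> + \<eta>) * a powr (\<alpha> - \<eta>)"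
    by (rule mult_right_mono) simp
  then show ?thesis using assms by (simp add: wt_def powr_mult distrib_left)
qed

lemma wt_scale_down:
  assumes "0 < c" "c \<le> 1" "0 \<le> a" "0 \<le> \<eta>"
  shows "wt \<eta> (c * a) \<le> c powr (\<alpha> - \<eta>) * wt \<eta> a"
proof -
  have "c powr (\<alpha> + \<eta>) \<le> c powr (\<alpha> - \<eta>)" using assms by (intro powr_mono') auto
  then have "c powr (\<alpha> + \<eta>) * a powr (\<alpha> + \<eta>) \<le> c powr (\<alpha> - \<eta>) * a powr (\<alpha> + \<eta>)"
    by (rule mult_right_mono) simp
  then show ?thesis using assms by (simp add: wt_def powr_mult distrib_left)
qed

text \<open>The doubling estimates are iterated along powers of 2, with monotonicity of T in
  between; rounding a ratio to a power of 2 costs a factor 2 inside the powers. For a \<le> 1 the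
  level u / a lies above u and the upper estimate applies; for a > 1 it lies below u and the lower
  estimate is solved for \<open>T (u / a)\<close>.\<close>

lemma potter:
  assumes \<eta>: "0 < \<eta>" "\<eta> < \<alpha>"
  obtains C u0 where "C > 0" "u0 \<ge> 1"
    "\<And>u a. u \<ge> u0 \<Longrightarrow> a \<ge> 0 \<Longrightarrow> prob {z. a * norm z > u} \<le> C * T u * wt \<eta> a"
proof -
  obtain u0 where u0: "u0 \<ge> 1" "\<And>u. u \<ge> u0 \<Longrightarrow> 2 powr - (\<alpha> + \<eta>) * T u \<le> T (2 * u)"
    "\<And>u. u \<ge> u0 \<Longrightarrow> T (2 * u) \<le> 2 powr - (\<alpha> - \<eta>) * T u"
    using T_double [OF \<eta>(1)] by blast
  have ge: "2 ^ k * u \<ge> u0" if "u \<ge> u0" for k u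
    using that u0(1) mult_mono [of 1 "2 ^ k" u0 u] by simp
  have lower_pow: "(2 ^ k) powr - (\<alpha> + \<eta>) * T u \<le> T (2 ^ k * u)" if "u \<ge> u0" for k u
  proof (induction k)
    case (Suc k)
    have "(2 ^ Suc k) powr - (\<alpha> + \<eta>) * T u = 2 powr - (\<alpha> + \<eta>) * ((2 ^ k) powr - (\<alpha> + \<eta>) * T u)"
      by (simp add: powr_mult)
    also have "\<dots> \<le> 2 powr - (\<alpha> + \<eta>) * T (2 ^ k * u)" by (intro mult_left_mono Suc) simp
    also have "\<dots> \<le> T (2 * (2 ^ k * u))" by (intro u0(2) ge that)
    finally show ?case by (simp add: mult.assoc)
  qed simp
  have upper_pow: "T (2 ^ k * u) \<le> (2 ^ k) powr - (\<alpha> - \<eta>) * T u" if "u \<ge> u0" for k u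
  proof (induction k)
    case (Suc k)
    have "T (2 * (2 ^ k * u)) \<le> 2 powr - (\<alpha> - \<eta>) * T (2 ^ k * u)" by (intro u0(3) ge that)
    also have "\<dots> \<le> 2 powr - (\<alpha> - \<eta>) * ((2 ^ k) powr - (\<alpha> - \<eta>) * T u)" by (intro mult_left_mono Suc) simp
    also have "\<dots> = (2 ^ Suc k) powr - (\<alpha> - \<eta>) * T u" by (simp add: powr_mult)
    finally show ?case by (simp add: mult.assoc)
  qed simp
  have lower: "(2 * s) powr - (\<alpha> + \<eta>) * T u \<le> T (s * u)" if "u \<ge> u0" "s \<ge> 1" for s u
  proof -
    obtain k where k: "2 ^ k \<le> s" "s < 2 ^ Suc k" using dyadic_bracket [OF \<open>s \<ge> 1\<close>] .
    have "(2 * s) powr - (\<alpha> + \<eta>) \<le> (2 ^ Suc k) powr - (\<alpha> + \<eta>)"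
      using k \<eta> by (intro powr_mono2') auto
    then have "(2 * s) powr - (\<alpha> + \<eta>) * T u \<le> (2 ^ Suc k) powr - (\<alpha> + \<eta>) * T u"
      using tail_pos [of u] by (intro mult_right_mono) auto
    also have "\<dots> \<le> T (2 ^ Suc k * u)" by (rule lower_pow [OF \<open>u \<ge> u0\<close>])
    also have "\<dots> \<le> T (s * u)" using k that u0(1) by (intro T_antimono mult_right_mono) auto
    finally show ?thesis .
  qed
  have upper: "T (s * u) \<le> (s / 2) powr - (\<alpha> - \<eta>) * T u" if "u \<ge> u0" "s \<ge> 1" for s u
  proof -
    obtain k where k: "2 ^ k \<le> s" "s < 2 ^ Suc k" using dyadic_bracket [OF \<open>s \<ge> 1\<close>] .
    have "T (s * u) \<le> T (2 ^ k * u)" using k that u0(1) by (intro T_antimono mult_right_mono) auto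
    also have "\<dots> \<le> (2 ^ k) powr - (\<alpha> - \<eta>) * T u" by (rule upper_pow [OF \<open>u \<ge> u0\<close>])
    also have "\<dots> \<le> (s / 2) powr - (\<alpha> - \<eta>) * T u"
      using k \<eta> that tail_pos [of u] by (intro mult_right_mono powr_mono2') auto
    finally show ?thesis .
  qed
  \<comment> \<open>Division by \<open>T u0\<close> pays for levels u / a below u0, where no
    doubling estimate holds: there the probability is bounded by 1, and the lower estimate from u0
    to u shows that \<open>C * a powr (\<alpha> + \<eta>) * T u\<close> is at least 1.\<close>
  define C where "C = 2 powr (\<alpha> + \<eta>) / T u0"
  have C: "C > 0" "2 powr (\<alpha> + \<eta>) \<le> C" "2 powr (\<alpha> - \<eta>) \<le> C"
  proof -
    show "C > 0" using tail_pos by (simp add: C_def)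
    show *: "2 powr (\<alpha> + \<eta>) \<le> C"
      using tail_pos [of u0] T_le_1 [of u0] by (simp add: C_def pos_le_divide_eq)
    show "2 powr (\<alpha> - \<eta>) \<le> C"
      using \<eta> by (intro order_trans [OF _ *] powr_mono) auto
  qed
  have main: "T (u / a) \<le> C * T u * wt \<eta> a" if u: "u \<ge> u0" and a: "a > 0" for u a
  proof (cases "a \<le> 1")
    case True
    have "T (u / a) \<le> (1 / a / 2) powr - (\<alpha> - \<eta>) * T u"
      using upper [OF u, of "1 / a"] True a by simp
    also have "(1 / a / 2) powr - (\<alpha> - \<eta>) = 2 powr (\<alpha> - \<eta>) * a powr (\<alpha> - \<eta>)"
    proof -
      have "1 / a / 2 = inverse (2 * a)" by (simp add: field_simps)
      then show ?thesis
        using a by (simp only: inverse_powr powr_minus inverse_inverse_eq powr_mult)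
    qed
    also have "\<dots> \<le> C * wt \<eta> a"
      using C by (intro mult_mono) (auto simp: wt_def)
    finally show ?thesis using tail_pos [of u] by (simp add: mult_ac mult_right_mono)
  next
    case False
    have "T (u / a) \<le> C * a powr (\<alpha> + \<eta>) * T u"
    proof (cases "u / a \<ge> u0")
      case True
      have "(2 * a) powr - (\<alpha> + \<eta>) * T (u / a) \<le> T u"
        using lower [OF True, of a] False by simp
      then have "T (u / a) \<le> (2 * a) powr (\<alpha> + \<eta>) * T u"
        using a by (intro powr_minus_mult_le) auto
      also have "\<dots> = 2 powr (\<alpha> + \<eta>) * a powr (\<alpha> + \<eta>) * T u"
        using a by (simp add: powr_mult)
      also have "\<dots> \<le> C * a powr (\<alpha> + \<eta>) * T u"
        using C(2) tail_pos [of u] by (intro mult_right_mono) auto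
      finally show ?thesis .
    next
      case far: False
      have "u / u0 \<le> a" using far a u0(1) by (simp add: divide_simps mult.commute)
      have "(2 * a) powr - (\<alpha> + \<eta>) * T u0 \<le> (2 * (u / u0)) powr - (\<alpha> + \<eta>) * T u0"
        using \<open>u / u0 \<le> a\<close> u u0(1) \<eta> tail_pos [of u0]
        by (intro mult_right_mono powr_mono2') auto
      also have "\<dots> \<le> T u"
        using lower [of u0 "u / u0"] u u0(1) by simp
      finally have "T u0 \<le> (2 * a) powr (\<alpha> + \<eta>) * T u"
        using a by (intro powr_minus_mult_le) auto
      then have "1 \<le> (2 * a) powr (\<alpha> + \<eta>) * T u / T u0"
        using tail_pos [of u0] by simp
      also have "\<dots> = C * a powr (\<alpha> + \<eta>) * T u"
        using a by (simp add: powr_mult C_def)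
      finally show ?thesis using T_le_1 [of "u / a"] by linarith
    qed
    also have "\<dots> \<le> C * wt \<eta> a * T u"
      using C(1) tail_pos [of u] by (intro mult_right_mono mult_left_mono) (auto simp: wt_def)
    finally show ?thesis by (simp add: mult_ac)
  qed
  show ?thesis
  proof (rule that [OF C(1) u0(1)])
    fix u a :: real assume ua: "u \<ge> u0" "a \<ge> 0"
    show "prob {z. a * norm z > u} \<le> C * T u * wt \<eta> a"
    proof (cases "a = 0")
      case True
      then show ?thesis using ua u0(1) by simp
    next
      case False
      then have "{z :: real ^ 'p. a * norm z > u} = {z. norm z > u / a}"
        using ua by (simp add: divide_simps mult.commute)
      then show ?thesis using main [of u a] ua False by (simp add: tail_def)
    qed
  qed
qed

text \<open>Potter's bound read backwards: for a = u / u0 its left side is the constant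
  \<open>T u0\<close>, so T(u) decays no faster than u^(-(\<alpha> + \<eta>)) up to a constant, and
  \<eta> can be taken with \<alpha> + \<eta> < q.\<close>

lemma T_poly_lower:
  assumes "q > \<alpha>"
  shows "((\<lambda>u. u powr - q / T u) \<longlongrightarrow> 0) at_top"
proof -
  define \<eta> where "\<eta> = min ((q - \<alpha>) / 2) (\<alpha> / 2)"
  have \<eta>: "0 < \<eta>" "\<eta> < \<alpha>" "\<alpha> + \<eta> < q" using assms alpha_pos by (auto simp: \<eta>_def min_def field_simps)
  obtain C u0 where C: "C > 0" "u0 \<ge> 1"
    "\<And>u a. u \<ge> u0 \<Longrightarrow> a \<ge> 0 \<Longrightarrow> prob {z. a * norm z > u} \<le> C * T u * wt \<eta> a"
    using potter [OF \<eta>(1,2)] by blast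
  let ?K = "2 * C / T u0"
  have "((\<lambda>u. ?K * u powr - (q - (\<alpha> + \<eta>))) \<longlongrightarrow> 0) at_top"
    using \<eta> by (intro tendsto_mult_right_zero tendsto_neg_powr filterlim_ident) auto
  note lim = this
  have "\<forall>\<^sub>F u in at_top. u powr - q / T u \<le> ?K * u powr - (q - (\<alpha> + \<eta>))"
    using eventually_ge_at_top [of u0]
  proof eventually_elim
    case (elim u)
    have u: "u \<ge> 1" "u / u0 \<le> u" "1 \<le> u / u0"
      using elim C(2) by (simp_all add: divide_simps mult_le_cancel_left1)
    have "T u0 = prob {z. u / u0 * norm z > u}"
      unfolding tail_def using u elim C(2)
      by (intro arg_cong [where f = prob]) (auto simp: field_simps)
    also have "\<dots> \<le> C * T u * wt \<eta> (u / u0)" using u by (intro C(3) elim) auto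
    also have "\<dots> \<le> C * T u * (2 * u powr (\<alpha> + \<eta>))"
    proof -
      have "(u / u0) powr (\<alpha> - \<eta>) \<le> u powr (\<alpha> - \<eta>)" "(u / u0) powr (\<alpha> + \<eta>) \<le> u powr (\<alpha> + \<eta>)"
        using u \<eta> by (intro powr_mono2; simp)+
      moreover have "u powr (\<alpha> - \<eta>) \<le> u powr (\<alpha> + \<eta>)" using u \<eta> by (intro powr_mono) auto
      ultimately have "wt \<eta> (u / u0) \<le> 2 * u powr (\<alpha> + \<eta>)" unfolding wt_def by linarith
      then show ?thesis using C(1) tail_pos [of u] by (intro mult_left_mono) auto
    qed
    finally have "1 / T u \<le> ?K * u powr (\<alpha> + \<eta>)"
      using tail_pos [of u] tail_pos [of u0] by (simp add: divide_simps mult_ac)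
    then have "u powr - q * (1 / T u) \<le> u powr - q * (?K * u powr (\<alpha> + \<eta>))"
      by (rule mult_left_mono) simp
    also have "\<dots> = ?K * u powr - (q - (\<alpha> + \<eta>))"
      by (simp add: powr_add [symmetric] algebra_simps)
    finally show ?case by simp
  qed
  from tendsto_sandwich [OF always_eventually this tendsto_const lim]
  show ?thesis using tail_pos by (simp add: less_imp_le)
qed

text \<open>A form of Karamata's theorem by dyadic shells below u. Where a |z| lies between u /
  2^(k+1) and u / 2^k, the power is at most \<open>(u / 2 ^ k) powr \<beta>\<close>, and Potter's
  bound at scale 2^(k+1) a controls the probability. The shells form a geometric series of ratio
  2^(\<alpha> + \<eta> - \<beta>) < 1.\<close>

lemma truncated_moment:
  assumes \<eta>: "0 < \<eta>" "\<eta> < \<alpha>" and \<beta>: "\<alpha> + \<eta> < \<beta>"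
  obtains C u0 where "C > 0" "u0 \<ge> 1"
    "\<And>u a. u \<ge> u0 \<Longrightarrow> a \<ge> 0 \<Longrightarrow>
      (\<integral>\<^sup>+z. ennreal ((a * norm z) powr \<beta> * indicator {z. a * norm z \<le> u} z) \<partial>D)
        \<le> ennreal (C * u powr \<beta> * T u * wt \<eta> a)"
proof -
  obtain C u0 where C: "C > 0" "u0 \<ge> 1"
    "\<And>u a. u \<ge> u0 \<Longrightarrow> a \<ge> 0 \<Longrightarrow> prob {z. a * norm z > u} \<le> C * T u * wt \<eta> a"
    using potter [OF \<eta>] by blast
  define q where "q = 2 powr (\<alpha> + \<eta> - \<beta>)"
  define K where "K = C * 2 powr (\<alpha> + \<eta>)"
  have q: "0 < q" "q < 1" using \<beta> by (auto simp: q_def powr_less_one)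
  have K: "K > 0" using C(1) by (simp add: K_def)
  show ?thesis
  proof (rule that [of "K / (1 - q)" u0])
    fix u a :: real assume u: "u \<ge> u0" and a: "a \<ge> 0"
    have u0: "u > 0" using u C(2) by linarith
    let ?f = "\<lambda>k z. ennreal ((u / 2 ^ k) powr \<beta> * indicator {z. (2 ^ Suc k * a) * norm z > u} z)"
    have pw: "ennreal ((a * norm z) powr \<beta> * indicator {z. a * norm z \<le> u} z) \<le> (\<Sum>k. ?f k z)" for z :: "real ^ 'p"
    proof (cases "0 < a * norm z \<and> a * norm z \<le> u")
      case True
      then have "1 \<le> u / (a * norm z)" by simp
      then obtain k where k: "2 ^ k \<le> u / (a * norm z)" "u / (a * norm z) < 2 ^ Suc k"
        by (rule dyadic_bracket)
      have "a * norm z \<le> u / 2 ^ k" "(2 ^ Suc k * a) * norm z > u"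
        using k True by (simp_all add: field_simps)
      then have "(a * norm z) powr \<beta> * indicator {z. a * norm z \<le> u} z
          \<le> (u / 2 ^ k) powr \<beta> * indicator {z. (2 ^ Suc k * a) * norm z > u} z"
        using True \<beta> \<eta> by (auto intro!: powr_mono2)
      then have "ennreal ((a * norm z) powr \<beta> * indicator {z. a * norm z \<le> u} z) \<le> ?f k z"
        by (rule ennreal_leI)
      also have "\<dots> \<le> (\<Sum>k. ?f k z)" by (rule term_le_suminf_ennreal)
      finally show ?thesis .
    next
      case False
      then have "a * norm z = 0 \<or> \<not> a * norm z \<le> u"
        using a mult_nonneg_nonneg [OF a norm_ge_zero [of z]] by linarith
      then have "(a * norm z) powr \<beta> * indicator {z. a * norm z \<le> u} z = 0" by auto
      then show ?thesis by (simp only: ennreal_0 zero_le)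
    qed
    have "(\<integral>\<^sup>+z. ennreal ((a * norm z) powr \<beta> * indicator {z. a * norm z \<le> u} z) \<partial>D)
        \<le> (\<integral>\<^sup>+z. (\<Sum>k. ?f k z) \<partial>D)" by (rule nn_integral_mono) (rule pw)
    also have "\<dots> = (\<Sum>k. \<integral>\<^sup>+z. ?f k z \<partial>D)"
      by (rule nn_integral_suminf) measurable
    also have "\<dots> \<le> (\<Sum>k. ennreal (K * u powr \<beta> * T u * wt \<eta> a * q ^ k))"
    proof (intro suminf_le summableI allI)
      fix k
      have "(\<integral>\<^sup>+z. ?f k z \<partial>D) = ennreal ((u / 2 ^ k) powr \<beta>) * emeasure D {z. (2 ^ Suc k * a) * norm z > u}"
        by (simp add: ennreal_mult nn_integral_cmult ennreal_indicator)
      also have "\<dots> = ennreal ((u / 2 ^ k) powr \<beta> * prob {z. (2 ^ Suc k * a) * norm z > u})"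
        by (simp add: emeasure_eq_measure ennreal_mult)
      also have "\<dots> \<le> ennreal (K * u powr \<beta> * T u * wt \<eta> a * q ^ k)"
      proof (rule ennreal_leI)
        have "prob {z. (2 ^ Suc k * a) * norm z > u} \<le> C * T u * wt \<eta> (2 ^ Suc k * a)"
          using a by (intro C(3) u) simp
        also have "\<dots> \<le> C * T u * ((2 ^ Suc k) powr (\<alpha> + \<eta>) * wt \<eta> a)"
          using C(1) tail_pos [of u] a \<eta> one_le_power [of "2::real" "Suc k"]
          by (intro mult_left_mono wt_scale_up) auto
        finally have "(u / 2 ^ k) powr \<beta> * prob {z. (2 ^ Suc k * a) * norm z > u}
            \<le> (u / 2 ^ k) powr \<beta> * (C * T u * ((2 ^ Suc k) powr (\<alpha> + \<eta>) * wt \<eta> a))"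
          by (rule mult_left_mono) simp
        also have "\<dots> = K * u powr \<beta> * T u * wt \<eta> a * ((2 ^ k) powr (\<alpha> + \<eta>) / (2 ^ k) powr \<beta>)"
          using u0 by (simp add: K_def powr_divide powr_mult)
        also have "(2 ^ k) powr (\<alpha> + \<eta>) / (2 ^ k) powr \<beta> = q ^ k"
          by (simp add: q_def powr_diff [symmetric] powr_realpow [symmetric] powr_powr algebra_simps)
        finally show "(u / 2 ^ k) powr \<beta> * prob {z. (2 ^ Suc k * a) * norm z > u}
            \<le> K * u powr \<beta> * T u * wt \<eta> a * q ^ k" .
      qed
      finally show "(\<integral>\<^sup>+z. ?f k z \<partial>D) \<le> ennreal (K * u powr \<beta> * T u * wt \<eta> a * q ^ k)" .
    qed
    also have "\<dots> = ennreal (K * u powr \<beta> * T u * wt \<eta> a / (1 - q))"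
      using K q tail_pos [of u] by (intro suminf_geometric_ennreal) auto
    finally show "(\<integral>\<^sup>+z. ennreal ((a * norm z) powr \<beta> * indicator {z. a * norm z \<le> u} z) \<partial>D)
        \<le> ennreal (K / (1 - q) * u powr \<beta> * T u * wt \<eta> a)" by simp
  qed (use K q C(2) in auto)
qed

text \<open>The counterpart of \<open>truncated_moment\<close> with shells above u; the ratio is now
  2^(\<gamma> - (\<alpha> - \<eta>)) < 1.\<close>

lemma tail_moment:
  assumes \<eta>: "0 < \<eta>" "\<eta> < \<alpha>" and \<gamma>: "0 \<le> \<gamma>" "\<gamma> < \<alpha> - \<eta>"
  obtains C u0 where "C > 0" "u0 \<ge> 1"
    "\<And>u a. u \<ge> u0 \<Longrightarrow> a \<ge> 0 \<Longrightarrow>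
      (\<integral>\<^sup>+z. ennreal ((a * norm z) powr \<gamma> * indicator {z. a * norm z > u} z) \<partial>D)
        \<le> ennreal (C * u powr \<gamma> * T u * wt \<eta> a)"
proof -
  obtain C u0 where C: "C > 0" "u0 \<ge> 1"
    "\<And>u a. u \<ge> u0 \<Longrightarrow> a \<ge> 0 \<Longrightarrow> prob {z. a * norm z > u} \<le> C * T u * wt \<eta> a"
    using potter [OF \<eta>] by blast
  define q where "q = 2 powr (\<gamma> - (\<alpha> - \<eta>))"
  define K where "K = C * 2 powr (\<alpha> + \<eta>) * 2 powr \<gamma>"
  have q: "0 < q" "q < 1" using \<gamma> by (auto simp: q_def powr_less_one)
  have K: "K > 0" using C(1) by (simp add: K_def)
  show ?thesis
  proof (rule that [of "K / (1 - q)" u0])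
    fix u a :: real assume u: "u \<ge> u0" and a: "a \<ge> 0"
    have u0: "u > 0" using u C(2) by linarith
    \<comment> \<open>On shell k only the weak inequality a |z| \<ge> 2^k u is known. Doubling a
      makes it strict, as Potter's bound requires, and contributes the factor
      \<open>2 powr (\<alpha> + \<eta>)\<close> of K.\<close>
    let ?f = "\<lambda>k z. ennreal ((2 ^ Suc k * u) powr \<gamma> * indicator {z. (1 / 2 ^ k * (2 * a)) * norm z > u} z)"
    have pw: "ennreal ((a * norm z) powr \<gamma> * indicator {z. a * norm z > u} z) \<le> (\<Sum>k. ?f k z)" for z :: "real ^ 'p"
    proof (cases "a * norm z > u")
      case True
      then have "1 \<le> a * norm z / u" using u0 by simp
      then obtain k where k: "2 ^ k \<le> a * norm z / u" "a * norm z / u < 2 ^ Suc k"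
        by (rule dyadic_bracket)
      have "u * 2 ^ k < 2 * (a * norm z)" using k u0 by (simp add: field_simps)
      then have "a * norm z \<le> 2 ^ Suc k * u" "(1 / 2 ^ k * (2 * a)) * norm z > u"
        using k u0 by (simp_all add: field_simps)
      then have "(a * norm z) powr \<gamma> * indicator {z. a * norm z > u} z
          \<le> (2 ^ Suc k * u) powr \<gamma> * indicator {z. (1 / 2 ^ k * (2 * a)) * norm z > u} z"
        using True \<gamma> a by (auto intro!: powr_mono2)
      then have "ennreal ((a * norm z) powr \<gamma> * indicator {z. a * norm z > u} z) \<le> ?f k z"
        by (rule ennreal_leI)
      also have "\<dots> \<le> (\<Sum>k. ?f k z)" by (rule term_le_suminf_ennreal)
      finally show ?thesis .
    qed simp
    have "(\<integral>\<^sup>+z. ennreal ((a * norm z) powr \<gamma> * indicator {z. a * norm z > u} z) \<partial>D)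
        \<le> (\<integral>\<^sup>+z. (\<Sum>k. ?f k z) \<partial>D)" by (rule nn_integral_mono) (rule pw)
    also have "\<dots> = (\<Sum>k. \<integral>\<^sup>+z. ?f k z \<partial>D)"
      by (rule nn_integral_suminf) measurable
    also have "\<dots> \<le> (\<Sum>k. ennreal (K * u powr \<gamma> * T u * wt \<eta> a * q ^ k))"
    proof (intro suminf_le summableI allI)
      fix k
      have "(\<integral>\<^sup>+z. ?f k z \<partial>D) = ennreal ((2 ^ Suc k * u) powr \<gamma>) * emeasure D {z. (1 / 2 ^ k * (2 * a)) * norm z > u}"
        by (simp add: ennreal_mult nn_integral_cmult ennreal_indicator)
      also have "\<dots> = ennreal ((2 ^ Suc k * u) powr \<gamma> * prob {z. (1 / 2 ^ k * (2 * a)) * norm z > u})"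
        by (simp add: emeasure_eq_measure ennreal_mult)
      also have "\<dots> \<le> ennreal (K * u powr \<gamma> * T u * wt \<eta> a * q ^ k)"
      proof (rule ennreal_leI)
        have "prob {z. (1 / 2 ^ k * (2 * a)) * norm z > u} \<le> C * T u * wt \<eta> (1 / 2 ^ k * (2 * a))"
          using a by (intro C(3) u) simp
        also have "\<dots> \<le> C * T u * ((1 / 2 ^ k) powr (\<alpha> - \<eta>) * wt \<eta> (2 * a))"
          using C(1) tail_pos [of u] a \<eta>
          by (intro mult_left_mono wt_scale_down) auto
        also have "\<dots> \<le> C * T u * ((1 / 2 ^ k) powr (\<alpha> - \<eta>) * (2 powr (\<alpha> + \<eta>) * wt \<eta> a))"
          using C(1) tail_pos [of u] a \<eta>
          by (intro mult_left_mono wt_scale_up) auto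
        finally have "(2 ^ Suc k * u) powr \<gamma> * prob {z. (1 / 2 ^ k * (2 * a)) * norm z > u}
            \<le> (2 ^ Suc k * u) powr \<gamma> * (C * T u * ((1 / 2 ^ k) powr (\<alpha> - \<eta>) * (2 powr (\<alpha> + \<eta>) * wt \<eta> a)))"
          by (rule mult_left_mono) simp
        also have "\<dots> = K * u powr \<gamma> * T u * wt \<eta> a * ((2 ^ k) powr \<gamma> / (2 ^ k) powr (\<alpha> - \<eta>))"
          using u0 by (simp add: K_def powr_divide powr_mult)
        also have "(2 ^ k) powr \<gamma> / (2 ^ k) powr (\<alpha> - \<eta>) = q ^ k"
          by (simp add: q_def powr_diff [symmetric] powr_realpow [symmetric] powr_powr algebra_simps)
        finally show "(2 ^ Suc k * u) powr \<gamma> * prob {z. (1 / 2 ^ k * (2 * a)) * norm z > u}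
            \<le> K * u powr \<gamma> * T u * wt \<eta> a * q ^ k" .
      qed
      finally show "(\<integral>\<^sup>+z. ?f k z \<partial>D) \<le> ennreal (K * u powr \<gamma> * T u * wt \<eta> a * q ^ k)" .
    qed
    also have "\<dots> = ennreal (K * u powr \<gamma> * T u * wt \<eta> a / (1 - q))"
      using K q tail_pos [of u] by (intro suminf_geometric_ennreal) auto
    finally show "(\<integral>\<^sup>+z. ennreal ((a * norm z) powr \<gamma> * indicator {z. a * norm z > u} z) \<partial>D)
        \<le> ennreal (K / (1 - q) * u powr \<gamma> * T u * wt \<eta> a)" by simp
  qed (use K q C(2) in auto)
qed

lemma moment_finite:
  assumes "0 < \<gamma>" "\<gamma> < \<alpha>"
  shows "(\<integral>\<^sup>+z. ennreal (norm z powr \<gamma>) \<partial>D) < \<infinity>"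
proof -
  define \<eta> where "\<eta> = (\<alpha> - \<gamma>) / 2"
  have \<eta>: "0 < \<eta>" "\<eta> < \<alpha>" "\<gamma> < \<alpha> - \<eta>" using assms by (auto simp: \<eta>_def field_simps)
  obtain C u0 where C: "u0 \<ge> 1" 
    "\<And>u a. u \<ge> u0 \<Longrightarrow> a \<ge> 0 \<Longrightarrow>
      (\<integral>\<^sup>+z. ennreal ((a * norm z) powr \<gamma> * indicator {z. a * norm z > u} z) \<partial>D)
        \<le> ennreal (C * u powr \<gamma> * T u * wt \<eta> a)"
    by (rule tail_moment [OF \<eta>(1,2) less_imp_le [OF assms(1)] \<eta>(3)]) blast
  have "(\<integral>\<^sup>+z. ennreal (norm z powr \<gamma>) \<partial>D)
      \<le> (\<integral>\<^sup>+z. ennreal (u0 powr \<gamma>) + ennreal ((1 * norm z) powr \<gamma> * indicator {z. 1 * norm z > u0} z) \<partial>D)"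
  proof (rule nn_integral_mono)
    fix z :: "real ^ 'p"
    have "norm z powr \<gamma> \<le> u0 powr \<gamma> + (1 * norm z) powr \<gamma> * indicator {z. 1 * norm z > u0} z"
      using assms C(1) by (cases "norm z > u0") (auto intro!: powr_mono2)
    then show "ennreal (norm z powr \<gamma>) \<le> ennreal (u0 powr \<gamma>) + ennreal ((1 * norm z) powr \<gamma> * indicator {z. 1 * norm z > u0} z)"
      by (simp add: ennreal_plus [symmetric] ennreal_leI del: ennreal_plus)
  qed
  also have "\<dots> = ennreal (u0 powr \<gamma>) + (\<integral>\<^sup>+z. ennreal ((1 * norm z) powr \<gamma> * indicator {z. 1 * norm z > u0} z) \<partial>D)"
    by (subst nn_integral_add) (auto simp: emeasure_eq_measure prob_space [unfolded space_D])
  also have "\<dots> < \<infinity>"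
    using C(2) [of u0 1] by (auto simp: less_top [symmetric] top_unique)
  finally show ?thesis .
qed

end

section \<open>Predictable sums\<close>

text \<open>Markov's inequality for \<open>nn_integral\<close> speaks of events
  \<open>1 \<le> c * f\<close>; this brings thresholds into that form.\<close>

lemma one_le_ennreal_mult_iff:
  assumes "0 < k" "0 \<le> s"
  shows "1 \<le> ennreal k * ennreal s \<longleftrightarrow> 1 / k \<le> s"
proof -
  have "1 \<le> ennreal k * ennreal s \<longleftrightarrow> ennreal 1 \<le> ennreal (k * s)"
    using assms by (simp only: ennreal_mult ennreal_1 less_imp_le)
  also have "\<dots> \<longleftrightarrow> 1 \<le> k * s" using assms by (intro ennreal_le_iff) simp
  finally show ?thesis using assms by (simp add: divide_le_eq mult.commute)
qed

section \<open>The operator norm and truncated products\<close>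

lemma bounded_linear_mv: "bounded_linear ((*v) (A :: real ^ 'p ^ 'd))"
  by (rule matrix_vector_mul_bounded_linear)

lemma op_norm_nonneg [simp]: "0 \<le> op_norm A"
  unfolding op_norm_def by (rule onorm_pos_le [OF bounded_linear_mv])

lemma norm_mv_le: "norm (A *v z) \<le> op_norm A * norm z"
  unfolding op_norm_def by (rule onorm [OF bounded_linear_mv])

lemma op_norm_triangle: "op_norm (A + B) \<le> op_norm A + op_norm B"
proof -
  have "(*v) (A + B) = (\<lambda>x. A *v x + B *v x)" by (simp add: fun_eq_iff matrix_vector_mult_add_rdistrib)
  then show ?thesis
    unfolding op_norm_def using onorm_triangle [OF bounded_linear_mv [of A] bounded_linear_mv [of B]] by simp
qed

lemma op_norm_le_entries: "op_norm A \<le> (\<Sum>i\<in>UNIV. \<Sum>j\<in>UNIV. \<bar>A $ i $ j\<bar>)"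
  unfolding op_norm_def by (rule onorm_le_matrix_component_sum)

lemma op_norm_0 [simp]: "op_norm (0 :: real ^ 'p ^ 'd) = 0"
proof -
  have "op_norm (0 :: real ^ 'p ^ 'd) \<le> 0" using op_norm_le_entries [of "0 :: real ^ 'p ^ 'd"] by simp
  then show "op_norm (0 :: real ^ 'p ^ 'd) = 0" by (intro antisym op_norm_nonneg)
qed

lemma continuous_op_norm: "continuous_on UNIV (op_norm :: real ^ 'p ^ 'd \<Rightarrow> real)"
proof -
  have *: "\<bar>op_norm A - op_norm B\<bar> \<le> (\<Sum>i\<in>UNIV. \<Sum>j\<in>UNIV. \<bar>(A - B) $ i $ j\<bar>)" for A B :: "real ^ 'p ^ 'd"
    using op_norm_triangle [of "A - B" B] op_norm_triangle [of "B - A" A]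
      op_norm_le_entries [of "A - B"] op_norm_le_entries [of "B - A"]
    by (simp add: abs_minus_commute)
  have "(op_norm \<longlongrightarrow> op_norm B) (at B)" for B :: "real ^ 'p ^ 'd"
  proof (rule LIM_zero_cancel, rule tendsto_rabs_zero_cancel)
    have "((\<lambda>A. \<Sum>i\<in>UNIV. \<Sum>j\<in>UNIV. \<bar>(A - B) $ i $ j\<bar>) \<longlongrightarrow> (\<Sum>i\<in>UNIV. \<Sum>j\<in>UNIV. \<bar>(B - B) $ i $ j\<bar>)) (at B)"
      by (intro tendsto_intros)
    then have "((\<lambda>A. \<Sum>i\<in>UNIV. \<Sum>j\<in>UNIV. \<bar>(A - B) $ i $ j\<bar>) \<longlongrightarrow> 0) (at B)" by simp
    from tendsto_sandwich [OF always_eventually always_eventually tendsto_const this] *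
    show "((\<lambda>A. \<bar>op_norm A - op_norm B\<bar>) \<longlongrightarrow> 0) (at B)" by simp
  qed
  then show ?thesis by (simp add: continuous_on_def)
qed

lemma op_norm_measurable [measurable]: "op_norm \<in> borel_measurable borel"
  by (intro borel_measurable_continuous_onI continuous_op_norm)

lemma mv_measurable [measurable (raw)]:
  fixes f :: "'a \<Rightarrow> real ^ 'p ^ 'd"
  assumes "f \<in> borel_measurable M" "g \<in> borel_measurable M"
  shows "(\<lambda>x. f x *v g x) \<in> borel_measurable M"
proof -
  have "continuous_on UNIV (\<lambda>p :: (real ^ 'p ^ 'd) \<times> (real ^ 'p). fst p *v snd p)"
    unfolding matrix_vector_mult_def by (intro continuous_intros)
  from borel_measurable_continuous_Pair [OF assms, of "\<lambda>a b. a *v b"] this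
  show ?thesis by simp
qed

text \<open>Truncation is decided by \<open>op_norm A * norm z\<close> and not by the norm of the
  image, so that exceedances are events of the kind treated by Potter's bound.\<close>

definition trunc :: "real \<Rightarrow> real ^ 'p ^ 'd \<Rightarrow> real ^ 'p \<Rightarrow> real ^ 'd" where
  "trunc c A z = (if op_norm A * norm z \<le> c then A *v z else 0)"

lemma trunc_measurable [measurable (raw)]:
  assumes [measurable]: "f \<in> borel_measurable M" "g \<in> borel_measurable M"
  shows "(\<lambda>x. trunc c (f x) (g x)) \<in> borel_measurable M"
  unfolding trunc_def by measurable

lemma norm_trunc_le: "0 \<le> c \<Longrightarrow> norm (trunc c A z) \<le> c"
  using norm_mv_le [of A z] by (auto simp: trunc_def intro: order_trans)

lemma norm_trunc_le_indicator: "norm (trunc c A z) \<le> op_norm A * norm z * indicator {z. op_norm A * norm z \<le> c} z"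
  using norm_mv_le [of A z] by (simp add: trunc_def)

lemma trunc_0 [simp]: "trunc c 0 z = 0"
  by (simp add: trunc_def)

lemma trunc_eq: "op_norm A * norm z \<le> c \<Longrightarrow> trunc c A z = A *v z"
  by (simp add: trunc_def)

section \<open>Means and second moments of truncated terms for a frozen coefficient\<close>

context tail_law
begin

text \<open>Evaluated at an \<open>F j\<close>-measurable matrix this is the conditional mean of the
  truncated term, the compensator of the martingale \<open>msum\<close>.\<close>

definition comp :: "real \<Rightarrow> real ^ 'p ^ 'd \<Rightarrow> real ^ 'd" where
  "comp c A = (\<integral>z. trunc c A z \<partial>D)"

text \<open>The uncentred second moment, an upper bound for the conditional variance.\<close>

definition vr :: "real \<Rightarrow> real ^ 'p ^ 'd \<Rightarrow> real" where
  "vr c A = (\<integral>z. (norm (trunc c A z))\<^sup>2 \<partial>D)"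

lemma comp_measurable [measurable]: "comp c \<in> borel_measurable borel"
  unfolding comp_def by measurable

lemma vr_measurable [measurable]: "vr c \<in> borel_measurable borel"
  unfolding vr_def by measurable

lemma comp_0 [simp]: "comp c 0 = 0" and vr_0 [simp]: "vr c 0 = 0"
  by (simp_all add: comp_def vr_def)

lemma vr_nonneg [simp]: "0 \<le> vr c A"
  unfolding vr_def by (rule integral_nonneg_AE) simp

lemma integrable_trunc:
  fixes A :: "real ^ 'p ^ 'd"
  shows "0 \<le> c \<Longrightarrow> integrable D (trunc c A)" "0 \<le> c \<Longrightarrow> integrable D (\<lambda>z. (norm (trunc c A z))\<^sup>2)"
proof -
  have [measurable]: "trunc c A \<in> borel_measurable D" by measurable
  show "0 \<le> c \<Longrightarrow> integrable D (trunc c A)"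
    by (rule integrable_const_bound [where B = c]) (auto simp: norm_trunc_le)
  show "0 \<le> c \<Longrightarrow> integrable D (\<lambda>z. (norm (trunc c A z))\<^sup>2)"
    by (rule integrable_const_bound [where B = "c\<^sup>2"]) (auto simp: norm_trunc_le power_mono)
qed

text \<open>The centred increment has mean 0, so the cross term with s disappears. What remains
  besides the square of s is the variance, which is \<open>vr c A\<close> minus the squared norm of
  \<open>comp c A\<close>.\<close>

lemma frozen_second_moment:
  fixes A :: "real ^ 'p ^ 'd"
  assumes c: "0 \<le> c"
  shows "(\<integral>\<^sup>+z. ennreal ((norm (s + (trunc c A z - comp c A)))\<^sup>2) \<partial>D) \<le> ennreal ((norm s)\<^sup>2 + vr c A)"
proof -
  let ?Y = "trunc c A" let ?b = "comp c A"
  note i [simp] = integrable_trunc [OF c, of A]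
  have eq: "(norm (s + (?Y z - ?b)))\<^sup>2 = (norm (?Y z))\<^sup>2 + 2 * ((s - ?b) \<bullet> ?Y z) + (norm (s - ?b))\<^sup>2" for z
    unfolding power2_norm_eq_inner by (simp add: algebra_simps inner_commute)
  have ii [simp]: "integrable D (\<lambda>z. (s - ?b) \<bullet> ?Y z)" by simp
  have int: "integrable D (\<lambda>z. (norm (s + (?Y z - ?b)))\<^sup>2)"
    unfolding eq by (intro Bochner_Integration.integrable_add integrable_mult_right ii i) simp
  have "(\<integral>\<^sup>+z. ennreal ((norm (s + (?Y z - ?b)))\<^sup>2) \<partial>D) = ennreal (\<integral>z. (norm (s + (?Y z - ?b)))\<^sup>2 \<partial>D)"
    by (rule nn_integral_eq_integral [OF int]) simp
  also have "(\<integral>z. (norm (s + (?Y z - ?b)))\<^sup>2 \<partial>D) = vr c A + 2 * ((s - ?b) \<bullet> ?b) + (norm (s - ?b))\<^sup>2"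
    unfolding eq by (simp add: vr_def comp_def prob_space [unfolded space_D])
  also have "\<dots> = (norm s)\<^sup>2 + vr c A - (norm ?b)\<^sup>2"
    unfolding power2_norm_eq_inner by (simp add: algebra_simps inner_commute)
  also have "ennreal \<dots> \<le> ennreal ((norm s)\<^sup>2 + vr c A)" by (rule ennreal_leI) simp
  finally show ?thesis .
qed

text \<open>The contribution of one term to \<open>tail_bound_L2\<close>: the chance of exceeding c,
  Markov's inequality for the compensator and Chebyshev's for the martingale, both at level x / 2;
  hence 2 / x and \<open>4 / x\<^sup>2\<close>.\<close>

definition cost :: "real \<Rightarrow> real \<Rightarrow> real ^ 'p ^ 'd \<Rightarrow> ennreal" where
  "cost x c A = ennreal (prob {z. op_norm A * norm z > c} + 2 / x * norm (comp c A) + 4 / x\<^sup>2 * vr c A)"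

lemma cost_0 [simp]: "0 \<le> c \<Longrightarrow> cost x c 0 = 0"
  by (simp add: cost_def not_less)

lemma exceed_measurable [measurable]:
  "(\<lambda>A :: real ^ 'p ^ 'd. prob {z. op_norm A * norm z > c}) \<in> borel_measurable borel"
proof -
  have "(\<lambda>A :: real ^ 'p ^ 'd. \<integral>z. (if op_norm A * norm z > c then 1 else 0 :: real) \<partial>D) \<in> borel_measurable borel"
    by measurable
  moreover have "(\<integral>z. (if op_norm A * norm z > c then 1 else 0 :: real) \<partial>D) = prob {z. op_norm A * norm z > c}"
    for A :: "real ^ 'p ^ 'd"
  proof -
    have "(\<lambda>z :: real ^ 'p. if op_norm A * norm z > c then 1 else 0 :: real) = indicator {z. op_norm A * norm z > c}"
      by (simp add: fun_eq_iff indicator_def)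
    then show ?thesis by simp
  qed
  ultimately show ?thesis by simp
qed

lemma cost_eq: "0 < x \<Longrightarrow> cost x c A = ennreal (prob {z. op_norm A * norm z > c}) +
    (ennreal (2 / x) * ennreal (norm (comp c A)) + ennreal (4 / x\<^sup>2) * ennreal (vr c A))"
  unfolding cost_def by (simp add: ennreal_mult [symmetric] ennreal_plus [symmetric] add.assoc del: ennreal_plus)

end

text \<open>The assumption \<open>freeze\<close> is the independence of \<open>F j\<close> and \<open>Z j\<close>, in the form in which
  conditional expectations given \<open>F j\<close> are computed by integrating out \<open>Z j\<close>.\<close>

locale noise = tail_law D N \<alpha> + M: prob_space M
  for D :: "(real ^ 'p) measure" and N :: "(real ^ 'p) measure" and \<alpha> :: real and M :: "'a measure" +
  fixes F :: "nat \<Rightarrow> 'a measure" and Z :: "nat \<Rightarrow> 'a \<Rightarrow> real ^ 'p"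
  assumes subalg: "subalgebra M (F j)"
    and F_mono: "i \<le> j \<Longrightarrow> sets (F i) \<subseteq> sets (F j)"
    and Z_adapted: "Z j \<in> borel_measurable (F (Suc j))"
    and freeze: "\<phi> \<in> borel_measurable (F j \<Otimes>\<^sub>M borel) \<Longrightarrow>
      (\<integral>\<^sup>+\<omega>. \<phi> (\<omega>, Z j \<omega>) \<partial>M) = (\<integral>\<^sup>+\<omega>. \<integral>\<^sup>+z. \<phi> (\<omega>, z) \<partial>D \<partial>M)"
begin

lemma space_F [simp]: "space (F j) = space M"
  using subalg [of j] by (simp add: subalgebra_def)

lemma F_measurable_mono: "f \<in> borel_measurable (F i) \<Longrightarrow> i \<le> j \<Longrightarrow> f \<in> borel_measurable (F j)"
  using F_mono [of i j] by (auto simp: measurable_def)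

lemma F_measurable: "f \<in> borel_measurable (F i) \<Longrightarrow> f \<in> borel_measurable M"
  using subalg [of i] by (rule measurable_from_subalg)

lemma Z_measurable [measurable]: "Z j \<in> borel_measurable M"
  by (rule F_measurable [OF Z_adapted])

lemma Z_measurable_F: "j < n \<Longrightarrow> Z j \<in> borel_measurable (F n)"
  by (rule F_measurable_mono [OF Z_adapted]) simp

section \<open>Partial sums with predictable coefficients\<close>

definition predictable :: "(nat \<Rightarrow> 'a \<Rightarrow> real ^ 'p ^ 'd) \<Rightarrow> bool" where
  "predictable B \<longleftrightarrow> (\<forall>j. B j \<in> borel_measurable (F j))"

lemma predictable_F: "predictable B \<Longrightarrow> j \<le> n \<Longrightarrow> B j \<in> borel_measurable (F n)"
  unfolding predictable_def by (blast intro: F_measurable_mono)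

lemma predictable_M: "predictable B \<Longrightarrow> B j \<in> borel_measurable M"
  unfolding predictable_def by (blast intro: F_measurable)

definition psum :: "(nat \<Rightarrow> 'a \<Rightarrow> real ^ 'p ^ 'd) \<Rightarrow> nat \<Rightarrow> 'a \<Rightarrow> real ^ 'd" where
  "psum B n \<omega> = (\<Sum>j<n. B j \<omega> *v Z j \<omega>)"

definition msum :: "real \<Rightarrow> (nat \<Rightarrow> 'a \<Rightarrow> real ^ 'p ^ 'd) \<Rightarrow> nat \<Rightarrow> 'a \<Rightarrow> real ^ 'd" where
  "msum c B n \<omega> = (\<Sum>j<n. trunc c (B j \<omega>) (Z j \<omega>) - comp c (B j \<omega>))"

lemma psum_measurable_F: "predictable B \<Longrightarrow> m \<le> n \<Longrightarrow> psum B m \<in> borel_measurable (F n)"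
  unfolding psum_def [abs_def]
  by (intro borel_measurable_sum mv_measurable predictable_F Z_measurable_F) auto

lemma psum_measurable: "predictable B \<Longrightarrow> psum B m \<in> borel_measurable M"
  by (rule F_measurable [OF psum_measurable_F [OF _ order_refl]])

lemma msum_measurable_F: "predictable B \<Longrightarrow> m \<le> n \<Longrightarrow> msum c B m \<in> borel_measurable (F n)"
  unfolding msum_def [abs_def]
  by (intro borel_measurable_sum borel_measurable_diff trunc_measurable predictable_F Z_measurable_F
      measurable_compose [OF _ comp_measurable]) auto

lemma msum_measurable: "predictable B \<Longrightarrow> msum c B m \<in> borel_measurable M"
  by (rule F_measurable [OF msum_measurable_F [OF _ order_refl]])

text \<open>Orthogonality of martingale increments, obtained by integrating out the last noise
  vector with the past frozen.\<close>

lemma second_moment: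
  assumes B: "predictable B" and c: "0 \<le> c"
  shows "(\<integral>\<^sup>+\<omega>. ennreal ((norm (msum c B n \<omega>))\<^sup>2) \<partial>M) \<le> (\<Sum>j<n. \<integral>\<^sup>+\<omega>. ennreal (vr c (B j \<omega>)) \<partial>M)"
proof (induction n)
  case (Suc n)
  have [measurable]: "msum c B n \<in> borel_measurable (F n)" "B n \<in> borel_measurable (F n)"
    using B by (auto intro: msum_measurable_F predictable_F)
  have [measurable]: "msum c B n \<in> borel_measurable M" "B n \<in> borel_measurable M"
    using B by (auto intro: msum_measurable predictable_M)
  let ?\<phi> = "\<lambda>(\<omega>, z). ennreal ((norm (msum c B n \<omega> + (trunc c (B n \<omega>) z - comp c (B n \<omega>))))\<^sup>2)"
  have "(\<integral>\<^sup>+\<omega>. ennreal ((norm (msum c B (Suc n) \<omega>))\<^sup>2) \<partial>M) = (\<integral>\<^sup>+\<omega>. ?\<phi> (\<omega>, Z n \<omega>) \<partial>M)"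
    by (simp add: msum_def)
  also have "\<dots> = (\<integral>\<^sup>+\<omega>. \<integral>\<^sup>+z. ?\<phi> (\<omega>, z) \<partial>D \<partial>M)" by (rule freeze) measurable
  also have "\<dots> \<le> (\<integral>\<^sup>+\<omega>. ennreal ((norm (msum c B n \<omega>))\<^sup>2) + ennreal (vr c (B n \<omega>)) \<partial>M)"
    using frozen_second_moment [OF c] by (intro nn_integral_mono) (simp add: ennreal_plus [symmetric] del: ennreal_plus)
  also have "\<dots> = (\<integral>\<^sup>+\<omega>. ennreal ((norm (msum c B n \<omega>))\<^sup>2) \<partial>M) + (\<integral>\<^sup>+\<omega>. ennreal (vr c (B n \<omega>)) \<partial>M)"
    by (rule nn_integral_add) measurable
  also have "\<dots> \<le> (\<Sum>j<n. \<integral>\<^sup>+\<omega>. ennreal (vr c (B j \<omega>)) \<partial>M) + (\<integral>\<^sup>+\<omega>. ennreal (vr c (B n \<omega>)) \<partial>M)"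
    by (intro add_right_mono Suc)
  finally show ?case by simp
qed (simp add: msum_def)

lemma exceed_eq:
  assumes B: "predictable B"
  shows "emeasure M {\<omega> \<in> space M. op_norm (B j \<omega>) * norm (Z j \<omega>) > c} =
    (\<integral>\<^sup>+\<omega>. ennreal (prob {z. op_norm (B j \<omega>) * norm z > c}) \<partial>M)"
proof -
  have [measurable]: "B j \<in> borel_measurable (F j)" "B j \<in> borel_measurable M"
    using B by (auto intro: predictable_M predictable_F)
  let ?\<phi> = "\<lambda>(\<omega>, z). indicator {p. op_norm (B j (fst p)) * norm (snd p) > c} (\<omega>, z) :: ennreal"
  have "emeasure M {\<omega> \<in> space M. op_norm (B j \<omega>) * norm (Z j \<omega>) > c} =
      (\<integral>\<^sup>+\<omega>. indicator {\<omega> \<in> space M. op_norm (B j \<omega>) * norm (Z j \<omega>) > c} \<omega> \<partial>M)"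
    by (rule nn_integral_indicator [symmetric]) measurable
  also have "\<dots> = (\<integral>\<^sup>+\<omega>. ?\<phi> (\<omega>, Z j \<omega>) \<partial>M)"
    by (rule nn_integral_cong) (simp add: indicator_def)
  also have "\<dots> = (\<integral>\<^sup>+\<omega>. \<integral>\<^sup>+z. ?\<phi> (\<omega>, z) \<partial>D \<partial>M)"
    by (rule freeze) (unfold indicator_def, measurable)
  also have "\<dots> = (\<integral>\<^sup>+\<omega>. \<integral>\<^sup>+z. indicator {z. op_norm (B j \<omega>) * norm z > c} z \<partial>D \<partial>M)"
    by (simp add: indicator_def)
  finally show ?thesis by (simp add: emeasure_eq_measure)
qed

text \<open>If no term exceeds c, truncation changes nothing and the sum is the martingale plus the
  compensators, so one of these two must reach x / 2.\<close>

lemma tail_bound_L2: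
  assumes B: "predictable B" and c: "0 \<le> c" and x: "0 < x"
  shows "emeasure M {\<omega> \<in> space M. norm (psum B m \<omega>) > x} \<le> (\<Sum>j<m. \<integral>\<^sup>+\<omega>. cost x c (B j \<omega>) \<partial>M)"
proof -
  have [measurable]: "B j \<in> borel_measurable M" for j using B by (rule predictable_M)
  have [measurable]: "psum B m \<in> borel_measurable M" "msum c B m \<in> borel_measurable M"
    using B by (auto intro: psum_measurable msum_measurable)
  let ?E = "\<lambda>j. {\<omega> \<in> space M. op_norm (B j \<omega>) * norm (Z j \<omega>) > c}"
  let ?C = "{\<omega> \<in> space M. (\<Sum>j<m. norm (comp c (B j \<omega>))) \<ge> x / 2}"
  let ?Q = "{\<omega> \<in> space M. (norm (msum c B m \<omega>))\<^sup>2 \<ge> (x / 2)\<^sup>2}"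
  have sub: "{\<omega> \<in> space M. norm (psum B m \<omega>) > x} \<subseteq> (\<Union>j<m. ?E j) \<union> (?C \<union> ?Q)"
  proof
    fix \<omega> assume \<omega>: "\<omega> \<in> {\<omega> \<in> space M. norm (psum B m \<omega>) > x}"
    show "\<omega> \<in> (\<Union>j<m. ?E j) \<union> (?C \<union> ?Q)"
    proof (rule ccontr)
      assume "\<not> ?thesis"
      then have n: "\<omega> \<notin> (\<Union>j<m. ?E j)" "\<omega> \<notin> ?C" "\<omega> \<notin> ?Q" by (simp_all only: Un_iff de_Morgan_disj not_False_eq_True)
      have sp: "\<omega> \<in> space M" "x < norm (psum B m \<omega>)" using \<omega> by simp_all
      have E: "op_norm (B j \<omega>) * norm (Z j \<omega>) \<le> c" if "j < m" for j
        using n(1) sp(1) that by (simp add: not_less)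
      have C: "(\<Sum>j<m. norm (comp c (B j \<omega>))) < x / 2" using n(2) sp(1) by (simp add: not_le)
      have Q: "(norm (msum c B m \<omega>))\<^sup>2 < (x / 2)\<^sup>2" using n(3) sp(1) by (simp only: mem_Collect_eq simp_thms not_le)
      have "psum B m \<omega> = msum c B m \<omega> + (\<Sum>j<m. comp c (B j \<omega>))"
        unfolding psum_def msum_def sum.distrib [symmetric]
        by (intro sum.cong) (simp_all add: trunc_eq E)
      then have "norm (psum B m \<omega>) \<le> norm (msum c B m \<omega>) + norm (\<Sum>j<m. comp c (B j \<omega>))"
        by (simp only: norm_triangle_ineq)
      also have "\<dots> \<le> norm (msum c B m \<omega>) + (\<Sum>j<m. norm (comp c (B j \<omega>)))"
        by (intro add_left_mono norm_sum)
      finally have "norm (psum B m \<omega>) \<le> norm (msum c B m \<omega>) + (\<Sum>j<m. norm (comp c (B j \<omega>)))" .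
      moreover have "norm (msum c B m \<omega>) < x / 2"
        by (rule power2_less_imp_less [OF Q]) (use x in simp)
      ultimately show False using C sp(2) by linarith
    qed
  qed
  have 1: "emeasure M ?C \<le> ennreal (2 / x) * (\<Sum>j<m. \<integral>\<^sup>+\<omega>. ennreal (norm (comp c (B j \<omega>))) \<partial>M)"
  proof -
    have "?C = {\<omega> \<in> space M. 1 \<le> ennreal (2 / x) * ennreal (\<Sum>j<m. norm (comp c (B j \<omega>)))}"
      using x by (simp add: one_le_ennreal_mult_iff sum_nonneg)
    also have "emeasure M \<dots> \<le> ennreal (2 / x) * (\<integral>\<^sup>+\<omega>. ennreal (\<Sum>j<m. norm (comp c (B j \<omega>))) * indicator (space M) \<omega> \<partial>M)"
      by (rule nn_integral_Markov_inequality [OF _ sets.top]) measurable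
    also have "(\<integral>\<^sup>+\<omega>. ennreal (\<Sum>j<m. norm (comp c (B j \<omega>))) * indicator (space M) \<omega> \<partial>M)
        = (\<integral>\<^sup>+\<omega>. (\<Sum>j<m. ennreal (norm (comp c (B j \<omega>)))) \<partial>M)"
      by (intro nn_integral_cong) (simp add: sum_ennreal)
    also have "\<dots> = (\<Sum>j<m. \<integral>\<^sup>+\<omega>. ennreal (norm (comp c (B j \<omega>))) \<partial>M)"
      by (rule nn_integral_sum) measurable
    finally show ?thesis .
  qed
  have 2: "emeasure M ?Q \<le> ennreal (4 / x\<^sup>2) * (\<Sum>j<m. \<integral>\<^sup>+\<omega>. ennreal (vr c (B j \<omega>)) \<partial>M)"
  proof -
    have "?Q = {\<omega> \<in> space M. 1 \<le> ennreal (4 / x\<^sup>2) * ennreal ((norm (msum c B m \<omega>))\<^sup>2)}"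
      using x by (simp add: one_le_ennreal_mult_iff power_divide)
    also have "emeasure M \<dots> \<le> ennreal (4 / x\<^sup>2) * (\<integral>\<^sup>+\<omega>. ennreal ((norm (msum c B m \<omega>))\<^sup>2) * indicator (space M) \<omega> \<partial>M)"
      by (rule nn_integral_Markov_inequality [OF _ sets.top]) measurable
    also have "(\<integral>\<^sup>+\<omega>. ennreal ((norm (msum c B m \<omega>))\<^sup>2) * indicator (space M) \<omega> \<partial>M)
        = (\<integral>\<^sup>+\<omega>. ennreal ((norm (msum c B m \<omega>))\<^sup>2) \<partial>M)"
      by (intro nn_integral_cong) simp
    finally show ?thesis
      using mult_left_mono [OF second_moment [OF B c, of m], of "ennreal (4 / x\<^sup>2)"] by (auto intro: order_trans)
  qed
  have "emeasure M {\<omega> \<in> space M. norm (psum B m \<omega>) > x} \<le> emeasure M ((\<Union>j<m. ?E j) \<union> (?C \<union> ?Q))"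
    by (rule emeasure_mono [OF sub]) measurable
  also have "\<dots> \<le> emeasure M (\<Union>j<m. ?E j) + emeasure M (?C \<union> ?Q)"
    by (rule emeasure_subadditive) measurable
  also have "\<dots> \<le> (\<Sum>j<m. emeasure M (?E j)) + (emeasure M ?C + emeasure M ?Q)"
    by (intro add_mono emeasure_subadditive_finite emeasure_subadditive) auto
  also have "\<dots> \<le> (\<Sum>j<m. emeasure M (?E j)) +
      (ennreal (2 / x) * (\<Sum>j<m. \<integral>\<^sup>+\<omega>. ennreal (norm (comp c (B j \<omega>))) \<partial>M) +
       ennreal (4 / x\<^sup>2) * (\<Sum>j<m. \<integral>\<^sup>+\<omega>. ennreal (vr c (B j \<omega>)) \<partial>M))"
    by (intro add_mono order_refl 1 2)
  also have "\<dots> = (\<Sum>j<m. \<integral>\<^sup>+\<omega>. cost x c (B j \<omega>) \<partial>M)"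
    unfolding cost_eq [OF x] exceed_eq [OF B] sum_distrib_left sum.distrib [symmetric]
    by (intro sum.cong refl) (simp add: nn_integral_add nn_integral_cmult)
  finally show ?thesis .
qed

text \<open>Switching the coefficients off after the first exit from the ball of radius \<open>x\<close> keeps them
  predictable, so the bound for the final value also holds for the maximum.\<close>

lemma maximal_bound_L2:
  assumes B: "predictable B" and c: "0 \<le> c" and x: "0 < x"
  shows "emeasure M {\<omega> \<in> space M. \<exists>i\<le>m. norm (psum B i \<omega>) > x} \<le> (\<Sum>j<m. \<integral>\<^sup>+\<omega>. cost x c (B j \<omega>) \<partial>M)"
proof -
  \<comment> \<open>\<open>psum B i\<close> with i \<le> j involves the noise only before index j,
    so the switch for term j is \<open>F j\<close>-measurable.\<close>
  define B' where "B' j \<omega> = (if \<forall>i\<le>j. norm (psum B i \<omega>) \<le> x then B j \<omega> else 0)" for j \<omega>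
  have B': "predictable B'"
    unfolding predictable_def
  proof
    fix j
    have [measurable]: "B j \<in> borel_measurable (F j)" "\<And>i. i \<in> {..j} \<Longrightarrow> psum B i \<in> borel_measurable (F j)"
      using B by (auto intro: predictable_F psum_measurable_F)
    have "B' j = (\<lambda>\<omega>. if \<forall>i\<in>{..j}. norm (psum B i \<omega>) \<le> x then B j \<omega> else 0)"
      by (auto simp: B'_def fun_eq_iff)
    also have "\<dots> \<in> borel_measurable (F j)" by measurable
    finally show "B' j \<in> borel_measurable (F j)" .
  qed
  have [measurable]: "psum B' m \<in> borel_measurable M" using B' by (rule psum_measurable)
  have "{\<omega> \<in> space M. \<exists>i\<le>m. norm (psum B i \<omega>) > x} \<subseteq> {\<omega> \<in> space M. norm (psum B' m \<omega>) > x}"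
  proof
    fix \<omega> assume \<omega>: "\<omega> \<in> {\<omega> \<in> space M. \<exists>i\<le>m. norm (psum B i \<omega>) > x}"
    \<comment> \<open>The first exit. \<open>B'\<close> agrees with B exactly below k, so its sums
      stay frozen at the value \<open>psum B k\<close> from then on.\<close>
    define k where "k = (LEAST i. norm (psum B i \<omega>) > x)"
    obtain i0 where i0: "i0 \<le> m" "norm (psum B i0 \<omega>) > x" using \<omega> by blast
    have k: "norm (psum B k \<omega>) > x" unfolding k_def by (rule LeastI) (rule i0)
    have less: "norm (psum B i \<omega>) \<le> x" if "i < k" for i
      using not_less_Least [of i "\<lambda>i. norm (psum B i \<omega>) > x"] that by (simp add: k_def)
    have "k \<le> i0" unfolding k_def by (rule Least_le) (rule i0)
    then have "k \<le> m" using i0(1) by simp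
    have "B' j \<omega> = (if j < k then B j \<omega> else 0)" for j
      using k less by (auto simp: B'_def not_le)
    then have "psum B' m \<omega> = (\<Sum>j<m. if j < k then B j \<omega> *v Z j \<omega> else 0)"
      unfolding psum_def by (intro sum.cong) auto
    also have "\<dots> = psum B k \<omega>"
      unfolding psum_def using \<open>k \<le> m\<close> by (intro sum.mono_neutral_cong_right) auto
    finally show "\<omega> \<in> {\<omega> \<in> space M. norm (psum B' m \<omega>) > x}" using k \<omega> by simp
  qed
  then have "emeasure M {\<omega> \<in> space M. \<exists>i\<le>m. norm (psum B i \<omega>) > x} \<le> emeasure M {\<omega> \<in> space M. norm (psum B' m \<omega>) > x}"
    by (rule emeasure_mono) measurable
  also have "\<dots> \<le> (\<Sum>j<m. \<integral>\<^sup>+\<omega>. cost x c (B' j \<omega>) \<partial>M)" by (rule tail_bound_L2 [OF B' c x])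
  also have "\<dots> \<le> (\<Sum>j<m. \<integral>\<^sup>+\<omega>. cost x c (B j \<omega>) \<partial>M)"
    using c by (intro sum_mono nn_integral_mono) (simp add: B'_def)
  finally show ?thesis .
qed

text \<open>Zeroing the first n coefficients keeps them predictable for the same filtration, so all
  bounds for partial sums apply to tails of the series without shifting the filtration.\<close>

definition delay :: "nat \<Rightarrow> (nat \<Rightarrow> 'a \<Rightarrow> real ^ 'p ^ 'd) \<Rightarrow> nat \<Rightarrow> 'a \<Rightarrow> real ^ 'p ^ 'd" where
  "delay n B j \<omega> = (if j < n then 0 else B j \<omega>)"

lemma predictable_delay: "predictable B \<Longrightarrow> predictable (delay n B)"
  unfolding predictable_def delay_def [abs_def]
proof
  fix j assume B: "\<forall>j. B j \<in> borel_measurable (F j)"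
  show "(\<lambda>\<omega>. if j < n then 0 else B j \<omega>) \<in> borel_measurable (F j)"
    using B by (cases "j < n") simp_all
qed

lemma psum_delay: "n \<le> m \<Longrightarrow> psum (delay n B) m \<omega> = psum B m \<omega> - psum B n \<omega>"
proof -
  assume "n \<le> m"
  then have "psum B m \<omega> = psum B n \<omega> + (\<Sum>j\<in>{n..<m}. B j \<omega> *v Z j \<omega>)"
    unfolding psum_def lessThan_atLeast0 by (intro sum.atLeastLessThan_concat [symmetric]) auto
  moreover have "psum (delay n B) m \<omega> = (\<Sum>j\<in>{n..<m}. B j \<omega> *v Z j \<omega>)"
    unfolding psum_def delay_def by (intro sum.mono_neutral_cong_right) auto
  ultimately show ?thesis by simp
qed

lemma sum_delay_le:
  fixes f :: "real ^ 'p ^ 'd \<Rightarrow> ennreal"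
  assumes "f 0 = 0"
  shows "(\<Sum>j<m. \<integral>\<^sup>+\<omega>. f (delay n B j \<omega>) \<partial>M) \<le> (\<Sum>j. \<integral>\<^sup>+\<omega>. f (B (j + n) \<omega>) \<partial>M)"
proof -
  have "(\<Sum>j<m. \<integral>\<^sup>+\<omega>. f (delay n B j \<omega>) \<partial>M) = (\<Sum>j\<in>{n..<m}. \<integral>\<^sup>+\<omega>. f (B j \<omega>) \<partial>M)"
    using assms by (intro sum.mono_neutral_cong_right) (auto simp: delay_def)
  also have "\<dots> = (\<Sum>j<m - n. \<integral>\<^sup>+\<omega>. f (B (j + n) \<omega>) \<partial>M)"
    by (rule sum.reindex_bij_witness [of _ "\<lambda>j. j + n" "\<lambda>j. j - n"]) auto
  also have "\<dots> \<le> (\<Sum>j. \<integral>\<^sup>+\<omega>. f (B (j + n) \<omega>) \<partial>M)"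
    by (intro sum_le_suminf summableI) auto
  finally show ?thesis .
qed

section \<open>Almost sure convergence of the series\<close>

lemma suminf_tail_ennreal:
  fixes f :: "nat \<Rightarrow> ennreal"
  assumes "(\<Sum>j. f j) < \<infinity>"
  shows "(\<lambda>n. \<Sum>j. f (j + n)) \<longlonglongrightarrow> 0"
proof -
  have fin: "f j < \<infinity>" for j
    using term_le_suminf_ennreal [of f j] assms by (rule order_le_less_trans)
  define g where "g j = enn2real (f j)" for j
  have f: "f j = ennreal (g j)" for j using fin [of j] by (simp add: g_def)
  have g: "g j \<ge> 0" for j by (simp add: g_def)
  have sg: "summable g"
    using assms unfolding f by (intro summable_suminf_not_top g) auto
  have "(\<lambda>n. \<Sum>j. g (j + n)) \<longlonglongrightarrow> 0" by (rule suminf_exist_split2 [OF sg])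
  then have "(\<lambda>n. ennreal (\<Sum>j. g (j + n))) \<longlonglongrightarrow> ennreal 0" by (rule tendsto_ennrealI)
  moreover have "(\<Sum>j. f (j + n)) = ennreal (\<Sum>j. g (j + n))" for n
    unfolding f using sg g by (intro suminf_ennreal2) (auto simp: summable_iff_shift)
  ultimately show ?thesis by simp
qed

text \<open>Cauchy's criterion: by the maximal bound, the chance of ever moving further than x after
  time n is at most the tail from n of the cost series. The level c may depend on x but not on n, so
  this tail tends to 0.\<close>

lemma AE_summable:
  assumes B: "predictable B"
    and cost: "\<And>x. 0 < x \<Longrightarrow> \<exists>c\<ge>0. (\<Sum>j. \<integral>\<^sup>+\<omega>. cost x c (B j \<omega>) \<partial>M) < \<infinity>"
  shows "AE \<omega> in M. summable (\<lambda>j. B j \<omega> *v Z j \<omega>)"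
proof -
  have [measurable]: "psum B n \<in> borel_measurable M" for n using B by (rule psum_measurable)
  let ?W = "\<lambda>x n. {\<omega> \<in> space M. \<exists>m\<ge>n. norm (psum B m \<omega> - psum B n \<omega>) > x}"
  have [measurable]: "?W x n \<in> sets M" for x n by measurable
  have bound: "emeasure M (?W x n) \<le> (\<Sum>j. \<integral>\<^sup>+\<omega>. cost x c (B (j + n) \<omega>) \<partial>M)" if "x > 0" "c \<ge> 0" for x c n
  proof -
    let ?V = "\<lambda>m. {\<omega> \<in> space M. \<exists>i\<le>m. norm (psum (delay n B) i \<omega>) > x}"
    have [measurable]: "psum (delay n B) i \<in> borel_measurable M" for i
      by (rule psum_measurable [OF predictable_delay [OF B]])
    have V [measurable]: "?V m \<in> sets M" for m by measurable
    have "?W x n \<subseteq> (\<Union>m. ?V m)"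
    proof
      fix \<omega> assume "\<omega> \<in> ?W x n"
      then obtain m where "\<omega> \<in> space M" "m \<ge> n" "norm (psum B m \<omega> - psum B n \<omega>) > x" by blast
      then have "\<omega> \<in> ?V m" by (auto simp: psum_delay intro!: exI [of _ m])
      then show "\<omega> \<in> (\<Union>m. ?V m)" by blast
    qed
    then have "emeasure M (?W x n) \<le> emeasure M (\<Union>m. ?V m)" by (rule emeasure_mono) measurable
    also have "\<dots> = (SUP m. emeasure M (?V m))"
    proof (rule SUP_emeasure_incseq [symmetric])
      show "incseq ?V" unfolding incseq_def using le_trans by blast
    qed auto
    also have "\<dots> \<le> (\<Sum>j. \<integral>\<^sup>+\<omega>. cost x c (B (j + n) \<omega>) \<partial>M)"
    proof (rule SUP_least)
      fix m
      have "emeasure M (?V m) \<le> (\<Sum>j<m. \<integral>\<^sup>+\<omega>. cost x c (delay n B j \<omega>) \<partial>M)"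
        by (rule maximal_bound_L2 [OF predictable_delay [OF B] that(2,1)])
      also have "\<dots> \<le> (\<Sum>j. \<integral>\<^sup>+\<omega>. cost x c (B (j + n) \<omega>) \<partial>M)"
        using that by (intro sum_delay_le) simp
      finally show "emeasure M (?V m) \<le> (\<Sum>j. \<integral>\<^sup>+\<omega>. cost x c (B (j + n) \<omega>) \<partial>M)" .
    qed
    finally show ?thesis .
  qed
  have null: "emeasure M (\<Inter>n. ?W x n) = 0" if x: "x > 0" for x
  proof -
    obtain c where c: "c \<ge> 0" "(\<Sum>j. \<integral>\<^sup>+\<omega>. cost x c (B j \<omega>) \<partial>M) < \<infinity>" using cost [OF x] by blast
    have "emeasure M (\<Inter>n. ?W x n) \<le> (\<Sum>j. \<integral>\<^sup>+\<omega>. cost x c (B (j + n) \<omega>) \<partial>M)" for n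
      by (rule order_trans [OF emeasure_mono bound [OF x c(1)]]) auto
    then have "emeasure M (\<Inter>n. ?W x n) \<le> 0"
      using suminf_tail_ennreal [OF c(2)] by (intro LIMSEQ_le_const) auto
    then show ?thesis by simp
  qed
  have "AE \<omega> in M. \<forall>k. \<omega> \<notin> (\<Inter>n. ?W (1 / Suc k) n)"
    unfolding AE_all_countable
  proof
    fix k
    show "AE \<omega> in M. \<omega> \<notin> (\<Inter>n. ?W (1 / Suc k) n)"
      by (intro AE_not_in null_setsI null) (simp, measurable)
  qed
  then show ?thesis
    using AE_space
  proof eventually_elim
    case (elim \<omega>)
    have "Cauchy (\<lambda>n. psum B n \<omega>)"
      unfolding Cauchy_altdef2
    proof (intro allI impI)
      fix e :: real assume "e > 0"
      then obtain k where k: "1 / Suc k < e" using nat_approx_posE by blast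
      have "\<omega> \<notin> (\<Inter>n. ?W (1 / Suc k) n)" using elim(1) by (rule spec)
      then obtain n where "\<omega> \<notin> ?W (1 / Suc k) n" by blast
      then have "\<forall>m\<ge>n. norm (psum B m \<omega> - psum B n \<omega>) \<le> 1 / Suc k"
        using elim(2) by (simp add: not_less)
      then have "\<forall>m\<ge>n. dist (psum B m \<omega>) (psum B n \<omega>) < e"
        using k by (simp add: dist_norm) (blast intro: order_le_less_trans)
      then show "\<exists>n. \<forall>m\<ge>n. dist (psum B m \<omega>) (psum B n \<omega>) < e" ..
    qed
    then have "convergent (\<lambda>n. psum B n \<omega>)" by (simp add: Cauchy_convergent_iff)
    then show ?case by (simp add: summable_iff_convergent psum_def)
  qed
qed

end

section \<open>An exponential tail bound\<close>

lemma exp_le_quadratic: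
  fixes y :: real
  assumes "\<bar>y\<bar> \<le> L"
  shows "exp y \<le> 1 + y + y\<^sup>2 / 2 * exp L"
proof -
  obtain t where t: "\<bar>t\<bar> \<le> \<bar>y\<bar>" "exp y = (\<Sum>m<2. y ^ m / fact m) + exp t / fact 2 * y ^ 2"
    using Maclaurin_exp_le [of y 2] by blast
  have "exp t \<le> exp L" using t(1) assms by simp
  then have "exp t / 2 * y\<^sup>2 \<le> exp L / 2 * y\<^sup>2" by (intro mult_right_mono divide_right_mono) auto
  then show ?thesis using t(2) by (simp add: numeral_2_eq_2 fact_2 mult.commute)
qed

lemma powr_two: "0 \<le> (x::real) \<Longrightarrow> x powr 2 = x\<^sup>2"
  by (cases "x = 0") (simp_all add: powr_numeral)

text \<open>Trades the exponent \<beta> for \<gamma> at the price of a power of the level c. The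
  first alternative serves moments below the level, the second moments above it.\<close>

lemma powr_split_le:
  fixes x c :: real
  assumes "0 \<le> x" "0 < c" "x \<le> c \<and> \<gamma> \<le> \<beta> \<or> c \<le> x \<and> \<beta> \<le> \<gamma>"
  shows "x powr \<beta> \<le> x powr \<gamma> * c powr (\<beta> - \<gamma>)"
proof (cases "x = 0")
  case False
  then have x: "x > 0" using assms(1) by simp
  have "x powr (\<beta> - \<gamma>) \<le> c powr (\<beta> - \<gamma>)"
    using assms x by (elim disjE) (auto intro: powr_mono2 powr_mono2')
  then have "x powr \<gamma> * x powr (\<beta> - \<gamma>) \<le> x powr \<gamma> * c powr (\<beta> - \<gamma>)" by (rule mult_left_mono) simp
  then show ?thesis using x by (simp add: powr_add [symmetric])
qed simp

section \<open>Bounds for compensators, second moments and exponential moments\<close>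

context tail_law
begin

lemma comp_le_low:
  assumes "0 \<le> c"
  shows "ennreal (norm (comp c A)) \<le>
    (\<integral>\<^sup>+z. ennreal ((op_norm A * norm z) powr 1 * indicator {z. op_norm A * norm z \<le> c} z) \<partial>D)"
proof -
  have "ennreal (norm (comp c A)) \<le> (\<integral>\<^sup>+z. ennreal (norm (trunc c A z)) \<partial>D)"
    unfolding comp_def by (rule integral_norm_bound_ennreal) (rule integrable_trunc [OF assms])
  also have "\<dots> \<le> (\<integral>\<^sup>+z. ennreal ((op_norm A * norm z) powr 1 * indicator {z. op_norm A * norm z \<le> c} z) \<partial>D)"
    using norm_trunc_le_indicator [of c A] by (intro nn_integral_mono ennreal_leI) (simp add: powr_one)
  finally show ?thesis .
qed

text \<open>Since the image of Z under A has mean zero, the mean of the truncated part is minus the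
  mean of the discarded part.\<close>

lemma comp_le_high:
  fixes A :: "real ^ 'p ^ 'd"
  assumes c: "0 \<le> c" and int: "integrable D (\<lambda>z. z)" and mean: "(\<integral>z. z \<partial>D) = 0"
  shows "ennreal (norm (comp c A)) \<le>
    (\<integral>\<^sup>+z. ennreal ((op_norm A * norm z) powr 1 * indicator {z. op_norm A * norm z > c} z) \<partial>D)"
proof -
  have iA: "integrable D (\<lambda>z. A *v z)"
    by (rule integrable_bounded_linear [OF bounded_linear_mv int])
  have "(\<integral>z. A *v z \<partial>D) = A *v (\<integral>z. z \<partial>D)"
    by (rule integral_bounded_linear [OF bounded_linear_mv int])
  then have 0: "(\<integral>z. A *v z \<partial>D) = 0" by (simp add: mean)
  have "(\<integral>z. A *v z - trunc c A z \<partial>D) = - comp c A"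
    unfolding comp_def using 0 by (simp add: Bochner_Integration.integral_diff [OF iA integrable_trunc(1) [OF c]])
  then have "norm (comp c A) = norm (\<integral>z. A *v z - trunc c A z \<partial>D)" by simp
  then have "ennreal (norm (comp c A)) \<le> (\<integral>\<^sup>+z. ennreal (norm (A *v z - trunc c A z)) \<partial>D)"
    using integral_norm_bound_ennreal [OF Bochner_Integration.integrable_diff [OF iA integrable_trunc(1) [OF c]]] by simp
  also have "\<dots> \<le> (\<integral>\<^sup>+z. ennreal ((op_norm A * norm z) powr 1 * indicator {z. op_norm A * norm z > c} z) \<partial>D)"
    using norm_mv_le [of A] by (intro nn_integral_mono ennreal_leI) (simp add: powr_one trunc_def)
  finally show ?thesis .
qed

lemma vr_le_moment:
  assumes c: "0 \<le> c"
  shows "ennreal (vr c A) \<le>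
    (\<integral>\<^sup>+z. ennreal ((op_norm A * norm z) powr 2 * indicator {z. op_norm A * norm z \<le> c} z) \<partial>D)"
proof -
  have "ennreal (vr c A) = (\<integral>\<^sup>+z. ennreal ((norm (trunc c A z))\<^sup>2) \<partial>D)"
    unfolding vr_def by (rule nn_integral_eq_integral [symmetric, OF integrable_trunc(2) [OF c]]) simp
  also have "\<dots> \<le> (\<integral>\<^sup>+z. ennreal ((op_norm A * norm z) powr 2 * indicator {z. op_norm A * norm z \<le> c} z) \<partial>D)"
  proof (intro nn_integral_mono ennreal_leI)
    fix z
    show "(norm (trunc c A z))\<^sup>2 \<le> (op_norm A * norm z) powr 2 * indicator {z. op_norm A * norm z \<le> c} z"
      using power_mono [OF norm_mv_le [of A z], of 2] by (simp add: trunc_def powr_two)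
  qed
  finally show ?thesis .
qed

definition mean_zero :: bool where
  "mean_zero \<longleftrightarrow> integrable D (\<lambda>z. z) \<and> (\<integral>z. z \<partial>D) = 0"

text \<open>The alternatives are those in which a first moment is at most of order u T(u): the one
  below the level if \<alpha> + \<eta> < 1, the one above it if \<alpha> - \<eta> > 1 and Z is
  centred. The second moment below the level needs \<alpha> + \<eta> < 2.\<close>

lemma bounds_regular:
  assumes \<eta>: "0 < \<eta>" "\<eta> < \<alpha>" and cs: "\<alpha> + \<eta> < 1 \<or> 1 < \<alpha> - \<eta> \<and> \<alpha> + \<eta> < 2 \<and> mean_zero"
  obtains C u0 where "C > 0" "u0 \<ge> 1"
    "\<And>u A. u \<ge> u0 \<Longrightarrow> norm (comp u (A :: real ^ 'p ^ 'd)) \<le> C * u * T u * wt \<eta> (op_norm A)"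
    "\<And>u A. u \<ge> u0 \<Longrightarrow> vr u (A :: real ^ 'p ^ 'd) \<le> C * u\<^sup>2 * T u * wt \<eta> (op_norm A)"
proof -
  have "\<alpha> + \<eta> < 2" using cs by auto
  obtain C2 u2 where 2: "C2 > 0" "u2 \<ge> 1" "\<And>u a. u \<ge> u2 \<Longrightarrow> a \<ge> 0 \<Longrightarrow>
      (\<integral>\<^sup>+z. ennreal ((a * norm z) powr 2 * indicator {z. a * norm z \<le> u} z) \<partial>D)
        \<le> ennreal (C2 * u powr 2 * T u * wt \<eta> a)"
    by (rule truncated_moment [OF \<eta> \<open>\<alpha> + \<eta> < 2\<close>]) blast
  obtain C1 u1 where 1: "C1 > 0" "u1 \<ge> 1" "\<And>u A. u \<ge> u1 \<Longrightarrow>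
      ennreal (norm (comp u (A :: real ^ 'p ^ 'd))) \<le> ennreal (C1 * u powr 1 * T u * wt \<eta> (op_norm A))"
  proof (cases "\<alpha> + \<eta> < 1")
    case True
    obtain C1 u1 where 1: "C1 > 0" "u1 \<ge> 1" "\<And>u a. u \<ge> u1 \<Longrightarrow> a \<ge> 0 \<Longrightarrow>
        (\<integral>\<^sup>+z. ennreal ((a * norm z) powr 1 * indicator {z. a * norm z \<le> u} z) \<partial>D)
          \<le> ennreal (C1 * u powr 1 * T u * wt \<eta> a)"
      by (rule truncated_moment [OF \<eta> True]) blast
    show ?thesis
    proof (rule that [OF 1(1,2)])
      fix u and A :: "real ^ 'p ^ 'd" assume "u \<ge> u1"
      then show "ennreal (norm (comp u A)) \<le> ennreal (C1 * u powr 1 * T u * wt \<eta> (op_norm A))"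
        using 1(2) by (intro order_trans [OF comp_le_low 1(3)]) auto
    qed
  next
    case False
    then have cs: "1 < \<alpha> - \<eta>" and mz: "integrable D (\<lambda>z. z)" "(\<integral>z. z \<partial>D) = 0"
      using cs by (auto simp: mean_zero_def)
    obtain C1 u1 where 1: "C1 > 0" "u1 \<ge> 1" "\<And>u a. u \<ge> u1 \<Longrightarrow> a \<ge> 0 \<Longrightarrow>
        (\<integral>\<^sup>+z. ennreal ((a * norm z) powr 1 * indicator {z. a * norm z > u} z) \<partial>D)
          \<le> ennreal (C1 * u powr 1 * T u * wt \<eta> a)"
      by (rule tail_moment [OF \<eta> zero_le_one cs]) blast
    show ?thesis
    proof (rule that [OF 1(1,2)])
      fix u and A :: "real ^ 'p ^ 'd" assume "u \<ge> u1"
      then show "ennreal (norm (comp u A)) \<le> ennreal (C1 * u powr 1 * T u * wt \<eta> (op_norm A))"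
        using 1(2) by (intro order_trans [OF comp_le_high [OF _ mz] 1(3)]) auto
    qed
  qed
  show ?thesis
  proof (rule that [of "max C1 C2" "max u1 u2"])
    fix u and A :: "real ^ 'p ^ 'd" assume u: "max u1 u2 \<le> u"
    then have u': "u1 \<le> u" "u2 \<le> u" "1 \<le> u" using 1(2) by auto
    have Tu: "0 < T u" by (rule tail_pos)
    have "norm (comp u A) \<le> C1 * u powr 1 * T u * wt \<eta> (op_norm A)"
      using 1(3) [OF u'(1), of A] Tu 1(1) u' by (subst (asm) ennreal_le_iff) auto
    also have "\<dots> \<le> max C1 C2 * u * T u * wt \<eta> (op_norm A)"
      using Tu u' by (intro mult_right_mono) auto
    finally show "norm (comp u A) \<le> max C1 C2 * u * T u * wt \<eta> (op_norm A)" .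
    have "ennreal (vr u A) \<le> ennreal (C2 * u powr 2 * T u * wt \<eta> (op_norm A))"
      using u' by (intro order_trans [OF vr_le_moment 2(3)]) auto
    then have "vr u A \<le> C2 * u powr 2 * T u * wt \<eta> (op_norm A)"
      using Tu 2(1) u' by (subst (asm) ennreal_le_iff) auto
    also have "\<dots> = C2 * u\<^sup>2 * T u * wt \<eta> (op_norm A)" using u' by (simp add: powr_two)
    also have "\<dots> \<le> max C1 C2 * u\<^sup>2 * T u * wt \<eta> (op_norm A)"
      using Tu u' by (intro mult_right_mono) auto
    finally show "vr u A \<le> max C1 C2 * u\<^sup>2 * T u * wt \<eta> (op_norm A)" .
  qed (use 1 in auto)
qed

text \<open>Everything is compared with the finite moment of order \<gamma> through
  \<open>powr_split_le\<close>. For \<gamma> \<le> 1 the compensator is estimated by the part below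
  the level, otherwise by the part above it, where 1 \<le> \<gamma> gives the comparison the right
  direction.\<close>

lemma bounds_power:
  assumes \<gamma>: "0 < \<gamma>" "\<gamma> < \<alpha>" "\<gamma> \<le> 2" and cs: "\<gamma> \<le> 1 \<or> mean_zero"
  obtains m where "m > 0"
    "\<And>c A. c > 0 \<Longrightarrow> norm (comp c (A :: real ^ 'p ^ 'd)) \<le> m * c powr (1 - \<gamma>) * op_norm A powr \<gamma>"
    "\<And>c A. c > 0 \<Longrightarrow> vr c (A :: real ^ 'p ^ 'd) \<le> m * c powr (2 - \<gamma>) * op_norm A powr \<gamma>"
proof -
  define m where "m = enn2real (\<integral>\<^sup>+z. ennreal (norm z powr \<gamma>) \<partial>D)"
  have m: "(\<integral>\<^sup>+z. ennreal (norm z powr \<gamma>) \<partial>D) = ennreal m" "0 \<le> m"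
    using moment_finite [OF \<gamma>(1,2)] by (simp_all add: m_def)
  have gen: "(\<integral>\<^sup>+z. ennreal ((op_norm A * norm z) powr \<beta> * indicator (S z) z) \<partial>D)
      \<le> ennreal (m * c powr (\<beta> - \<gamma>) * op_norm A powr \<gamma>)"
    if c: "c > 0" and S: "\<And>z. z \<in> S z \<Longrightarrow> op_norm A * norm z \<le> c \<and> \<gamma> \<le> \<beta> \<or> c \<le> op_norm A * norm z \<and> \<beta> \<le> \<gamma>"
    for \<beta> c and A :: "real ^ 'p ^ 'd" and S :: "real ^ 'p \<Rightarrow> (real ^ 'p) set"
  proof -
    have "(\<integral>\<^sup>+z. ennreal ((op_norm A * norm z) powr \<beta> * indicator (S z) z) \<partial>D)
        \<le> (\<integral>\<^sup>+z. ennreal (c powr (\<beta> - \<gamma>) * op_norm A powr \<gamma>) * ennreal (norm z powr \<gamma>) \<partial>D)"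
    proof (rule nn_integral_mono)
      fix z :: "real ^ 'p"
      have "(op_norm A * norm z) powr \<beta> * indicator (S z) z \<le> c powr (\<beta> - \<gamma>) * op_norm A powr \<gamma> * norm z powr \<gamma>"
      proof (cases "z \<in> S z")
        case True
        have "(op_norm A * norm z) powr \<beta> \<le> (op_norm A * norm z) powr \<gamma> * c powr (\<beta> - \<gamma>)"
          using S [OF True] c by (intro powr_split_le) auto
        then show ?thesis using True by (simp add: powr_mult mult_ac)
      qed simp
      then show "ennreal ((op_norm A * norm z) powr \<beta> * indicator (S z) z)
          \<le> ennreal (c powr (\<beta> - \<gamma>) * op_norm A powr \<gamma>) * ennreal (norm z powr \<gamma>)"
        by (simp add: ennreal_mult [symmetric] ennreal_leI)
    qed
    also have "\<dots> = ennreal (c powr (\<beta> - \<gamma>) * op_norm A powr \<gamma>) * ennreal m"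
      unfolding m(1) [symmetric] by (rule nn_integral_cmult) measurable
    finally show ?thesis using m(2) by (simp add: ennreal_mult [symmetric] mult_ac)
  qed
  show ?thesis
  \<comment> \<open>The summand 1 makes the constant positive without a lower bound for the
    moment.\<close>
  proof (rule that [of "m + 1"])
    fix c :: real and A :: "real ^ 'p ^ 'd" assume c: "c > 0"
    have "ennreal (norm (comp c A)) \<le> ennreal (m * c powr (1 - \<gamma>) * op_norm A powr \<gamma>)"
    proof (cases "\<gamma> \<le> 1")
      case True
      show ?thesis
        using c True by (intro order_trans [OF comp_le_low gen]) auto
    next
      case False
      then have mz: "integrable D (\<lambda>z. z)" "(\<integral>z. z \<partial>D) = 0" using cs by (auto simp: mean_zero_def)
      show ?thesis
        using c False by (intro order_trans [OF comp_le_high [OF _ mz] gen]) auto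
    qed
    then have "norm (comp c A) \<le> m * c powr (1 - \<gamma>) * op_norm A powr \<gamma>"
      using m(2) by (subst (asm) ennreal_le_iff) auto
    also have "\<dots> \<le> (m + 1) * c powr (1 - \<gamma>) * op_norm A powr \<gamma>" by (intro mult_right_mono) auto
    finally show "norm (comp c A) \<le> (m + 1) * c powr (1 - \<gamma>) * op_norm A powr \<gamma>" .
    have "ennreal (vr c A) \<le> ennreal (m * c powr (2 - \<gamma>) * op_norm A powr \<gamma>)"
      using c \<gamma> by (intro order_trans [OF vr_le_moment gen]) auto
    then have "vr c A \<le> m * c powr (2 - \<gamma>) * op_norm A powr \<gamma>"
      using m(2) by (subst (asm) ennreal_le_iff) auto
    also have "\<dots> \<le> (m + 1) * c powr (2 - \<gamma>) * op_norm A powr \<gamma>" by (intro mult_right_mono) auto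
    finally show "vr c A \<le> (m + 1) * c powr (2 - \<gamma>) * op_norm A powr \<gamma>" .
  qed (use m(2) in auto)
qed

text \<open>Taylor's formula bounds the exponential by 1, its linear part and a quadratic remainder
  carrying a factor \<open>exp (\<tau> * c)\<close>. Writing \<tau>^2 as (\<tau> c)^2 / c^2 and
  using (\<tau> c)^2 / 2 \<le> exp(\<tau> c) yields the factor
  \<open>exp (2 * \<tau> * c) / c\<^sup>2\<close>, in which \<tau> survives only in the
  exponent.\<close>

lemma frozen_exp:
  fixes A :: "real ^ 'p ^ 'd"
  assumes c: "0 < c" and l: "0 < \<tau>" and e: "norm e \<le> 1"
  shows "(\<integral>\<^sup>+z. ennreal (exp (\<tau> * (e \<bullet> trunc c A z))) \<partial>D)
    \<le> ennreal (exp (\<tau> * norm (comp c A) + exp (2 * \<tau> * c) / c\<^sup>2 * vr c A))"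
proof -
  let ?Y = "trunc c A" and ?\<psi> = "exp (2 * \<tau> * c) / c\<^sup>2"
  have c0: "0 \<le> c" using c by simp
  note i [simp] = integrable_trunc [OF c0, of A]
  have inner: "\<bar>e \<bullet> w\<bar> \<le> norm w" for w
    using Cauchy_Schwarz_ineq2 [of e w] mult_right_mono [OF e norm_ge_zero [of w]] by simp
  have pw: "exp (\<tau> * (e \<bullet> ?Y z)) \<le> 1 + \<tau> * (e \<bullet> ?Y z) + ?\<psi> * (norm (?Y z))\<^sup>2" for z
  proof -
    let ?y = "\<tau> * (e \<bullet> ?Y z)"
    have "\<bar>e \<bullet> ?Y z\<bar> \<le> c" using inner [of "?Y z"] norm_trunc_le [OF c0, of A z] by linarith
    then have "\<bar>?y\<bar> \<le> \<tau> * c" using l by (simp add: abs_mult)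
    then have "exp ?y \<le> 1 + ?y + ?y\<^sup>2 / 2 * exp (\<tau> * c)" by (rule exp_le_quadratic)
    moreover have "?y\<^sup>2 / 2 * exp (\<tau> * c) \<le> ?\<psi> * (norm (?Y z))\<^sup>2"
    proof -
      have "(e \<bullet> ?Y z)\<^sup>2 \<le> (norm (?Y z))\<^sup>2" using inner [of "?Y z"] by (rule abs_le_square_iff [THEN iffD1, OF order_trans]) simp
      then have "?y\<^sup>2 \<le> \<tau>\<^sup>2 * (norm (?Y z))\<^sup>2" by (simp add: power_mult_distrib mult_left_mono)
      then have "?y\<^sup>2 / 2 * exp (\<tau> * c) \<le> \<tau>\<^sup>2 * (norm (?Y z))\<^sup>2 / 2 * exp (\<tau> * c)"
        by (intro mult_right_mono divide_right_mono) auto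
      also have "\<dots> = ((\<tau> * c)\<^sup>2 / 2) * (exp (\<tau> * c) / c\<^sup>2 * (norm (?Y z))\<^sup>2)"
        using c by (simp add: power_mult_distrib)
      also have "\<dots> \<le> exp (\<tau> * c) * (exp (\<tau> * c) / c\<^sup>2 * (norm (?Y z))\<^sup>2)"
      proof (rule mult_right_mono)
        have "0 \<le> \<tau> * c" using c l by simp
        then show "(\<tau> * c)\<^sup>2 / 2 \<le> exp (\<tau> * c)"
          using exp_lower_Taylor_quadratic [of "\<tau> * c"] by linarith
      qed simp
      also have "\<dots> = ?\<psi> * (norm (?Y z))\<^sup>2" by (simp add: mult_exp_exp)
      finally show ?thesis .
    qed
    ultimately show ?thesis by linarith
  qed
  have int: "integrable D (\<lambda>z. 1 + \<tau> * (e \<bullet> ?Y z) + ?\<psi> * (norm (?Y z))\<^sup>2)" by simp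
  have "(\<integral>\<^sup>+z. ennreal (exp (\<tau> * (e \<bullet> ?Y z))) \<partial>D) \<le> (\<integral>\<^sup>+z. ennreal (1 + \<tau> * (e \<bullet> ?Y z) + ?\<psi> * (norm (?Y z))\<^sup>2) \<partial>D)"
    by (intro nn_integral_mono ennreal_leI pw)
  also have "\<dots> = ennreal (\<integral>z. 1 + \<tau> * (e \<bullet> ?Y z) + ?\<psi> * (norm (?Y z))\<^sup>2 \<partial>D)"
    by (rule nn_integral_eq_integral [OF int]) (rule AE_I2, rule order_trans [OF _ pw], simp)
  also have "(\<integral>z. 1 + \<tau> * (e \<bullet> ?Y z) + ?\<psi> * (norm (?Y z))\<^sup>2 \<partial>D) = 1 + \<tau> * (e \<bullet> comp c A) + ?\<psi> * vr c A"
    by (simp add: comp_def vr_def prob_space [unfolded space_D])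
  also have "\<dots> \<le> 1 + (\<tau> * norm (comp c A) + ?\<psi> * vr c A)"
    using inner [of "comp c A"] mult_left_mono [of "e \<bullet> comp c A" "norm (comp c A)" \<tau>] l by simp
  also have "\<dots> \<le> exp (\<tau> * norm (comp c A) + ?\<psi> * vr c A)" by (rule exp_ge_add_one_self)
  finally show ?thesis by (simp add: ennreal_leI)
qed

end

section \<open>The exponential supermartingale and its tail bound\<close>

context noise
begin

text \<open>Each factor is divided by the bound of \<open>frozen_exp\<close> for its conditional
  expectation, so integrating out the last noise vector leaves at most the integral of the previous
  product.\<close>

lemma exp_supermartingale:
  assumes B: "predictable B" and c: "0 < c" and l: "0 < \<tau>" and e: "norm e \<le> 1"
  shows "(\<integral>\<^sup>+\<omega>. ennreal (exp (\<Sum>j<n. \<tau> * (e \<bullet> trunc c (B j \<omega>) (Z j \<omega>))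
    - (\<tau> * norm (comp c (B j \<omega>)) + exp (2 * \<tau> * c) / c\<^sup>2 * vr c (B j \<omega>)))) \<partial>M) \<le> 1"
proof (induction n)
  case 0
  then show ?case by (simp add: M.emeasure_space_1)
next
  case (Suc n)
  let ?k = "\<lambda>A. \<tau> * norm (comp c A) + exp (2 * \<tau> * c) / c\<^sup>2 * vr c A"
  let ?S = "\<lambda>\<omega>. \<Sum>j<n. \<tau> * (e \<bullet> trunc c (B j \<omega>) (Z j \<omega>)) - ?k (B j \<omega>)"
  let ?\<phi> = "\<lambda>(\<omega>, z). ennreal (exp (?S \<omega> - ?k (B n \<omega>)) * exp (\<tau> * (e \<bullet> trunc c (B n \<omega>) z)))"
  have [measurable]: "j \<in> {..<n} \<Longrightarrow> B j \<in> borel_measurable (F n)" "j \<in> {..<n} \<Longrightarrow> Z j \<in> borel_measurable (F n)" for j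
    using B by (auto intro: predictable_F Z_measurable_F)
  have [measurable]: "B n \<in> borel_measurable (F n)" using B by (auto intro: predictable_F)
  have [measurable]: "?S \<in> borel_measurable (F n)" by measurable
  have "(\<integral>\<^sup>+\<omega>. ennreal (exp (\<Sum>j<Suc n. \<tau> * (e \<bullet> trunc c (B j \<omega>) (Z j \<omega>)) - ?k (B j \<omega>))) \<partial>M)
      = (\<integral>\<^sup>+\<omega>. ?\<phi> (\<omega>, Z n \<omega>) \<partial>M)"
    by (intro nn_integral_cong) (simp add: exp_add [symmetric] algebra_simps)
  also have "\<dots> = (\<integral>\<^sup>+\<omega>. \<integral>\<^sup>+z. ?\<phi> (\<omega>, z) \<partial>D \<partial>M)" by (rule freeze) measurable
  also have "\<dots> \<le> (\<integral>\<^sup>+\<omega>. ennreal (exp (?S \<omega>)) \<partial>M)"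
  proof (rule nn_integral_mono)
    fix \<omega>
    have "(\<integral>\<^sup>+z. ?\<phi> (\<omega>, z) \<partial>D) = ennreal (exp (?S \<omega> - ?k (B n \<omega>))) * (\<integral>\<^sup>+z. ennreal (exp (\<tau> * (e \<bullet> trunc c (B n \<omega>) z))) \<partial>D)"
      unfolding prod.case ennreal_mult [OF exp_ge_zero exp_ge_zero] by (rule nn_integral_cmult) measurable
    also have "\<dots> \<le> ennreal (exp (?S \<omega> - ?k (B n \<omega>))) * ennreal (exp (?k (B n \<omega>)))"
      by (intro mult_left_mono frozen_exp c l e) simp
    also have "\<dots> = ennreal (exp (?S \<omega>))"
      unfolding ennreal_mult [OF exp_ge_zero exp_ge_zero, symmetric] mult_exp_exp by simp
    finally show "(\<integral>\<^sup>+z. ?\<phi> (\<omega>, z) \<partial>D) \<le> ennreal (exp (?S \<omega>))" .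
  qed
  finally show ?case using Suc by (rule order_trans)
qed

text \<open>In dimension d a vector longer than x has an inner product larger than x / d with one of
  the 2 d signed basis vectors. Unless the compensators or second moments are large, at most half of
  this is lost to the compensators and the quadratic term is controlled by y; Markov's inequality
  for the supermartingale in that direction gives the exponential.\<close>

lemma tail_bound_exp:
  fixes B :: "nat \<Rightarrow> 'a \<Rightarrow> real ^ 'p ^ 'd"
  assumes B: "predictable B" and c: "0 < c" and l: "0 < \<tau>" and x: "0 < x"
  shows "emeasure M {\<omega> \<in> space M. norm (psum B m \<omega>) > x} \<le>
    (\<Sum>j<m. \<integral>\<^sup>+\<omega>. ennreal (prob {z. op_norm (B j \<omega>) * norm z > c}) \<partial>M)
    + (emeasure M {\<omega> \<in> space M. (\<Sum>j<m. norm (comp c (B j \<omega>))) > x / (2 * CARD('d))}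
     + emeasure M {\<omega> \<in> space M. (\<Sum>j<m. vr c (B j \<omega>)) > y}
     + ennreal (2 * CARD('d) * exp (exp (2 * \<tau> * c) / c\<^sup>2 * y - \<tau> * (x / (2 * CARD('d))))))"
proof -
  have [measurable]: "B j \<in> borel_measurable M" for j using B by (rule predictable_M)
  have [measurable]: "psum B m \<in> borel_measurable M" using B by (rule psum_measurable)
  let ?d = "real CARD('d)" let ?\<psi> = "exp (2 * \<tau> * c) / c\<^sup>2"
  let ?E = "\<lambda>j. {\<omega> \<in> space M. op_norm (B j \<omega>) * norm (Z j \<omega>) > c}"
  let ?C = "{\<omega> \<in> space M. (\<Sum>j<m. norm (comp c (B j \<omega>))) > x / (2 * ?d)}"
  let ?V = "{\<omega> \<in> space M. (\<Sum>j<m. vr c (B j \<omega>)) > y}"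
  let ?S = "\<lambda>e \<omega>. \<Sum>j<m. \<tau> * (e \<bullet> trunc c (B j \<omega>) (Z j \<omega>))
    - (\<tau> * norm (comp c (B j \<omega>)) + ?\<psi> * vr c (B j \<omega>))"
  let ?r = "\<tau> * (x / (2 * ?d)) - ?\<psi> * y"
  let ?G = "\<lambda>e. {\<omega> \<in> space M. 1 \<le> ennreal (exp (- ?r)) * ennreal (exp (?S e \<omega>))}"
  let ?Es = "Basis \<union> uminus ` Basis :: (real ^ 'd) set"
  have d: "?d > 0" by simp
  have S: "?S e \<omega> = \<tau> * (e \<bullet> (\<Sum>j<m. trunc c (B j \<omega>) (Z j \<omega>)))
      - \<tau> * (\<Sum>j<m. norm (comp c (B j \<omega>))) - ?\<psi> * (\<Sum>j<m. vr c (B j \<omega>))" for e \<omega>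
    by (simp add: sum_subtractf sum.distrib sum_distrib_left inner_sum_right)
  have sub: "{\<omega> \<in> space M. norm (psum B m \<omega>) > x} \<subseteq> (\<Union>j<m. ?E j) \<union> (?C \<union> ?V \<union> (\<Union>e\<in>?Es. ?G e))"
  proof
    fix \<omega> assume \<omega>: "\<omega> \<in> {\<omega> \<in> space M. norm (psum B m \<omega>) > x}"
    show "\<omega> \<in> (\<Union>j<m. ?E j) \<union> (?C \<union> ?V \<union> (\<Union>e\<in>?Es. ?G e))"
    proof (rule ccontr)
      assume "\<not> ?thesis"
      then have n: "\<omega> \<notin> (\<Union>j<m. ?E j)" "\<omega> \<notin> ?C" "\<omega> \<notin> ?V" "\<omega> \<notin> (\<Union>e\<in>?Es. ?G e)"
        by (simp_all only: Un_iff de_Morgan_disj not_False_eq_True)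
      have sp: "\<omega> \<in> space M" "x < norm (psum B m \<omega>)" using \<omega> by simp_all
      have E: "op_norm (B j \<omega>) * norm (Z j \<omega>) \<le> c" if "j < m" for j
        using n(1) sp(1) that by (simp add: not_less)
      have C: "(\<Sum>j<m. norm (comp c (B j \<omega>))) \<le> x / (2 * ?d)" using n(2) sp(1) by (simp add: not_less)
      have V: "(\<Sum>j<m. vr c (B j \<omega>)) \<le> y" using n(3) sp(1) by (simp add: not_less)
      have p: "psum B m \<omega> = (\<Sum>j<m. trunc c (B j \<omega>) (Z j \<omega>))"
        unfolding psum_def by (intro sum.cong) (simp_all add: trunc_eq E)
      have "\<exists>b\<in>Basis. x / ?d < \<bar>psum B m \<omega> \<bullet> b\<bar>"
      proof (rule ccontr)
        assume "\<not> ?thesis"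
        then have "(\<Sum>b\<in>Basis. \<bar>psum B m \<omega> \<bullet> b\<bar>) \<le> (\<Sum>b\<in>(Basis :: (real ^ 'd) set). x / ?d)"
          by (intro sum_mono) (simp add: not_less)
        also have "\<dots> = x" by simp
        finally show False using norm_le_l1 [of "psum B m \<omega>"] sp(2) by linarith
      qed
      then obtain b where b: "b \<in> Basis" "x / ?d < \<bar>psum B m \<omega> \<bullet> b\<bar>" ..
      define e where "e = (if 0 \<le> psum B m \<omega> \<bullet> b then b else - b)"
      have e: "e \<in> ?Es" "x / ?d < e \<bullet> psum B m \<omega>"
        using b by (auto simp: e_def inner_commute abs_if split: if_splits)
      have "\<tau> * (x / ?d) \<le> \<tau> * (e \<bullet> psum B m \<omega>)" "\<tau> * (\<Sum>j<m. norm (comp c (B j \<omega>))) \<le> \<tau> * (x / (2 * ?d))"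
        "?\<psi> * (\<Sum>j<m. vr c (B j \<omega>)) \<le> ?\<psi> * y"
        using e(2) C V l by (intro mult_left_mono; simp)+
      moreover have "\<tau> * (x / ?d) = \<tau> * (x / (2 * ?d)) + \<tau> * (x / (2 * ?d))" using d by (simp add: field_simps)
      ultimately have "?r \<le> ?S e \<omega>" unfolding S p [symmetric] by linarith
      then have "1 \<le> exp (- ?r) * exp (?S e \<omega>)" unfolding mult_exp_exp by (subst one_le_exp_iff) linarith
      then have "ennreal 1 \<le> ennreal (exp (- ?r) * exp (?S e \<omega>))" by (rule ennreal_leI)
      then have "\<omega> \<in> ?G e" using sp(1) by (simp only: ennreal_mult [OF exp_ge_zero exp_ge_zero] ennreal_1 mem_Collect_eq simp_thms)
      then show False using n(4) e(1) by blast
    qed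
  qed
  have G: "emeasure M (?G e) \<le> ennreal (exp (- ?r))" if "e \<in> ?Es" for e
  proof -
    have e: "norm e \<le> 1" using that by auto
    have "emeasure M (?G e) \<le> ennreal (exp (- ?r)) * (\<integral>\<^sup>+\<omega>. ennreal (exp (?S e \<omega>)) * indicator (space M) \<omega> \<partial>M)"
      by (rule nn_integral_Markov_inequality [OF _ sets.top]) measurable
    also have "(\<integral>\<^sup>+\<omega>. ennreal (exp (?S e \<omega>)) * indicator (space M) \<omega> \<partial>M) = (\<integral>\<^sup>+\<omega>. ennreal (exp (?S e \<omega>)) \<partial>M)"
      by (intro nn_integral_cong) simp
    also have "ennreal (exp (- ?r)) * \<dots> \<le> ennreal (exp (- ?r)) * 1"
      by (intro mult_left_mono exp_supermartingale B c l e) simp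
    finally show ?thesis by simp
  qed
  have fin: "finite ?Es" by simp
  have cd: "card ?Es \<le> 2 * CARD('d)"
    using card_Un_le [of "Basis :: (real ^ 'd) set" "uminus ` Basis"] card_image_le [of "Basis :: (real ^ 'd) set" uminus] by simp
  have mG: "?G e \<in> sets M" for e by measurable
  have mUG: "(\<Union>e\<in>?Es. ?G e) \<in> sets M" by (intro sets.finite_UN fin mG)
  have mE: "?E j \<in> sets M" for j by measurable
  have mUE: "(\<Union>j<m. ?E j) \<in> sets M" by (intro sets.finite_UN mE) simp
  have mC: "?C \<in> sets M" and mV: "?V \<in> sets M" by measurable
  have "(\<Sum>e\<in>?Es. emeasure M (?G e)) \<le> (\<Sum>e\<in>?Es. ennreal (exp (- ?r)))" by (intro sum_mono G)
  also have "\<dots> = ennreal (real (card ?Es) * exp (- ?r))"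
    by (simp only: sum_constant ennreal_mult [OF of_nat_0_le_iff exp_ge_zero] ennreal_of_nat_eq_real_of_nat)
  also have "\<dots> \<le> ennreal (2 * ?d * exp (- ?r))"
  proof (intro ennreal_leI mult_right_mono)
    have "real (card ?Es) \<le> real (2 * CARD('d))" using cd by (rule of_nat_mono)
    then show "real (card ?Es) \<le> 2 * ?d" by (simp only: of_nat_mult of_nat_numeral)
  qed simp
  finally have UG: "emeasure M (\<Union>e\<in>?Es. ?G e) \<le> ennreal (2 * ?d * exp (- ?r))"
    by (rule order_trans [OF emeasure_subadditive_finite [OF fin], rotated]) (use mG in blast)
  have "emeasure M {\<omega> \<in> space M. norm (psum B m \<omega>) > x} \<le> emeasure M ((\<Union>j<m. ?E j) \<union> (?C \<union> ?V \<union> (\<Union>e\<in>?Es. ?G e)))"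
    by (rule emeasure_mono [OF sub]) (intro sets.Un mUE mC mV mUG)
  also have "\<dots> \<le> emeasure M (\<Union>j<m. ?E j) + emeasure M (?C \<union> ?V \<union> (\<Union>e\<in>?Es. ?G e))"
    by (intro emeasure_subadditive sets.Un mUE mC mV mUG)
  also have "\<dots> \<le> (\<Sum>j<m. emeasure M (?E j)) + (emeasure M (?C \<union> ?V) + emeasure M (\<Union>e\<in>?Es. ?G e))"
  proof (rule add_mono)
    show "emeasure M (\<Union>j<m. ?E j) \<le> (\<Sum>j<m. emeasure M (?E j))"
      by (rule emeasure_subadditive_finite) (use mE in blast)+
    show "emeasure M (?C \<union> ?V \<union> (\<Union>e\<in>?Es. ?G e)) \<le> emeasure M (?C \<union> ?V) + emeasure M (\<Union>e\<in>?Es. ?G e)"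
      by (intro emeasure_subadditive sets.Un mC mV mUG)
  qed
  also have "\<dots> \<le> (\<Sum>j<m. emeasure M (?E j)) + ((emeasure M ?C + emeasure M ?V) + ennreal (2 * ?d * exp (- ?r)))"
    by (rule add_left_mono, rule add_mono [OF emeasure_subadditive [OF mC mV] UG])
  finally show ?thesis
    unfolding exceed_eq [OF B] minus_diff_eq by (simp only: of_nat_mult of_nat_numeral)
qed

end

section \<open>Negligibility of the tails of the series\<close>

context noise
begin

text \<open>Finite blocks with an arbitrary end m suffice, since \<open>remainder_bound\<close>
  passes to the infinite remainder. The range of admissible u may depend on the start n, but not on
  m.\<close>

definition negligible_tails :: "(nat \<Rightarrow> 'a \<Rightarrow> real ^ 'p ^ 'd) \<Rightarrow> bool" where
  "negligible_tails A \<longleftrightarrow> (\<forall>e>0. \<forall>\<^sub>F n in sequentially. \<forall>\<^sub>F u in at_top. \<forall>m.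
    emeasure M {\<omega> \<in> space M. norm (psum (delay n A) m \<omega>) > u} \<le> ennreal (e * T u))"

lemma nn_integral_wt_cmult:
  assumes "predictable A" "0 \<le> k" "g \<in> borel_measurable borel" "\<And>a. 0 \<le> g a"
  shows "(\<integral>\<^sup>+\<omega>. ennreal (k * g (op_norm (A j \<omega>))) \<partial>M) = ennreal k * (\<integral>\<^sup>+\<omega>. ennreal (g (op_norm (A j \<omega>))) \<partial>M)"
proof -
  have [measurable]: "A j \<in> borel_measurable M" "g \<in> borel_measurable borel"
    using assms by (auto intro: predictable_M)
  show ?thesis using assms(2,4) by (simp add: ennreal_mult nn_integral_cmult)
qed

lemma eventually_small_remainder:
  fixes f :: "nat \<Rightarrow> ennreal"
  assumes "(\<Sum>j. f j) < \<infinity>" "0 < e" "0 < k"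
  shows "\<forall>\<^sub>F n in sequentially. ennreal k * (\<Sum>j. f (j + n)) \<le> ennreal e"
proof -
  have "0 < ennreal (e / k)" using assms by simp
  from order_tendstoD(2) [OF suminf_tail_ennreal [OF assms(1)] this]
  show ?thesis
  proof eventually_elim
    case (elim n)
    then have "ennreal k * (\<Sum>j. f (j + n)) \<le> ennreal k * ennreal (e / k)" by (intro mult_left_mono) auto
    also have "\<dots> = ennreal e" using assms by (simp add: ennreal_mult [symmetric])
    finally show ?case .
  qed
qed

text \<open>The truncation level u and the threshold x are kept apart: convergence uses one fixed
  level for all x > 0, negligibility takes x = u.\<close>

lemma cost_le_regular:
  assumes \<eta>: "0 < \<eta>" "\<eta> < \<alpha>" and cs: "\<alpha> + \<eta> < 1 \<or> 1 < \<alpha> - \<eta> \<and> \<alpha> + \<eta> < 2 \<and> mean_zero"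
  obtains C u0 where "C > 0" "u0 \<ge> 1"
    "\<And>u x A. u \<ge> u0 \<Longrightarrow> x > 0 \<Longrightarrow>
      cost x u (A :: real ^ 'p ^ 'd) \<le> ennreal (C * (1 + 2 * (u / x) + 4 * (u / x)\<^sup>2) * T u * wt \<eta> (op_norm A))"
proof -
  obtain C0 u0 where 0: "C0 > 0" "u0 \<ge> 1"
    "\<And>u a. u \<ge> u0 \<Longrightarrow> a \<ge> 0 \<Longrightarrow> prob {z. a * norm z > u} \<le> C0 * T u * wt \<eta> a"
    using potter [OF \<eta>] by blast
  obtain C1 u1 where 1: "C1 > 0" "u1 \<ge> 1"
    "\<And>u A. u \<ge> u1 \<Longrightarrow> norm (comp u (A :: real ^ 'p ^ 'd)) \<le> C1 * u * T u * wt \<eta> (op_norm A)"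
    "\<And>u A. u \<ge> u1 \<Longrightarrow> vr u (A :: real ^ 'p ^ 'd) \<le> C1 * u\<^sup>2 * T u * wt \<eta> (op_norm A)"
    by (rule bounds_regular [OF \<eta> cs]) blast
  show ?thesis
  proof (rule that [of "max C0 C1" "max u0 u1"])
    fix u x :: real and A :: "real ^ 'p ^ 'd" assume u: "max u0 u1 \<le> u" and x: "x > 0"
    let ?C = "max C0 C1" let ?w = "T u * wt \<eta> (op_norm A)"
    have w: "0 \<le> ?w" using tail_pos [of u] by simp
    have u': "u0 \<le> u" "u1 \<le> u" "0 < u" using u 0(2) by auto
    have "prob {z. op_norm A * norm z > u} \<le> C0 * ?w" using 0(3) [OF u'(1), of "op_norm A"] by (simp add: mult.assoc)
    also have "\<dots> \<le> ?C * ?w" using w by (intro mult_right_mono) auto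
    finally have a: "prob {z. op_norm A * norm z > u} \<le> ?C * ?w" .
    have "norm (comp u A) \<le> C1 * (u * ?w)" using 1(3) [OF u'(2), of A] by (simp add: mult_ac)
    also have "\<dots> \<le> ?C * (u * ?w)" using w u' by (intro mult_right_mono) auto
    finally have "2 / x * norm (comp u A) \<le> 2 / x * (?C * (u * ?w))" using x by (intro mult_left_mono) auto
    then have b: "2 / x * norm (comp u A) \<le> ?C * (2 * (u / x)) * ?w" by (simp add: mult_ac)
    have "vr u A \<le> C1 * (u\<^sup>2 * ?w)" using 1(4) [OF u'(2), of A] by (simp add: mult_ac)
    also have "\<dots> \<le> ?C * (u\<^sup>2 * ?w)" using w u' by (intro mult_right_mono) auto
    finally have "4 / x\<^sup>2 * vr u A \<le> 4 / x\<^sup>2 * (?C * (u\<^sup>2 * ?w))" using x by (intro mult_left_mono) auto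
    then have c: "4 / x\<^sup>2 * vr u A \<le> ?C * (4 * (u / x)\<^sup>2) * ?w" by (simp add: mult_ac power_divide)
    have "prob {z. op_norm A * norm z > u} + 2 / x * norm (comp u A) + 4 / x\<^sup>2 * vr u A
        \<le> ?C * ?w + ?C * (2 * (u / x)) * ?w + ?C * (4 * (u / x)\<^sup>2) * ?w"
      by (intro add_mono a b c)
    also have "\<dots> = ?C * (1 + 2 * (u / x) + 4 * (u / x)\<^sup>2) * T u * wt \<eta> (op_norm A)"
      by (simp only: distrib_left distrib_right mult.assoc mult_1_right mult_1_left)
    finally show "cost x u A \<le> ennreal (?C * (1 + 2 * (u / x) + 4 * (u / x)\<^sup>2) * T u * wt \<eta> (op_norm A))"
      unfolding cost_def by (rule ennreal_leI)
  qed (use 0 in auto)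
qed

text \<open>For x = u the cost of a term is at most 7 C T(u) times its weight, 7 being 1 + 2 + 4, so
  the tail of the convergent series of weights is the relevant small factor.\<close>

lemma regular_case:
  fixes A :: "nat \<Rightarrow> 'a \<Rightarrow> real ^ 'p ^ 'd"
  assumes A: "predictable A"
    and \<eta>: "0 < \<eta>" "\<eta> < \<alpha>" and cs: "\<alpha> + \<eta> < 1 \<or> 1 < \<alpha> - \<eta> \<and> \<alpha> + \<eta> < 2 \<and> mean_zero"
    and fin: "(\<Sum>j. \<integral>\<^sup>+\<omega>. ennreal (wt \<eta> (op_norm (A j \<omega>))) \<partial>M) < \<infinity>"
  shows "AE \<omega> in M. summable (\<lambda>j. A j \<omega> *v Z j \<omega>)" "negligible_tails A"
proof -
  obtain C u0 where C: "C > 0" "u0 \<ge> 1"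
    "\<And>u x A. u \<ge> u0 \<Longrightarrow> x > 0 \<Longrightarrow>
      cost x u (A :: real ^ 'p ^ 'd) \<le> ennreal (C * (1 + 2 * (u / x) + 4 * (u / x)\<^sup>2) * T u * wt \<eta> (op_norm A))"
    by (rule cost_le_regular [OF \<eta> cs]) blast
  let ?k = "\<lambda>u x. C * (1 + 2 * (u / x) + 4 * (u / x)\<^sup>2) * T u"
  have k: "0 < ?k u x" if "u \<ge> u0" "x > 0" for u x
    using C(1,2) that tail_pos [of u] by (intro mult_pos_pos add_pos_nonneg) auto
  have int: "(\<integral>\<^sup>+\<omega>. cost x u (A j \<omega>) \<partial>M) \<le> ennreal (?k u x) * (\<integral>\<^sup>+\<omega>. ennreal (wt \<eta> (op_norm (A j \<omega>))) \<partial>M)"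
    if "u \<ge> u0" "x > 0" for u x j
    by (subst nn_integral_wt_cmult [OF A less_imp_le [OF k [OF that]] wt_measurable wt_nonneg, symmetric])
      (intro nn_integral_mono C(3) that)
  show "AE \<omega> in M. summable (\<lambda>j. A j \<omega> *v Z j \<omega>)"
  proof (rule AE_summable [OF A])
    fix x :: real assume x: "0 < x"
    have "(\<Sum>j. \<integral>\<^sup>+\<omega>. cost x u0 (A j \<omega>) \<partial>M)
        \<le> (\<Sum>j. ennreal (?k u0 x) * (\<integral>\<^sup>+\<omega>. ennreal (wt \<eta> (op_norm (A j \<omega>))) \<partial>M))"
      by (intro suminf_le int order_refl x summableI)
    also have "\<dots> = ennreal (?k u0 x) * (\<Sum>j. \<integral>\<^sup>+\<omega>. ennreal (wt \<eta> (op_norm (A j \<omega>))) \<partial>M)"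
      by (rule ennreal_suminf_cmult)
    also have "\<dots> < \<infinity>" using fin by (simp add: ennreal_mult_less_top)
    finally show "\<exists>c\<ge>0. (\<Sum>j. \<integral>\<^sup>+\<omega>. cost x c (A j \<omega>) \<partial>M) < \<infinity>"
      using C(2) by (intro exI [of _ u0] conjI) auto
  qed
  show "negligible_tails A"
    unfolding negligible_tails_def
  proof (intro allI impI)
    fix e :: real assume e: "e > 0"
    have "\<forall>\<^sub>F n in sequentially. ennreal (7 * C) * (\<Sum>j. \<integral>\<^sup>+\<omega>. ennreal (wt \<eta> (op_norm (A (j + n) \<omega>))) \<partial>M) \<le> ennreal e"
      using C(1) by (intro eventually_small_remainder [OF fin e]) simp
    then show "\<forall>\<^sub>F n in sequentially. \<forall>\<^sub>F u in at_top. \<forall>m.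
        emeasure M {\<omega> \<in> space M. norm (psum (delay n A) m \<omega>) > u} \<le> ennreal (e * T u)"
    proof eventually_elim
      case (elim n)
      note n = elim
      have "emeasure M {\<omega> \<in> space M. norm (psum (delay n A) m \<omega>) > u} \<le> ennreal (e * T u)" if u: "u \<ge> u0" for u m
      proof -
        have u1: "u > 0" using u C(2) by linarith
        have "emeasure M {\<omega> \<in> space M. norm (psum (delay n A) m \<omega>) > u} \<le> (\<Sum>j<m. \<integral>\<^sup>+\<omega>. cost u u (delay n A j \<omega>) \<partial>M)"
          using u1 by (intro tail_bound_L2 predictable_delay A) auto
        also have "\<dots> \<le> (\<Sum>j. \<integral>\<^sup>+\<omega>. cost u u (A (j + n) \<omega>) \<partial>M)"
          using u1 by (intro sum_delay_le) simp
        also have "\<dots> \<le> (\<Sum>j. ennreal (?k u u) * (\<integral>\<^sup>+\<omega>. ennreal (wt \<eta> (op_norm (A (j + n) \<omega>))) \<partial>M))"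
          by (intro suminf_le int u u1 summableI)
        also have "\<dots> = ennreal (?k u u) * (\<Sum>j. \<integral>\<^sup>+\<omega>. ennreal (wt \<eta> (op_norm (A (j + n) \<omega>))) \<partial>M)"
          by (rule ennreal_suminf_cmult)
        also have "?k u u = T u * (7 * C)" using u1 by simp
        also have "ennreal (T u * (7 * C)) = ennreal (T u) * ennreal (7 * C)"
          using tail_pos [of u] C(1) by (intro ennreal_mult) auto
        also have "ennreal (T u) * ennreal (7 * C) * (\<Sum>j. \<integral>\<^sup>+\<omega>. ennreal (wt \<eta> (op_norm (A (j + n) \<omega>))) \<partial>M)
            \<le> ennreal (T u) * ennreal e"
          unfolding mult.assoc by (rule mult_left_mono [OF n]) simp
        also have "\<dots> = ennreal (e * T u)"
          using tail_pos [of u] e by (simp add: ennreal_mult [symmetric] mult.commute)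
        finally show ?thesis .
      qed
      then show ?case by (intro eventually_at_top_linorderI [of u0] allI)
    qed
  qed
qed

section \<open>The power case, for \<alpha> = 1, \<alpha> = 2 and \<alpha> > 2\<close>

lemma ennreal_powr_measurable:
  assumes [measurable]: "W \<in> borel_measurable M"
  shows "(\<lambda>\<omega>. ennreal_powr (W \<omega>) r) \<in> borel_measurable M"
  unfolding ennreal_powr_def by measurable

lemma power_tail:
  assumes [measurable]: "W \<in> borel_measurable M" and k: "0 < k" and r: "0 < r"
  shows "emeasure M {\<omega> \<in> space M. W \<omega> > ennreal k} \<le> ennreal (k powr - r) * (\<integral>\<^sup>+\<omega>. ennreal_powr (W \<omega>) r \<partial>M)"
proof -
  note ennreal_powr_measurable [measurable]
  have "{\<omega> \<in> space M. W \<omega> > ennreal k} \<subseteq> {\<omega> \<in> space M. 1 \<le> ennreal (k powr - r) * ennreal_powr (W \<omega>) r}"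
  proof safe
    fix \<omega> assume W: "ennreal k < W \<omega>"
    show "1 \<le> ennreal (k powr - r) * ennreal_powr (W \<omega>) r"
    proof (cases "W \<omega> = \<infinity>")
      case True
      then show ?thesis using k by (simp add: ennreal_powr_def ennreal_mult_top)
    next
      case False
      define w where "w = enn2real (W \<omega>)"
      have w: "W \<omega> = ennreal w" using False by (simp add: w_def less_top [symmetric])
      then have "k < w" using W k by (simp add: ennreal_less_iff)
      then have "k powr r \<le> w powr r" using k r by (intro powr_mono2) auto
      then have "k powr - r * k powr r \<le> k powr - r * w powr r" by (rule mult_left_mono) simp
      then have "1 \<le> k powr - r * w powr r" using k by (simp add: powr_add [symmetric])
      then have "ennreal 1 \<le> ennreal (k powr - r * w powr r)" by (rule ennreal_leI)
      then show ?thesis using False by (simp add: ennreal_powr_def w_def ennreal_mult)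
    qed
  qed
  then have "emeasure M {\<omega> \<in> space M. W \<omega> > ennreal k} \<le> emeasure M {\<omega> \<in> space M. 1 \<le> ennreal (k powr - r) * ennreal_powr (W \<omega>) r}"
    by (rule emeasure_mono) measurable
  also have "\<dots> \<le> ennreal (k powr - r) * (\<integral>\<^sup>+\<omega>. ennreal_powr (W \<omega>) r * indicator (space M) \<omega> \<partial>M)"
    by (rule nn_integral_Markov_inequality [OF _ sets.top]) measurable
  also have "(\<integral>\<^sup>+\<omega>. ennreal_powr (W \<omega>) r * indicator (space M) \<omega> \<partial>M) = (\<integral>\<^sup>+\<omega>. ennreal_powr (W \<omega>) r \<partial>M)"
    by (intro nn_integral_cong) simp
  finally show ?thesis .
qed

text \<open>At one fixed level the exceedances are summed by the weights, and the compensators and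
  second moments by the powers of order \<gamma>. Convergence asks for no decay in the level, so the
  second-moment bound is enough here.\<close>

lemma power_case_summable:
  fixes A :: "nat \<Rightarrow> 'a \<Rightarrow> real ^ 'p ^ 'd"
  assumes A: "predictable A" and \<eta>: "0 < \<eta>" "\<eta> < \<alpha>"
    and \<gamma>: "0 < \<gamma>" "\<gamma> < \<alpha>" "\<gamma> \<le> 2" and cs: "\<gamma> \<le> 1 \<or> mean_zero"
    and fin: "(\<Sum>j. \<integral>\<^sup>+\<omega>. ennreal (wt \<eta> (op_norm (A j \<omega>))) \<partial>M) < \<infinity>"
    and fin\<gamma>: "(\<Sum>j. \<integral>\<^sup>+\<omega>. ennreal (op_norm (A j \<omega>) powr \<gamma>) \<partial>M) < \<infinity>"
  shows "AE \<omega> in M. summable (\<lambda>j. A j \<omega> *v Z j \<omega>)"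
proof (rule AE_summable [OF A])
  fix x :: real assume x: "0 < x"
  obtain C c where C: "C > 0" "c \<ge> 1"
    "\<And>u a. u \<ge> c \<Longrightarrow> a \<ge> 0 \<Longrightarrow> prob {z. a * norm z > u} \<le> C * T u * wt \<eta> a"
    using potter [OF \<eta>] by blast
  obtain m where m: "m > 0"
    "\<And>c A. c > 0 \<Longrightarrow> norm (comp c (A :: real ^ 'p ^ 'd)) \<le> m * c powr (1 - \<gamma>) * op_norm A powr \<gamma>"
    "\<And>c A. c > 0 \<Longrightarrow> vr c (A :: real ^ 'p ^ 'd) \<le> m * c powr (2 - \<gamma>) * op_norm A powr \<gamma>"
    by (rule bounds_power [OF \<gamma> cs]) blast
  have c: "c > 0" using C(2) by linarith
  let ?k = "C * T c" let ?l = "2 / x * (m * c powr (1 - \<gamma>)) + 4 / x\<^sup>2 * (m * c powr (2 - \<gamma>))"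
  have kl: "0 \<le> ?k" "0 \<le> ?l" using C(1) tail_pos [of c] m(1) x by (auto intro!: add_nonneg_nonneg)
  have "cost x c B \<le> ennreal (?k * wt \<eta> (op_norm B)) + ennreal (?l * op_norm B powr \<gamma>)" for B :: "real ^ 'p ^ 'd"
  proof -
    have "prob {z. op_norm B * norm z > c} \<le> ?k * wt \<eta> (op_norm B)" by (rule C(3)) simp_all
    moreover have "2 / x * norm (comp c B) \<le> 2 / x * (m * c powr (1 - \<gamma>) * op_norm B powr \<gamma>)"
      using x by (intro mult_left_mono m c) simp
    moreover have "4 / x\<^sup>2 * vr c B \<le> 4 / x\<^sup>2 * (m * c powr (2 - \<gamma>) * op_norm B powr \<gamma>)"
      by (intro mult_left_mono m c) simp
    ultimately have "prob {z. op_norm B * norm z > c} + 2 / x * norm (comp c B) + 4 / x\<^sup>2 * vr c B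
        \<le> ?k * wt \<eta> (op_norm B) + ?l * op_norm B powr \<gamma>"
      unfolding distrib_right mult.assoc by linarith
    then show ?thesis
      unfolding cost_def using kl by (simp add: ennreal_plus [symmetric] ennreal_leI del: ennreal_plus)
  qed
  then have "(\<integral>\<^sup>+\<omega>. cost x c (A j \<omega>) \<partial>M) \<le>
      (\<integral>\<^sup>+\<omega>. ennreal (?k * wt \<eta> (op_norm (A j \<omega>))) + ennreal (?l * op_norm (A j \<omega>) powr \<gamma>) \<partial>M)" for j
    by (intro nn_integral_mono)
  also have "\<dots> j = ennreal ?k * (\<integral>\<^sup>+\<omega>. ennreal (wt \<eta> (op_norm (A j \<omega>))) \<partial>M)
      + ennreal ?l * (\<integral>\<^sup>+\<omega>. ennreal (op_norm (A j \<omega>) powr \<gamma>) \<partial>M)" for j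
  proof -
    have [measurable]: "A j \<in> borel_measurable M" using A by (rule predictable_M)
    have "(\<integral>\<^sup>+\<omega>. ennreal (?k * wt \<eta> (op_norm (A j \<omega>))) + ennreal (?l * op_norm (A j \<omega>) powr \<gamma>) \<partial>M)
        = (\<integral>\<^sup>+\<omega>. ennreal (?k * wt \<eta> (op_norm (A j \<omega>))) \<partial>M) + (\<integral>\<^sup>+\<omega>. ennreal (?l * op_norm (A j \<omega>) powr \<gamma>) \<partial>M)"
      by (rule nn_integral_add) measurable
    moreover have "(\<integral>\<^sup>+\<omega>. ennreal (?l * op_norm (A j \<omega>) powr \<gamma>) \<partial>M)
        = ennreal ?l * (\<integral>\<^sup>+\<omega>. ennreal (op_norm (A j \<omega>) powr \<gamma>) \<partial>M)"
      by (rule nn_integral_wt_cmult [OF A kl(2), where g = "\<lambda>a. a powr \<gamma>"]) simp_all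
    ultimately show ?thesis by (simp only: nn_integral_wt_cmult [OF A kl(1) wt_measurable wt_nonneg])
  qed
  finally have bd: "(\<integral>\<^sup>+\<omega>. cost x c (A j \<omega>) \<partial>M) \<le> ennreal ?k * (\<integral>\<^sup>+\<omega>. ennreal (wt \<eta> (op_norm (A j \<omega>))) \<partial>M)
      + ennreal ?l * (\<integral>\<^sup>+\<omega>. ennreal (op_norm (A j \<omega>) powr \<gamma>) \<partial>M)" for j .
  have "(\<Sum>j. \<integral>\<^sup>+\<omega>. cost x c (A j \<omega>) \<partial>M) \<le> (\<Sum>j. ennreal ?k * (\<integral>\<^sup>+\<omega>. ennreal (wt \<eta> (op_norm (A j \<omega>))) \<partial>M)
      + ennreal ?l * (\<integral>\<^sup>+\<omega>. ennreal (op_norm (A j \<omega>) powr \<gamma>) \<partial>M))"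
    by (intro suminf_le bd summableI)
  also have "\<dots> = ennreal ?k * (\<Sum>j. \<integral>\<^sup>+\<omega>. ennreal (wt \<eta> (op_norm (A j \<omega>))) \<partial>M)
      + ennreal ?l * (\<Sum>j. \<integral>\<^sup>+\<omega>. ennreal (op_norm (A j \<omega>) powr \<gamma>) \<partial>M)"
    by (simp add: suminf_add [OF summableI summableI, symmetric] ennreal_suminf_cmult)
  also have "\<dots> < \<infinity>" using fin fin\<gamma> by (simp add: ennreal_mult_less_top)
  finally show "\<exists>c\<ge>0. (\<Sum>j. \<integral>\<^sup>+\<omega>. cost x c (A j \<omega>) \<partial>M) < \<infinity>"
    using c by (intro exI [of _ c] conjI) auto
qed

text \<open>Truncation at \<open>u / K\<close> turns the exponential bound into \<open>u\<close> to the power \<open>- \<theta> K / (4 d)\<close>, so \<open>K\<close> is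
  taken large; \<open>\<theta>\<close> is small enough that \<open>W > u\<^bsup>\<gamma> - \<theta>\<^esup>\<close> still has probability \<open>o(T(u))\<close>.\<close>

lemma power_case_tails:
  fixes A :: "nat \<Rightarrow> 'a \<Rightarrow> real ^ 'p ^ 'd"
  assumes A: "predictable A" and \<eta>: "0 < \<eta>" "\<eta> < \<alpha>"
    and \<gamma>: "0 < \<gamma>" "\<gamma> < \<alpha>" "\<gamma> \<le> 2" and cs: "\<gamma> \<le> 1 \<or> mean_zero" and q: "\<alpha> < q"
    and fin: "(\<Sum>j. \<integral>\<^sup>+\<omega>. ennreal (wt \<eta> (op_norm (A j \<omega>))) \<partial>M) < \<infinity>"
    and finq: "(\<integral>\<^sup>+\<omega>. ennreal_powr (\<Sum>j. ennreal (op_norm (A j \<omega>) powr \<gamma>)) (q / \<gamma>) \<partial>M) < \<infinity>"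
  shows "negligible_tails A"
proof -
  define W where "W \<omega> = (\<Sum>j. ennreal (op_norm (A j \<omega>) powr \<gamma>))" for \<omega>
  define r where "r = q / \<gamma>"
  define E where "E = enn2real (\<integral>\<^sup>+\<omega>. ennreal_powr (W \<omega>) r \<partial>M)"
  \<comment> \<open>Makes (\<gamma> - \<theta>) q / \<gamma> the midpoint of \<alpha> and q, so that
    W exceeds a multiple of u^(\<gamma> - \<theta>) with probability of order u^(-(q + \<alpha>) /
    2), which is o(T(u)).\<close>
  define \<theta> where "\<theta> = \<gamma> * (q - \<alpha>) / (2 * q)"
  define d where "d = real CARD('d)"
  \<comment> \<open>Makes \<theta> K / (4 d) at least \<alpha> + 1, so that the exponential term is
    o(T(u)); K \<ge> 1 is required by \<open>wt_scale_up\<close>.\<close>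
  define K where "K = max 1 (4 * d * (\<alpha> + 1) / \<theta>)"
  have [measurable]: "A j \<in> borel_measurable M" for j using A by (rule predictable_M)
  have Wm [measurable]: "W \<in> borel_measurable M" unfolding W_def [abs_def] by measurable
  have E: "(\<integral>\<^sup>+\<omega>. ennreal_powr (W \<omega>) r \<partial>M) = ennreal E" "0 \<le> E"
    using finq by (simp_all add: E_def W_def r_def)
  have q0: "0 < q" using q \<gamma> by linarith
  have r: "0 < r" using q0 \<gamma> by (simp add: r_def)
  have \<theta>: "0 < \<theta>" using q q0 \<gamma> by (simp add: \<theta>_def)
  have d: "1 \<le> d" by (simp add: d_def Suc_leI)
  have K: "1 \<le> K" by (simp add: K_def)
  have gr: "\<gamma> * r = q" using \<gamma> by (simp add: r_def)
  have ex: "(\<gamma> - \<theta>) * r = (q + \<alpha>) / 2"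
    using \<gamma> q0 by (simp add: r_def \<theta>_def field_simps)
  obtain C u0 where C: "C > 0" "u0 \<ge> 1"
    "\<And>u a. u \<ge> u0 \<Longrightarrow> a \<ge> 0 \<Longrightarrow> prob {z. a * norm z > u} \<le> C * T u * wt \<eta> a"
    using potter [OF \<eta>] by blast
  obtain m0 where m0: "m0 > 0"
    "\<And>c A. c > 0 \<Longrightarrow> norm (comp c (A :: real ^ 'p ^ 'd)) \<le> m0 * c powr (1 - \<gamma>) * op_norm A powr \<gamma>"
    "\<And>c A. c > 0 \<Longrightarrow> vr c (A :: real ^ 'p ^ 'd) \<le> m0 * c powr (2 - \<gamma>) * op_norm A powr \<gamma>"
    by (rule bounds_power [OF \<gamma> cs]) blast
  define k1 where "k1 = K powr (1 - \<gamma>) / (2 * d * m0)"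
  define k2 where "k2 = K powr (2 - \<gamma>) / m0"
  have k: "k1 > 0" "k2 > 0" using K d m0(1) by (simp_all add: k1_def k2_def)
  \<comment> \<open>The three errors come from large compensators, large sums of second moments and
    the exponential bound; each is a power of u with exponent below -\<alpha>.\<close>
  define R where "R u = k1 powr - r * E * u powr - q + k2 powr - r * E * u powr - ((q + \<alpha>) / 2)
    + 2 * d * exp (K\<^sup>2) * u powr - (\<theta> * K / (4 * d))" for u
  have Rnn: "0 \<le> R u" for u using E d by (simp add: R_def)
  have bound: "emeasure M {\<omega> \<in> space M. norm (psum (delay n A) m \<omega>) > u} \<le>
      ennreal (C * T u * K powr (\<alpha> + \<eta>)) * (\<Sum>j. \<integral>\<^sup>+\<omega>. ennreal (wt \<eta> (op_norm (A (j + n) \<omega>))) \<partial>M) + ennreal (R u)"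
    if u: "u \<ge> u0" and u2: "u > 1" for n m u
  proof -
    define c where "c = u / K"
    \<comment> \<open>With this y and the next t, \<open>exp (2 * t * c)\<close> is u^\<theta> and
      the quadratic term of the exponent becomes the constant K^2, while the linear term is a
      negative multiple of ln u.\<close>
    define y where "y = u powr (2 - \<theta>)"
    define t where "t = \<theta> * ln u / (2 * c)"
    have u1: "u \<ge> 1" "u > 0" using u C(2) by auto
    have c: "c > 0" using u1 K by (simp add: c_def)
    let ?B = "delay n A"
    have B: "predictable ?B" by (rule predictable_delay [OF A])
    have [measurable]: "?B j \<in> borel_measurable M" for j using B by (rule predictable_M)
    have sumW: "ennreal (\<Sum>j<m. op_norm (?B j \<omega>) powr \<gamma>) \<le> W \<omega>" for \<omega>
    proof -
      have "ennreal (\<Sum>j<m. op_norm (?B j \<omega>) powr \<gamma>) = (\<Sum>j<m. ennreal (op_norm (?B j \<omega>) powr \<gamma>))"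
        by (simp add: sum_ennreal)
      also have "\<dots> \<le> (\<Sum>j<m. ennreal (op_norm (A j \<omega>) powr \<gamma>))"
        using \<gamma> by (intro sum_mono) (simp add: delay_def)
      also have "\<dots> \<le> W \<omega>" unfolding W_def by (intro sum_le_suminf summableI) auto
      finally show ?thesis .
    qed
    \<comment> \<open>Compensators and second moments are both dominated by a constant s times the
      power of order \<gamma>, so their sums exceed X only where W exceeds X / s.\<close>
    have Wtail: "emeasure M {\<omega> \<in> space M. (\<Sum>j<m. f (?B j \<omega>)) > X} \<le> ennreal ((X / s) powr - r * E)"
      if f: "\<And>A. f A \<le> s * op_norm A powr \<gamma>" and s: "s > 0" and X: "X > 0" for f :: "real ^ 'p ^ 'd \<Rightarrow> real" and s X
    proof -
      have "{\<omega> \<in> space M. (\<Sum>j<m. f (?B j \<omega>)) > X} \<subseteq> {\<omega> \<in> space M. W \<omega> > ennreal (X / s)}"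
      proof safe
        fix \<omega> assume "X < (\<Sum>j<m. f (?B j \<omega>))"
        also have "\<dots> \<le> (\<Sum>j<m. s * op_norm (?B j \<omega>) powr \<gamma>)" by (intro sum_mono f)
        also have "\<dots> = s * (\<Sum>j<m. op_norm (?B j \<omega>) powr \<gamma>)" by (simp add: sum_distrib_left)
        finally have "X / s < (\<Sum>j<m. op_norm (?B j \<omega>) powr \<gamma>)" using s by (simp add: divide_less_eq mult.commute)
        then have "ennreal (X / s) < ennreal (\<Sum>j<m. op_norm (?B j \<omega>) powr \<gamma>)"
          using s X by (intro ennreal_lessI) (auto intro: order_le_less_trans [of 0 "X / s"])
        then show "ennreal (X / s) < W \<omega>" using sumW [of \<omega>] by (rule order_less_le_trans)
      qed
      then have "emeasure M {\<omega> \<in> space M. (\<Sum>j<m. f (?B j \<omega>)) > X} \<le> emeasure M {\<omega> \<in> space M. W \<omega> > ennreal (X / s)}"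
        by (rule emeasure_mono) measurable
      also have "\<dots> \<le> ennreal ((X / s) powr - r) * ennreal E"
        unfolding E(1) [symmetric] using s X by (intro power_tail Wm r) simp
      finally show ?thesis using E(2) by (simp add: ennreal_mult)
    qed
    have e1: "u / (2 * d) / (m0 * c powr (1 - \<gamma>)) = k1 * u powr \<gamma>"
    proof -
      have "u powr \<gamma> * u powr (1 - \<gamma>) = u" using u1 by (simp add: powr_add [symmetric])
      then show ?thesis using u1 K m0(1) d by (simp add: c_def k1_def powr_divide field_simps)
    qed
    have e2: "y / (m0 * c powr (2 - \<gamma>)) = k2 * u powr (\<gamma> - \<theta>)"
    proof -
      have "u powr (\<gamma> - \<theta>) * u powr (2 - \<gamma>) = y" using u1 by (simp add: powr_add [symmetric] y_def)
      then show ?thesis using u1 K m0(1) by (simp add: c_def k2_def powr_divide field_simps)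
    qed
    have P1: "emeasure M {\<omega> \<in> space M. (\<Sum>j<m. norm (comp c (?B j \<omega>))) > u / (2 * d)} \<le> ennreal (k1 powr - r * E * u powr - q)"
    proof -
      have "emeasure M {\<omega> \<in> space M. (\<Sum>j<m. norm (comp c (?B j \<omega>))) > u / (2 * d)}
          \<le> ennreal ((u / (2 * d) / (m0 * c powr (1 - \<gamma>))) powr - r * E)"
        using u1 d m0(1) c by (intro Wtail m0(2)) auto
      also have "(u / (2 * d) / (m0 * c powr (1 - \<gamma>))) powr - r * E = k1 powr - r * E * u powr - q"
        unfolding e1 using k(1) u1 gr by (simp add: powr_mult powr_powr mult_ac)
      finally show ?thesis .
    qed
    have P2: "emeasure M {\<omega> \<in> space M. (\<Sum>j<m. vr c (?B j \<omega>)) > y} \<le> ennreal (k2 powr - r * E * u powr - ((q + \<alpha>) / 2))"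
    proof -
      have "emeasure M {\<omega> \<in> space M. (\<Sum>j<m. vr c (?B j \<omega>)) > y} \<le> ennreal ((y / (m0 * c powr (2 - \<gamma>))) powr - r * E)"
        using u1 m0(1) c by (intro Wtail m0(3)) (auto simp: y_def)
      also have "(y / (m0 * c powr (2 - \<gamma>))) powr - r * E = k2 powr - r * E * u powr - ((\<gamma> - \<theta>) * r)"
        unfolding e2 using k(2) u1 by (simp add: powr_mult powr_powr mult_ac)
      finally show ?thesis unfolding ex .
    qed
    have P0: "(\<Sum>j<m. \<integral>\<^sup>+\<omega>. ennreal (prob {z. op_norm (?B j \<omega>) * norm z > c}) \<partial>M)
        \<le> ennreal (C * T u * K powr (\<alpha> + \<eta>)) * (\<Sum>j. \<integral>\<^sup>+\<omega>. ennreal (wt \<eta> (op_norm (A (j + n) \<omega>))) \<partial>M)"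
    proof -
      have kk: "0 \<le> C * T u * K powr (\<alpha> + \<eta>)" using C(1) tail_pos [of u] by simp
      have "(\<Sum>j<m. \<integral>\<^sup>+\<omega>. ennreal (prob {z. op_norm (?B j \<omega>) * norm z > c}) \<partial>M)
          \<le> (\<Sum>j. \<integral>\<^sup>+\<omega>. ennreal (prob {z. op_norm (A (j + n) \<omega>) * norm z > c}) \<partial>M)"
        using c by (intro sum_delay_le [where f = "\<lambda>A. ennreal (prob {z. op_norm A * norm z > c})"]) (simp add: not_less)
      also have "\<dots> \<le> (\<Sum>j. \<integral>\<^sup>+\<omega>. ennreal (C * T u * K powr (\<alpha> + \<eta>) * wt \<eta> (op_norm (A (j + n) \<omega>))) \<partial>M)"
      proof (intro suminf_le nn_integral_mono ennreal_leI summableI)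
        fix j \<omega>
        let ?a = "op_norm (A (j + n) \<omega>)"
        have "prob {z. ?a * norm z > c} = prob {z. (K * ?a) * norm z > u}"
          using K by (intro arg_cong [where f = prob]) (simp add: c_def divide_less_eq mult_ac)
        also have "\<dots> \<le> C * T u * wt \<eta> (K * ?a)" using K by (intro C(3) u) simp
        also have "\<dots> \<le> C * T u * (K powr (\<alpha> + \<eta>) * wt \<eta> ?a)"
          using K C(1) tail_pos [of u] \<eta> by (intro mult_left_mono wt_scale_up) auto
        finally show "prob {z. ?a * norm z > c} \<le> C * T u * K powr (\<alpha> + \<eta>) * wt \<eta> ?a" by (simp add: mult.assoc)
      qed
      also have "\<dots> = (\<Sum>j. ennreal (C * T u * K powr (\<alpha> + \<eta>)) * (\<integral>\<^sup>+\<omega>. ennreal (wt \<eta> (op_norm (A (j + n) \<omega>))) \<partial>M))"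
        unfolding nn_integral_wt_cmult [OF A kk wt_measurable wt_nonneg] ..
      also have "\<dots> = ennreal (C * T u * K powr (\<alpha> + \<eta>)) * (\<Sum>j. \<integral>\<^sup>+\<omega>. ennreal (wt \<eta> (op_norm (A (j + n) \<omega>))) \<partial>M)"
        by (rule ennreal_suminf_cmult)
      finally show ?thesis .
    qed
    have t: "t > 0" using u2 \<theta> c by (simp add: t_def)
    have exp: "exp (exp (2 * t * c) / c\<^sup>2 * y - t * (u / (2 * d))) = exp (K\<^sup>2) * u powr - (\<theta> * K / (4 * d))"
    proof -
      have "2 * t * c = \<theta> * ln u" using c by (simp add: t_def)
      then have "exp (2 * t * c) = u powr \<theta>" using u1 by (simp add: powr_def)
      then have "exp (2 * t * c) / c\<^sup>2 * y = u powr \<theta> * u powr (2 - \<theta>) * K\<^sup>2 / u\<^sup>2"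
        by (simp add: y_def c_def power_divide)
      also have "u powr \<theta> * u powr (2 - \<theta>) = u\<^sup>2" using u1 by (simp add: powr_add [symmetric] powr_two)
      finally have 1: "exp (2 * t * c) / c\<^sup>2 * y = K\<^sup>2" using u1 by simp
      have 2: "t * (u / (2 * d)) = \<theta> * K / (4 * d) * ln u" using u1 K by (simp add: t_def c_def field_simps)
      have "exp (- (\<theta> * K / (4 * d) * ln u)) = u powr - (\<theta> * K / (4 * d))" using u1 by (simp add: powr_def)
      then show ?thesis unfolding 1 2 diff_conv_add_uminus exp_add by (simp only:)
    qed
    have "emeasure M {\<omega> \<in> space M. norm (psum ?B m \<omega>) > u} \<le>
      (\<Sum>j<m. \<integral>\<^sup>+\<omega>. ennreal (prob {z. op_norm (?B j \<omega>) * norm z > c}) \<partial>M)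
      + (emeasure M {\<omega> \<in> space M. (\<Sum>j<m. norm (comp c (?B j \<omega>))) > u / (2 * d)}
       + emeasure M {\<omega> \<in> space M. (\<Sum>j<m. vr c (?B j \<omega>)) > y}
       + ennreal (2 * d * exp (exp (2 * t * c) / c\<^sup>2 * y - t * (u / (2 * d)))))"
      using tail_bound_exp [OF B c t u1(2), of m y] by (simp add: d_def)
    also have "\<dots> \<le> ennreal (C * T u * K powr (\<alpha> + \<eta>)) * (\<Sum>j. \<integral>\<^sup>+\<omega>. ennreal (wt \<eta> (op_norm (A (j + n) \<omega>))) \<partial>M)
       + (ennreal (k1 powr - r * E * u powr - q) + ennreal (k2 powr - r * E * u powr - ((q + \<alpha>) / 2))
         + ennreal (2 * d * (exp (K\<^sup>2) * u powr - (\<theta> * K / (4 * d)))))"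
      unfolding exp by (intro add_mono P0 P1 P2 order_refl)
    also have "ennreal (k1 powr - r * E * u powr - q) + ennreal (k2 powr - r * E * u powr - ((q + \<alpha>) / 2))
         + ennreal (2 * d * (exp (K\<^sup>2) * u powr - (\<theta> * K / (4 * d)))) = ennreal (R u)"
      using E(2) d by (simp add: R_def ennreal_plus [symmetric] mult.assoc del: ennreal_plus)
    finally show ?thesis .
  qed
  have "((\<lambda>u. R u / T u) \<longlongrightarrow> 0) at_top"
  proof -
    have "\<theta> * K / (4 * d) > \<alpha>"
    proof -
      have "4 * d * (\<alpha> + 1) \<le> \<theta> * K" using \<theta> by (simp add: K_def max_def field_simps)
      then have "\<alpha> + 1 \<le> \<theta> * K / (4 * d)" using d by (simp add: le_divide_eq mult_ac)
      then show ?thesis by simp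
    qed
    then have "((\<lambda>u. k1 powr - r * E * (u powr - q / T u) + k2 powr - r * E * (u powr - ((q + \<alpha>) / 2) / T u)
        + 2 * d * exp (K\<^sup>2) * (u powr - (\<theta> * K / (4 * d)) / T u)) \<longlongrightarrow>
        k1 powr - r * E * 0 + k2 powr - r * E * 0 + 2 * d * exp (K\<^sup>2) * 0) at_top"
      using q by (intro tendsto_add tendsto_mult tendsto_const T_poly_lower) auto
    then show ?thesis by (simp add: R_def add_divide_distrib)
  qed
  note Rlim = this
  show ?thesis
    unfolding negligible_tails_def
  proof (intro allI impI)
    fix e :: real assume e: "e > 0"
    let ?k = "C * K powr (\<alpha> + \<eta>)"
    have kp: "0 < ?k" using C(1) K by simp
    have "\<forall>\<^sub>F n in sequentially. ennreal ?k * (\<Sum>j. \<integral>\<^sup>+\<omega>. ennreal (wt \<eta> (op_norm (A (j + n) \<omega>))) \<partial>M) \<le> ennreal (e / 2)"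
      using e by (intro eventually_small_remainder [OF fin _ kp]) simp
    then show "\<forall>\<^sub>F n in sequentially. \<forall>\<^sub>F u in at_top. \<forall>m.
        emeasure M {\<omega> \<in> space M. norm (psum (delay n A) m \<omega>) > u} \<le> ennreal (e * T u)"
    proof eventually_elim
      case (elim n)
      note n = elim
      have "\<forall>\<^sub>F u in at_top. R u / T u < e / 2" using e by (intro order_tendstoD(2) [OF Rlim]) simp
      then show ?case
        using eventually_ge_at_top [of u0] eventually_gt_at_top [of 1]
      proof eventually_elim
        case (elim u)
        have Tu: "T u > 0" by (rule tail_pos)
        have Ru: "R u \<le> e / 2 * T u" using elim(1) Tu by (simp add: divide_less_eq)
        show ?case
        proof
          fix m
          have "emeasure M {\<omega> \<in> space M. norm (psum (delay n A) m \<omega>) > u} \<le>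
              ennreal (T u * ?k) * (\<Sum>j. \<integral>\<^sup>+\<omega>. ennreal (wt \<eta> (op_norm (A (j + n) \<omega>))) \<partial>M) + ennreal (R u)"
            using bound [OF elim(2,3), of n m] by (simp add: mult_ac)
          also have "\<dots> \<le> ennreal (T u) * ennreal (e / 2) + ennreal (e / 2 * T u)"
          proof (rule add_mono)
            show "ennreal (T u * ?k) * (\<Sum>j. \<integral>\<^sup>+\<omega>. ennreal (wt \<eta> (op_norm (A (j + n) \<omega>))) \<partial>M) \<le> ennreal (T u) * ennreal (e / 2)"
              using mult_left_mono [OF n, of "ennreal (T u)"] Tu kp by (simp add: ennreal_mult mult.assoc)
          qed (rule ennreal_leI [OF Ru])
          also have "\<dots> = ennreal (e * T u)"
            using Tu e by (simp add: ennreal_mult [symmetric] ennreal_plus [symmetric] del: ennreal_plus)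
          finally show "emeasure M {\<omega> \<in> space M. norm (psum (delay n A) m \<omega>) > u} \<le> ennreal (e * T u)" .
        qed
      qed
    qed
  qed
qed

end

section \<open>A single big jump\<close>

text \<open>A deterministic inequality. With two terms above \<tau> everything is bounded crudely by
  (n + 1) G. Otherwise, unless r is large, the sum differs from its one large term by at most n
  \<tau> + \<rho> \<le> 2 \<rho>. The modulus w is charged only if that term exceeds \<delta> / 2;
  if not, 4 \<rho> \<le> \<delta> puts both the term and the sum where g vanishes. This localisation
  is what multiplies w by probabilities of order T(u).\<close>

lemma single_big_jump:
  fixes g :: "'b::real_normed_vector \<Rightarrow> real" and x :: "nat \<Rightarrow> 'b"
  assumes g: "\<And>y. 0 \<le> g y" "\<And>y. g y \<le> G" "\<And>y. norm y \<le> \<delta> \<Longrightarrow> g y = 0"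
    and mod: "\<And>y y'. norm (y - y') \<le> 2 * \<rho> \<Longrightarrow> \<bar>g y - g y'\<bar> \<le> w"
    and par: "0 < \<tau>" "\<tau> \<le> \<rho>" "real n * \<tau> \<le> \<rho>" "4 * \<rho> \<le> \<delta>" and w: "0 \<le> w"
  shows "\<bar>g ((\<Sum>j<n. x j) + r) - (\<Sum>j<n. g (x j))\<bar> \<le>
    (real n + 1) * G * (\<Sum>j<n. \<Sum>i<j. of_bool (norm (x i) > \<tau> \<and> norm (x j) > \<tau>))
    + G * of_bool (norm r > \<rho>) + w * (\<Sum>j<n. of_bool (norm (x j) > \<delta> / 2))"
    (is "?L \<le> (real n + 1) * G * ?P + ?R + w * ?S")
proof -
  have G: "0 \<le> G" using g(1) [of 0] g(2) [of 0] by linarith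
  have \<rho>: "0 < \<rho>" using par by linarith
  have P: "0 \<le> ?P" by (intro sum_nonneg) simp
  have S: "0 \<le> ?S" by (intro sum_nonneg) simp
  have R: "0 \<le> ?R" using G by simp
  have wS: "0 \<le> w * ?S" using w S by (rule mult_nonneg_nonneg)
  have GP: "0 \<le> (real n + 1) * G * ?P" using G P by (intro mult_nonneg_nonneg) auto
  show ?thesis
  proof (cases "\<exists>j<n. \<exists>i<j. norm (x i) > \<tau> \<and> norm (x j) > \<tau>")
    case True
    then obtain j i where ij: "j < n" "i < j" "norm (x i) > \<tau> \<and> norm (x j) > \<tau>" by blast
    have "(1 :: real) = of_bool (norm (x i) > \<tau> \<and> norm (x j) > \<tau>)" using ij(3) by simp
    also have "\<dots> \<le> (\<Sum>i<j. of_bool (norm (x i) > \<tau> \<and> norm (x j) > \<tau>))"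
      using ij(2) by (intro member_le_sum [where f = "\<lambda>i. of_bool (norm (x i) > \<tau> \<and> norm (x j) > \<tau>)"]) auto
    also have "\<dots> \<le> ?P"
      using ij(1) by (intro member_le_sum [where f = "\<lambda>j. \<Sum>i<j. of_bool (norm (x i) > \<tau> \<and> norm (x j) > \<tau>)"] sum_nonneg) auto
    finally have "(real n + 1) * G * 1 \<le> (real n + 1) * G * ?P" using G by (intro mult_left_mono) auto
    moreover have "?L \<le> (real n + 1) * G"
    proof -
      have "(\<Sum>j<n. g (x j)) \<le> real n * G" using sum_bounded_above [of "{..<n}" "\<lambda>j. g (x j)" G] g(2) by simp
      moreover have "0 \<le> (\<Sum>j<n. g (x j))" by (intro sum_nonneg g)
      ultimately show ?thesis using g(1,2) [of "(\<Sum>j<n. x j) + r"] G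
        by (simp add: distrib_right abs_le_iff)
    qed
    ultimately show ?thesis using R wS by linarith
  next
    case False
    then have small: "norm (x i) \<le> \<tau>" if "norm (x j) > \<tau>" "i < n" "j < n" "i \<noteq> j" for i j
      using that by (metis linorder_neqE_nat not_less)
    have g0: "g (x j) = 0" if "norm (x j) \<le> \<tau>" for j using that par \<rho> by (intro g(3)) linarith
    show ?thesis
    proof (cases "\<exists>i<n. norm (x i) > \<tau>")
      case True
      then obtain i where i: "i < n" "norm (x i) > \<tau>" by blast
      have sm: "norm (x j) \<le> \<tau>" if "j \<in> {..<n} - {i}" for j using small [OF i(2), of j] i(1) that by auto
      have gs: "(\<Sum>j<n. g (x j)) = g (x i)"
        using i(1) sm g0 by (subst sum.remove [of _ i]) auto
      have xs: "(\<Sum>j<n. x j) = x i + (\<Sum>j\<in>{..<n} - {i}. x j)"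
        using i(1) by (subst sum.remove [of _ i]) auto
      have ns: "norm (\<Sum>j\<in>{..<n} - {i}. x j) \<le> \<rho>"
      proof -
        have "norm (\<Sum>j\<in>{..<n} - {i}. x j) \<le> of_nat (card ({..<n} - {i})) * \<tau>"
          by (rule order_trans [OF norm_sum sum_bounded_above]) (rule sm)
        also have "\<dots> \<le> real n * \<tau>" using par(1) by (intro mult_right_mono) (auto intro: order_trans [OF card_Diff1_le])
        finally show ?thesis using par(3) by linarith
      qed
      show ?thesis
      proof (cases "norm r > \<rho>")
        case True
        have "?L \<le> G" unfolding gs using g(1,2) [of "(\<Sum>j<n. x j) + r"] g(1,2) [of "x i"] by linarith
        then show ?thesis using True GP wS by simp
      next
        case False
        have near: "norm ((\<Sum>j<n. x j) + r - x i) \<le> 2 * \<rho>"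
          unfolding xs using norm_triangle_ineq [of "\<Sum>j\<in>{..<n} - {i}. x j" r] ns False by simp
        show ?thesis
        proof (cases "norm (x i) > \<delta> / 2")
          case True
          have "(1 :: real) = of_bool (norm (x i) > \<delta> / 2)" using True by simp
          also have "\<dots> \<le> ?S" using i(1) by (intro member_le_sum [where f = "\<lambda>j. of_bool (norm (x j) > \<delta> / 2)"]) auto
          finally have "w * 1 \<le> w * ?S" using w by (intro mult_left_mono) auto
          then show ?thesis unfolding gs using mod [OF near] GP R by linarith
        next
          case False
          then have "norm ((\<Sum>j<n. x j) + r) \<le> \<delta>"
            using near norm_triangle_sub [of "(\<Sum>j<n. x j) + r" "x i"] par by linarith
          moreover have "norm (x i) \<le> \<delta>" using False par \<rho> by linarith
          ultimately show ?thesis unfolding gs using GP R wS by (simp add: g(3))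
        qed
      qed
    next
      case False
      then have sm: "norm (x j) \<le> \<tau>" if "j < n" for j using that by (meson not_less)
      have gs: "(\<Sum>j<n. g (x j)) = 0" using sm g0 by (intro sum.neutral) auto
      show ?thesis
      proof (cases "norm r > \<rho>")
        case True
        have "?L \<le> G" unfolding gs using g(1,2) [of "(\<Sum>j<n. x j) + r"] by linarith
        then show ?thesis using True GP wS by simp
      next
        case False
        have "norm (\<Sum>j<n. x j) \<le> of_nat (card {..<n}) * \<tau>"
          by (rule order_trans [OF norm_sum sum_bounded_above]) (use sm in simp)
        then have "norm ((\<Sum>j<n. x j) + r) \<le> \<delta>"
          using norm_triangle_ineq [of "\<Sum>j<n. x j" r] False par \<rho> by simp
        then show ?thesis unfolding gs using GP R wS by (simp add: g(3))
      qed
    qed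
  qed
qed

section \<open>The series tested against one nonnegative function\<close>

locale test_bump =
  fixes g :: "real ^ 'd \<Rightarrow> real" and G \<delta> :: real
  assumes g_cont: "uniformly_continuous_on UNIV g" and g_nonneg: "0 \<le> g y" and g_le: "g y \<le> G"
    and g_zero: "norm y \<le> \<delta> \<Longrightarrow> g y = 0" and \<delta>_pos: "0 < \<delta>" and \<delta>_le: "\<delta> \<le> 1" and G_pos: "0 < G"
begin

lemma g_continuous: "continuous_on UNIV g"
  by (rule uniformly_continuous_imp_continuous [OF g_cont])

lemma g_measurable [measurable]: "g \<in> borel_measurable borel"
  by (rule borel_measurable_continuous_onI [OF g_continuous])

lemma abs_g: "\<bar>g y\<bar> \<le> G"
  using g_nonneg [of y] g_le [of y] by simp

end

locale series_test = noise D N \<alpha> M F Z + test_bump g G \<delta>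
  for D N :: "(real ^ 'p) measure" and \<alpha> :: real and M :: "'a measure" and F Z
    and g :: "real ^ 'd \<Rightarrow> real" and G \<delta> +
  fixes A :: "nat \<Rightarrow> 'a \<Rightarrow> real ^ 'p ^ 'd" and \<eta> :: real
  assumes A: "predictable A" and \<eta>: "0 < \<eta>" "\<eta> < \<alpha>"
    and fin: "(\<Sum>j. \<integral>\<^sup>+\<omega>. ennreal (wt \<eta> (op_norm (A j \<omega>))) \<partial>M) < \<infinity>"
begin

lemma A_measurable [measurable]: "A j \<in> borel_measurable M"
  using A by (rule predictable_M)

lemma A_measurable_F [measurable]: "A j \<in> borel_measurable (F j)"
  using A by (rule predictable_F) simp

definition S :: "nat \<Rightarrow> real" where
  "S j = (\<integral>\<omega>. wt \<eta> (op_norm (A j \<omega>)) \<partial>M)"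

lemma integrable_wt: "integrable M (\<lambda>\<omega>. wt \<eta> (op_norm (A j \<omega>)))"
proof (rule integrableI_nonneg)
  show "(\<integral>\<^sup>+\<omega>. ennreal (wt \<eta> (op_norm (A j \<omega>))) \<partial>M) < \<infinity>"
    using term_le_suminf_ennreal [of "\<lambda>j. \<integral>\<^sup>+\<omega>. ennreal (wt \<eta> (op_norm (A j \<omega>))) \<partial>M" j] fin
    by (rule order_le_less_trans)
qed simp_all

lemma nn_integral_wt: "(\<integral>\<^sup>+\<omega>. ennreal (wt \<eta> (op_norm (A j \<omega>))) \<partial>M) = ennreal (S j)"
  unfolding S_def by (rule nn_integral_eq_integral [OF integrable_wt]) simp

lemma S_nonneg: "0 \<le> S j"
  unfolding S_def by (rule integral_nonneg_AE) simp

lemma S_summable: "summable S"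
  using fin unfolding nn_integral_wt by (intro summable_suminf_not_top S_nonneg) auto

text \<open>One fixed choice of the constants in Potter's bound, shared by all estimates of the
  locale as \<open>C\<close> and \<open>U\<close>.\<close>

definition potter_constants :: "real \<times> real" where
  "potter_constants = (SOME (C, u0). C > 0 \<and> u0 \<ge> 1 \<and>
    (\<forall>u\<ge>u0. \<forall>a\<ge>0. prob {z. a * norm z > u} \<le> C * T u * wt \<eta> a))"

definition C where "C = fst potter_constants"
definition U where "U = snd potter_constants"

lemma CU: "C > 0" "U \<ge> 1" "u \<ge> U \<Longrightarrow> a \<ge> 0 \<Longrightarrow> prob {z. a * norm z > u} \<le> C * T u * wt \<eta> a"
proof -
  obtain C' u' where "C' > 0" "u' \<ge> 1"
    "\<And>u a. u \<ge> u' \<Longrightarrow> a \<ge> 0 \<Longrightarrow> prob {z. a * norm z > u} \<le> C' * T u * wt \<eta> a"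
    using potter [OF \<eta>] by blast
  then have "(\<lambda>(C, u0). C > 0 \<and> u0 \<ge> 1 \<and>
      (\<forall>u\<ge>u0. \<forall>a\<ge>0. prob {z. a * norm z > u} \<le> C * T u * wt \<eta> a)) (C', u')" by simp
  then have "(\<lambda>(C, u0). C > 0 \<and> u0 \<ge> 1 \<and>
      (\<forall>u\<ge>u0. \<forall>a\<ge>0. prob {z. a * norm z > u} \<le> C * T u * wt \<eta> a)) potter_constants"
    unfolding potter_constants_def by (rule someI)
  then show "C > 0" "U \<ge> 1" "u \<ge> U \<Longrightarrow> a \<ge> 0 \<Longrightarrow> prob {z. a * norm z > u} \<le> C * T u * wt \<eta> a"
    by (simp_all add: C_def U_def split_beta)
qed

lemma prob_scaled:
  assumes "u \<ge> U" "0 < \<tau>" "\<tau> \<le> 1" "0 \<le> a"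
  shows "prob {z. a * norm z > \<tau> * u} \<le> C * T u * ((1 / \<tau>) powr (\<alpha> + \<eta>) * wt \<eta> a)"
proof -
  have "prob {z. a * norm z > \<tau> * u} = prob {z. (1 / \<tau> * a) * norm z > u}"
    using assms by (intro arg_cong [where f = prob]) (simp add: field_simps)
  also have "\<dots> \<le> C * T u * wt \<eta> (1 / \<tau> * a)" using assms by (intro CU(3)) auto
  also have "\<dots> \<le> C * T u * ((1 / \<tau>) powr (\<alpha> + \<eta>) * wt \<eta> a)"
    using assms \<eta> CU(1) tail_pos [of u] by (intro mult_left_mono wt_scale_up) auto
  finally show ?thesis .
qed

lemma jump_prob:
  assumes "u \<ge> U" "0 < \<tau>" "\<tau> \<le> 1"
  shows "M.prob {\<omega> \<in> space M. norm (A j \<omega> *v Z j \<omega>) > \<tau> * u} \<le> C * T u * ((1 / \<tau>) powr (\<alpha> + \<eta>) * S j)"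
proof -
  let ?k = "C * T u * (1 / \<tau>) powr (\<alpha> + \<eta>)"
  have k: "0 \<le> ?k" using CU(1) tail_pos [of u] by simp
  have "emeasure M {\<omega> \<in> space M. norm (A j \<omega> *v Z j \<omega>) > \<tau> * u}
      \<le> emeasure M {\<omega> \<in> space M. op_norm (A j \<omega>) * norm (Z j \<omega>) > \<tau> * u}"
    using norm_mv_le by (intro emeasure_mono) (auto intro: order_less_le_trans)
  also have "\<dots> = (\<integral>\<^sup>+\<omega>. ennreal (prob {z. op_norm (A j \<omega>) * norm z > \<tau> * u}) \<partial>M)" by (rule exceed_eq [OF A])
  also have "\<dots> \<le> (\<integral>\<^sup>+\<omega>. ennreal (?k * wt \<eta> (op_norm (A j \<omega>))) \<partial>M)"
    using prob_scaled [OF assms op_norm_nonneg] by (intro nn_integral_mono ennreal_leI) (simp add: mult.assoc)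
  also have "\<dots> = ennreal (?k * S j)"
    unfolding nn_integral_wt_cmult [OF A k wt_measurable wt_nonneg] nn_integral_wt using k S_nonneg by (simp add: ennreal_mult)
  finally have "M.prob {\<omega> \<in> space M. norm (A j \<omega> *v Z j \<omega>) > \<tau> * u} \<le> ?k * S j"
    unfolding M.emeasure_eq_measure by (rule ennreal_le_iff [THEN iffD1, rotated]) (intro mult_nonneg_nonneg k S_nonneg)
  then show ?thesis by (simp only: mult.assoc)
qed

text \<open>\<open>A j\<close> may depend on \<open>Z i\<close>, so the probability does not factor.
  Integrating out \<open>Z j\<close> leaves T(u) times the mean of the weight of \<open>A j\<close>
  over the event that term i is large; each outcome leaves this event as u grows, and dominated
  convergence makes the mean vanish.\<close>

lemma pair_prob:
  assumes ij: "i < j" and \<tau>: "0 < \<tau>" "\<tau> \<le> 1"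
  shows "((\<lambda>u. M.prob {\<omega> \<in> space M. norm (A i \<omega> *v Z i \<omega>) > \<tau> * u \<and> norm (A j \<omega> *v Z j \<omega>) > \<tau> * u} / T u) \<longlongrightarrow> 0) at_top"
proof -
  let ?k = "C * (1 / \<tau>) powr (\<alpha> + \<eta>)"
  have [measurable]: "A i \<in> borel_measurable (F j)" "Z i \<in> borel_measurable (F j)"
    using ij A by (auto intro: predictable_F Z_measurable_F)
  have k: "0 \<le> ?k" using CU(1) by simp
  let ?s = "\<lambda>u \<omega>. indicator {\<omega>. norm (A i \<omega> *v Z i \<omega>) > \<tau> * u} \<omega> * wt \<eta> (op_norm (A j \<omega>))"
  have sm [measurable]: "?s u \<in> borel_measurable M" for u
  proof -
    have "(\<lambda>\<omega>. (if norm (A i \<omega> *v Z i \<omega>) > \<tau> * u then 1 else 0) * wt \<eta> (op_norm (A j \<omega>))) \<in> borel_measurable M" by measurable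
    then show ?thesis by (simp add: indicator_def of_bool_def)
  qed
  have si: "integrable M (?s u)" for u
    by (rule Bochner_Integration.integrable_bound [OF integrable_wt [of j]]) (auto simp: indicator_def)
  have lim: "((\<lambda>u. \<integral>\<omega>. ?s u \<omega> \<partial>M) \<longlongrightarrow> (\<integral>\<omega>. 0 \<partial>M)) at_top"
  proof (rule integral_dominated_convergence_at_top [OF _ _ integrable_wt [of j]])
    show "AE \<omega> in M. ((\<lambda>u. ?s u \<omega>) \<longlongrightarrow> 0) at_top"
    proof (rule AE_I2)
      fix \<omega>
      have "\<forall>\<^sub>F u in at_top. u \<ge> norm (A i \<omega> *v Z i \<omega>) / \<tau>" by (rule eventually_ge_at_top)
      then have "\<forall>\<^sub>F u in at_top. ?s u \<omega> = 0"
        by eventually_elim (use \<tau> in \<open>simp add: divide_le_eq mult.commute not_less\<close>)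
      then show "((\<lambda>u. ?s u \<omega>) \<longlongrightarrow> 0) at_top" by (rule tendsto_eventually)
    qed
    show "\<forall>\<^sub>F u in at_top. AE \<omega> in M. norm (?s u \<omega>) \<le> wt \<eta> (op_norm (A j \<omega>))"
      by (rule always_eventually) (auto simp: indicator_def)
  qed (use sm in auto)
  have "M.prob {\<omega> \<in> space M. norm (A i \<omega> *v Z i \<omega>) > \<tau> * u \<and> norm (A j \<omega> *v Z j \<omega>) > \<tau> * u} / T u \<le> ?k * (\<integral>\<omega>. ?s u \<omega> \<partial>M)"
    if u: "u \<ge> U" for u
  proof -
    let ?E = "{\<omega> \<in> space M. norm (A i \<omega> *v Z i \<omega>) > \<tau> * u \<and> norm (A j \<omega> *v Z j \<omega>) > \<tau> * u}"
    let ?\<phi> = "\<lambda>(\<omega>, z). if norm (A i \<omega> *v Z i \<omega>) > \<tau> * u \<and> op_norm (A j \<omega>) * norm z > \<tau> * u then 1 else 0 :: ennreal"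
    have "emeasure M ?E = (\<integral>\<^sup>+\<omega>. indicator ?E \<omega> \<partial>M)" by (rule nn_integral_indicator [symmetric]) measurable
    also have "\<dots> \<le> (\<integral>\<^sup>+\<omega>. ?\<phi> (\<omega>, Z j \<omega>) \<partial>M)"
    proof (rule nn_integral_mono)
      fix \<omega>
      have "norm (A j \<omega> *v Z j \<omega>) \<le> op_norm (A j \<omega>) * norm (Z j \<omega>)" by (rule norm_mv_le)
      then show "indicator ?E \<omega> \<le> ?\<phi> (\<omega>, Z j \<omega>)" by (simp add: indicator_def)
    qed
    also have "\<dots> = (\<integral>\<^sup>+\<omega>. \<integral>\<^sup>+z. ?\<phi> (\<omega>, z) \<partial>D \<partial>M)" by (rule freeze) measurable
    also have "\<dots> \<le> (\<integral>\<^sup>+\<omega>. ennreal (T u * (?k * ?s u \<omega>)) \<partial>M)"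
    proof (rule nn_integral_mono)
      fix \<omega>
      show "(\<integral>\<^sup>+z. ?\<phi> (\<omega>, z) \<partial>D) \<le> ennreal (T u * (?k * ?s u \<omega>))"
      proof (cases "norm (A i \<omega> *v Z i \<omega>) > \<tau> * u")
        case True
        have "(\<integral>\<^sup>+z. ?\<phi> (\<omega>, z) \<partial>D) = (\<integral>\<^sup>+z. indicator {z. op_norm (A j \<omega>) * norm z > \<tau> * u} z \<partial>D)"
          using True by (intro nn_integral_cong) (simp add: indicator_def)
        also have "\<dots> = ennreal (prob {z. op_norm (A j \<omega>) * norm z > \<tau> * u})" by (simp add: emeasure_eq_measure)
        also have "\<dots> \<le> ennreal (T u * (?k * ?s u \<omega>))"
          using prob_scaled [OF u \<tau> op_norm_nonneg, of "A j \<omega>"] True by (intro ennreal_leI) (simp add: mult_ac)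
        finally show ?thesis .
      next
        case False
        then show ?thesis by simp
      qed
    qed
    also have "\<dots> = ennreal (\<integral>\<omega>. T u * (?k * ?s u \<omega>) \<partial>M)"
    proof (rule nn_integral_eq_integral)
      show "integrable M (\<lambda>\<omega>. T u * (?k * ?s u \<omega>))" by (intro integrable_mult_right si)
      show "AE \<omega> in M. 0 \<le> T u * (?k * ?s u \<omega>)"
        using tail_pos [of u] CU(1) by (intro AE_I2 mult_nonneg_nonneg) auto
    qed
    also have "(\<integral>\<omega>. T u * (?k * ?s u \<omega>) \<partial>M) = T u * (?k * (\<integral>\<omega>. ?s u \<omega> \<partial>M))"
      by (simp only: integral_mult_right_zero)
    finally have "M.prob ?E \<le> T u * (?k * (\<integral>\<omega>. ?s u \<omega> \<partial>M))"
      unfolding M.emeasure_eq_measure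
      by (rule ennreal_le_iff [THEN iffD1, rotated]) (use tail_pos [of u] CU(1) in \<open>intro mult_nonneg_nonneg integral_nonneg_AE AE_I2; simp\<close>)
    then show ?thesis using tail_pos [of u] by (simp add: divide_le_eq mult.commute)
  qed
  then have up: "\<forall>\<^sub>F u in at_top. M.prob {\<omega> \<in> space M. norm (A i \<omega> *v Z i \<omega>) > \<tau> * u \<and> norm (A j \<omega> *v Z j \<omega>) > \<tau> * u} / T u \<le> ?k * (\<integral>\<omega>. ?s u \<omega> \<partial>M)"
    by (intro eventually_at_top_linorderI [of U])
  have lo: "\<forall>\<^sub>F u in at_top. 0 \<le> M.prob {\<omega> \<in> space M. norm (A i \<omega> *v Z i \<omega>) > \<tau> * u \<and> norm (A j \<omega> *v Z j \<omega>) > \<tau> * u} / T u"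
    using tail_pos by (intro always_eventually allI divide_nonneg_pos) auto
  have "((\<lambda>u. ?k * (\<integral>\<omega>. ?s u \<omega> \<partial>M)) \<longlongrightarrow> 0) at_top"
    using tendsto_mult_left [OF lim, of ?k] by simp
  from tendsto_sandwich [OF lo up tendsto_const this] show ?thesis .
qed

section \<open>The limit of a single term\<close>

definition \<Phi> :: "real ^ 'p ^ 'd \<Rightarrow> real" where
  "\<Phi> B = (\<integral>z. g (B *v z) \<partial>N)"

definition L :: "nat \<Rightarrow> real" where
  "L j = (\<integral>\<omega>. \<Phi> (A j \<omega>) \<partial>M)"

text \<open>The summand 1 in the denominator covers B = 0.\<close>

lemma g_mv_zero: "norm z \<le> \<delta> / (op_norm B + 1) \<Longrightarrow> g (B *v z) = 0"
proof (rule g_zero)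
  assume z: "norm z \<le> \<delta> / (op_norm B + 1)"
  have pos: "0 < op_norm B + 1" using op_norm_nonneg [of B] by linarith
  have "norm (B *v z) \<le> op_norm B * norm z" by (rule norm_mv_le)
  also have "\<dots> \<le> (op_norm B + 1) * norm z" by (intro mult_right_mono) auto
  also have "\<dots> \<le> \<delta>" using z pos by (simp add: le_divide_eq mult.commute)
  finally show "norm (B *v z) \<le> \<delta>" .
qed

lemma d_pos: "0 < \<delta> / (op_norm B + 1)"
  using \<delta>_pos op_norm_nonneg [of B] by (intro divide_pos_pos) linarith+

lemma g_mv_continuous: "continuous_on UNIV (\<lambda>z. g (B *v z))"
  by (rule continuous_on_compose2 [OF g_continuous matrix_vector_mult_linear_continuous_on]) simp

lemma g_mv_integrable_N: "integrable N (\<lambda>z. g (B *v z))"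
proof (rule integrable_vanishing [of N "\<delta> / (op_norm B + 1)" _ G])
  show "emeasure N {z. norm z > \<delta> / (op_norm B + 1)} < \<infinity>" by (simp add: N_far [OF d_pos])
qed (auto simp: g_mv_zero abs_g intro: borel_measurable_continuous_onI g_mv_continuous)

lemma \<Phi>_limit: "((\<lambda>u. (\<integral>z. g (B *v (z /\<^sub>R u)) \<partial>D) / T u) \<longlongrightarrow> \<Phi> B) at_top"
  unfolding \<Phi>_def by (rule law_limit [OF g_mv_continuous d_pos g_mv_zero abs_g])

lemma \<Phi>_measurable [measurable]: "\<Phi> \<in> borel_measurable borel"
proof -
  interpret N: sigma_finite_measure N by (rule sigma_finite_N)
  show ?thesis unfolding \<Phi>_def by measurable
qed

lemma \<phi>_nonneg: "0 \<le> (\<integral>z. g (B *v (z /\<^sub>R u)) \<partial>D)"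
  by (rule integral_nonneg_AE) (simp add: g_nonneg)

lemma g_D_integrable: "integrable D (\<lambda>z. g (B *v (z /\<^sub>R u)))"
  by (rule integrable_const_bound [where B = G]) (auto simp: abs_g)

definition kd :: real where "kd = G * C * (1 / \<delta>) powr (\<alpha> + \<eta>)"

lemma kd_nonneg: "0 \<le> kd"
  using G_pos CU(1) by (simp add: kd_def)

text \<open>The integrable majorant for \<open>breiman\<close>, uniform in u \<ge> U.\<close>

lemma \<phi>_bound:
  assumes u: "u \<ge> U"
  shows "(\<integral>z. g (B *v (z /\<^sub>R u)) \<partial>D) / T u \<le> kd * wt \<eta> (op_norm B)"
proof -
  have u0: "u > 0" using u CU(2) by linarith
  have i: "integrable D (\<lambda>z. G * indicator {z. op_norm B * norm z > \<delta> * u} z :: real)"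
    by (intro integrable_mult_right integrable_real_indicator) (auto simp: emeasure_eq_measure)
  have "(\<integral>z. g (B *v (z /\<^sub>R u)) \<partial>D) \<le> (\<integral>z. G * indicator {z. op_norm B * norm z > \<delta> * u} z \<partial>D)"
  proof (rule integral_mono [OF g_D_integrable i])
    fix z
    show "g (B *v (z /\<^sub>R u)) \<le> G * indicator {z. op_norm B * norm z > \<delta> * u} z"
    proof (cases "op_norm B * norm z > \<delta> * u")
      case False
      have "norm (B *v (z /\<^sub>R u)) \<le> op_norm B * norm (z /\<^sub>R u)" by (rule norm_mv_le)
      also have "\<dots> = op_norm B * norm z / u" using u0 by (simp add: divide_inverse mult_ac)
      also have "\<dots> \<le> \<delta>" using False u0 by (simp add: divide_le_eq)
      finally show ?thesis using False by (simp add: g_zero)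
    qed (simp add: g_le)
  qed
  also have "\<dots> = G * prob {z. op_norm B * norm z > \<delta> * u}" by simp
  also have "\<dots> \<le> G * (C * T u * ((1 / \<delta>) powr (\<alpha> + \<eta>) * wt \<eta> (op_norm B)))"
    using G_pos by (intro mult_left_mono prob_scaled u \<delta>_pos \<delta>_le op_norm_nonneg) simp
  finally show ?thesis using tail_pos [of u] by (simp add: divide_le_eq kd_def mult_ac)
qed

lemma \<Phi>_bounds: "0 \<le> \<Phi> B" "\<Phi> B \<le> kd * wt \<eta> (op_norm B)"
proof -
  show "0 \<le> \<Phi> B" unfolding \<Phi>_def by (rule integral_nonneg_AE) (simp add: g_nonneg)
  show "\<Phi> B \<le> kd * wt \<eta> (op_norm B)"
    by (rule tendsto_upperbound [OF \<Phi>_limit eventually_at_top_linorderI [of U]]) (auto intro: \<phi>_bound)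
qed

lemma \<Phi>_integrable: "integrable M (\<lambda>\<omega>. \<Phi> (A j \<omega>))"
  by (rule Bochner_Integration.integrable_bound [OF integrable_mult_right [OF integrable_wt [of j], of kd]])
    (use \<Phi>_bounds kd_nonneg in auto)

lemma L_bounds: "0 \<le> L j" "L j \<le> kd * S j"
proof -
  show "0 \<le> L j" unfolding L_def by (rule integral_nonneg_AE) (simp add: \<Phi>_bounds)
  have "L j \<le> (\<integral>\<omega>. kd * wt \<eta> (op_norm (A j \<omega>)) \<partial>M)"
    unfolding L_def by (intro integral_mono \<Phi>_integrable integrable_mult_right integrable_wt \<Phi>_bounds)
  then show "L j \<le> kd * S j" by (simp add: S_def)
qed

lemma L_summable: "summable L"
  by (rule summable_comparison_test' [OF summable_mult [OF S_summable, of kd], of 0]) (simp add: L_bounds)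

lemma freeze_g: "(\<integral>\<omega>. g ((A j \<omega> *v Z j \<omega>) /\<^sub>R u) \<partial>M) = (\<integral>\<omega>. (\<integral>z. g (A j \<omega> *v (z /\<^sub>R u)) \<partial>D) \<partial>M)"
proof -
  let ?\<phi> = "\<lambda>(\<omega>, z). ennreal (g (A j \<omega> *v (z /\<^sub>R u)))"
  have "(\<integral>\<^sup>+\<omega>. ennreal (g ((A j \<omega> *v Z j \<omega>) /\<^sub>R u)) \<partial>M) = (\<integral>\<^sup>+\<omega>. ?\<phi> (\<omega>, Z j \<omega>) \<partial>M)"
    by (simp add: matrix_vector_mult_scaleR)
  also have "\<dots> = (\<integral>\<^sup>+\<omega>. \<integral>\<^sup>+z. ?\<phi> (\<omega>, z) \<partial>D \<partial>M)" by (rule freeze) measurable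
  also have "\<dots> = (\<integral>\<^sup>+\<omega>. ennreal (\<integral>z. g (A j \<omega> *v (z /\<^sub>R u)) \<partial>D) \<partial>M)"
    unfolding prod.case by (intro nn_integral_cong nn_integral_eq_integral g_D_integrable) (simp add: g_nonneg)
  finally have "(\<integral>\<^sup>+\<omega>. ennreal (g ((A j \<omega> *v Z j \<omega>) /\<^sub>R u)) \<partial>M) = (\<integral>\<^sup>+\<omega>. ennreal (\<integral>z. g (A j \<omega> *v (z /\<^sub>R u)) \<partial>D) \<partial>M)" .
  then show ?thesis
    by (subst (1 2) integral_eq_nn_integral) (auto simp: g_nonneg \<phi>_nonneg)
qed

text \<open>Breiman's lemma: \<open>freeze_g\<close> reduces the term to the noise with a fixed
  coefficient, whose limit is \<Phi>, and dominated convergence then averages over the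
  coefficient.\<close>

lemma breiman: "((\<lambda>u. (\<integral>\<omega>. g ((A j \<omega> *v Z j \<omega>) /\<^sub>R u) \<partial>M) / T u) \<longlongrightarrow> L j) at_top"
proof -
  have "((\<lambda>u. \<integral>\<omega>. (\<integral>z. g (A j \<omega> *v (z /\<^sub>R u)) \<partial>D) / T u \<partial>M) \<longlongrightarrow> (\<integral>\<omega>. \<Phi> (A j \<omega>) \<partial>M)) at_top"
  proof (rule integral_dominated_convergence_at_top [OF _ _ integrable_mult_right [OF integrable_wt [of j], of kd]])
    show "AE \<omega> in M. ((\<lambda>u. (\<integral>z. g (A j \<omega> *v (z /\<^sub>R u)) \<partial>D) / T u) \<longlongrightarrow> \<Phi> (A j \<omega>)) at_top"
      by (intro AE_I2 \<Phi>_limit)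
    show "\<forall>\<^sub>F u in at_top. AE \<omega> in M. norm ((\<integral>z. g (A j \<omega> *v (z /\<^sub>R u)) \<partial>D) / T u) \<le> kd * wt \<eta> (op_norm (A j \<omega>))"
      using \<phi>_bound \<phi>_nonneg tail_pos
      by (intro eventually_at_top_linorderI [of U] AE_I2) (simp add: abs_of_pos [OF tail_pos])
  qed measurable
  then show ?thesis unfolding L_def freeze_g by simp
qed

end

section \<open>From single terms to the series\<close>

lemma (in prob_space) integral_of_bool:
  assumes "Measurable.pred M P"
  shows "integrable M (\<lambda>\<omega>. of_bool (P \<omega>) :: real)" "(\<integral>\<omega>. of_bool (P \<omega>) \<partial>M) = prob {\<omega> \<in> space M. P \<omega>}"
proof -
  have s: "{\<omega> \<in> space M. P \<omega>} \<in> events" using assms by measurable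
  have eq: "(of_bool (P \<omega>) :: real) = indicator {\<omega> \<in> space M. P \<omega>} \<omega>" if "\<omega> \<in> space M" for \<omega>
    using that by (simp add: indicator_def)
  have "integrable M (indicator {\<omega> \<in> space M. P \<omega>} :: _ \<Rightarrow> real)"
    using s by (intro integrable_real_indicator) (auto simp: emeasure_eq_measure)
  moreover have "integrable M (\<lambda>\<omega>. of_bool (P \<omega>) :: real) = integrable M (\<lambda>\<omega>. indicator {\<omega> \<in> space M. P \<omega>} \<omega> :: real)"
    by (rule Bochner_Integration.integrable_cong [OF refl eq])
  ultimately show "integrable M (\<lambda>\<omega>. of_bool (P \<omega>) :: real)" by simp
  have "(\<integral>\<omega>. of_bool (P \<omega>) \<partial>M) = (\<integral>\<omega>. indicator {\<omega> \<in> space M. P \<omega>} \<omega> \<partial>M :: real)"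
    by (rule Bochner_Integration.integral_cong [OF refl eq])
  then show "(\<integral>\<omega>. of_bool (P \<omega>) \<partial>M) = prob {\<omega> \<in> space M. P \<omega>}"
    by (simp add: Int_absorb2 Collect_restrict)
qed

context series_test
begin

definition X :: "'a \<Rightarrow> real ^ 'd" where
  "X \<omega> = (\<Sum>j. A j \<omega> *v Z j \<omega>)"

lemma X_measurable [measurable]: "X \<in> borel_measurable M"
  unfolding X_def [abs_def] by measurable

text \<open>If the infinite remainder exceeds x, then by strictness so do all sufficiently long
  finite blocks. The events that all blocks of length at least k exceed x increase with k, and each
  lies in the event of a single block.\<close>

lemma remainder_bound:
  assumes sm: "AE \<omega> in M. summable (\<lambda>j. A j \<omega> *v Z j \<omega>)"
    and b: "\<And>m. emeasure M {\<omega> \<in> space M. norm (psum (delay n A) m \<omega>) > x} \<le> b"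
  shows "emeasure M {\<omega> \<in> space M. norm (X \<omega> - psum A n \<omega>) > x} \<le> b"
proof -
  have [measurable]: "psum A m \<in> borel_measurable M" for m by (rule psum_measurable [OF A])
  let ?V = "\<lambda>k. {\<omega> \<in> space M. \<forall>m\<ge>k. norm (psum A (m + n) \<omega> - psum A n \<omega>) > x}"
  have V: "?V k \<in> sets M" for k by measurable
  have "AE \<omega> in M. \<omega> \<in> {\<omega> \<in> space M. norm (X \<omega> - psum A n \<omega>) > x} \<longrightarrow> \<omega> \<in> (\<Union>k. ?V k)"
    using sm
  proof eventually_elim
    case (elim \<omega>)
    show ?case
    proof
      assume w: "\<omega> \<in> {\<omega> \<in> space M. norm (X \<omega> - psum A n \<omega>) > x}"
      have "(\<lambda>m. psum A m \<omega>) \<longlonglongrightarrow> X \<omega>"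
        unfolding psum_def X_def by (rule summable_LIMSEQ [OF elim])
      then have "(\<lambda>m. psum A (m + n) \<omega>) \<longlonglongrightarrow> X \<omega>" by (rule LIMSEQ_ignore_initial_segment)
      then have "(\<lambda>m. norm (psum A (m + n) \<omega> - psum A n \<omega>)) \<longlonglongrightarrow> norm (X \<omega> - psum A n \<omega>)"
        by (intro tendsto_intros)
      then have "\<forall>\<^sub>F m in sequentially. x < norm (psum A (m + n) \<omega> - psum A n \<omega>)"
        by (rule order_tendstoD(1)) (use w in simp)
      then obtain k where "\<forall>m\<ge>k. x < norm (psum A (m + n) \<omega> - psum A n \<omega>)"
        unfolding eventually_sequentially ..
      then have "\<omega> \<in> ?V k" using w by simp
      then show "\<omega> \<in> (\<Union>k. ?V k)" by blast
    qed
  qed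
  then have "emeasure M {\<omega> \<in> space M. norm (X \<omega> - psum A n \<omega>) > x} \<le> emeasure M (\<Union>k. ?V k)"
    by (rule emeasure_mono_AE) (use V in blast)
  also have "\<dots> = (SUP k. emeasure M (?V k))"
  proof (rule SUP_emeasure_incseq [symmetric])
    show "incseq ?V" unfolding incseq_def using le_trans by blast
  qed (use V in blast)
  also have "\<dots> \<le> b"
  proof (rule SUP_least)
    fix k
    have [measurable]: "psum (delay n A) (k + n) \<in> borel_measurable M"
      by (rule psum_measurable [OF predictable_delay [OF A]])
    have "?V k \<subseteq> {\<omega> \<in> space M. norm (psum (delay n A) (k + n) \<omega>) > x}"
      by (simp add: psum_delay Collect_mono)
    then have "emeasure M (?V k) \<le> emeasure M {\<omega> \<in> space M. norm (psum (delay n A) (k + n) \<omega>) > x}"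
      by (rule emeasure_mono) measurable
    then show "emeasure M (?V k) \<le> b" using b [of "k + n"] by (rule order_trans)
  qed
  finally show ?thesis .
qed

lemma expectation_bound:
  assumes mod: "\<And>y y'. norm (y - y') \<le> 2 * \<rho> \<Longrightarrow> \<bar>g y - g y'\<bar> \<le> w"
    and par: "0 < \<tau>" "\<tau> \<le> \<rho>" "real n * \<tau> \<le> \<rho>" "4 * \<rho> \<le> \<delta>" and w: "0 \<le> w" and u: "u > 0"
  shows "\<bar>(\<integral>\<omega>. g (X \<omega> /\<^sub>R u) \<partial>M) - (\<Sum>j<n. \<integral>\<omega>. g ((A j \<omega> *v Z j \<omega>) /\<^sub>R u) \<partial>M)\<bar> \<le>
    (real n + 1) * G * (\<Sum>j<n. \<Sum>i<j. M.prob {\<omega> \<in> space M. norm (A i \<omega> *v Z i \<omega>) > \<tau> * u \<and> norm (A j \<omega> *v Z j \<omega>) > \<tau> * u})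
    + G * M.prob {\<omega> \<in> space M. norm (X \<omega> - psum A n \<omega>) > \<rho> * u}
    + w * (\<Sum>j<n. M.prob {\<omega> \<in> space M. norm (A j \<omega> *v Z j \<omega>) > \<delta> / 2 * u})"
proof -
  have [measurable]: "psum A n \<in> borel_measurable M" by (rule psum_measurable [OF A])
  let ?y = "\<lambda>j \<omega>. A j \<omega> *v Z j \<omega>"
  have ig: "integrable M (\<lambda>\<omega>. g (Y \<omega>))" if [measurable]: "Y \<in> borel_measurable M" for Y
    by (rule M.integrable_const_bound [where B = G]) (auto simp: abs_g)
  let ?P = "\<lambda>i j \<omega>. norm (?y i \<omega>) > \<tau> * u \<and> norm (?y j \<omega>) > \<tau> * u"
  let ?R = "\<lambda>\<omega>. norm (X \<omega> - psum A n \<omega>) > \<rho> * u"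
  let ?Q = "\<lambda>j \<omega>. norm (?y j \<omega>) > \<delta> / 2 * u"
  have P: "Measurable.pred M (?P i j)" and R: "Measurable.pred M ?R" and Q: "Measurable.pred M (?Q j)" for i j
    by measurable
  let ?h = "\<lambda>\<omega>. (real n + 1) * G * (\<Sum>j<n. \<Sum>i<j. of_bool (?P i j \<omega>)) + G * of_bool (?R \<omega>) + w * (\<Sum>j<n. of_bool (?Q j \<omega>))"
  note ob = M.integral_of_bool
  have ih: "integrable M ?h"
    by (intro Bochner_Integration.integrable_add integrable_mult_right Bochner_Integration.integrable_sum ob(1) P R Q)
  have pw: "\<bar>g (X \<omega> /\<^sub>R u) - (\<Sum>j<n. g (?y j \<omega> /\<^sub>R u))\<bar> \<le> ?h \<omega>" for \<omega>
  proof -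
    have x: "(\<Sum>j<n. ?y j \<omega> /\<^sub>R u) + (X \<omega> - psum A n \<omega>) /\<^sub>R u = X \<omega> /\<^sub>R u"
      by (simp add: psum_def scaleR_diff_right scaleR_sum_right)
    show ?thesis
      using single_big_jump [of g G \<delta> \<rho> w \<tau> n "\<lambda>j. ?y j \<omega> /\<^sub>R u" "(X \<omega> - psum A n \<omega>) /\<^sub>R u", OF g_nonneg g_le g_zero mod par w]
      unfolding x scaleR_far [OF u] .
  qed
  have id: "integrable M (\<lambda>\<omega>. g (X \<omega> /\<^sub>R u) - (\<Sum>j<n. g (?y j \<omega> /\<^sub>R u)))"
    by (intro Bochner_Integration.integrable_diff Bochner_Integration.integrable_sum ig) measurable
  have "(\<integral>\<omega>. g (X \<omega> /\<^sub>R u) \<partial>M) - (\<Sum>j<n. \<integral>\<omega>. g (?y j \<omega> /\<^sub>R u) \<partial>M)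
      = (\<integral>\<omega>. g (X \<omega> /\<^sub>R u) - (\<Sum>j<n. g (?y j \<omega> /\<^sub>R u)) \<partial>M)"
  proof -
    have "(\<integral>\<omega>. g (X \<omega> /\<^sub>R u) - (\<Sum>j<n. g (?y j \<omega> /\<^sub>R u)) \<partial>M)
        = (\<integral>\<omega>. g (X \<omega> /\<^sub>R u) \<partial>M) - (\<integral>\<omega>. (\<Sum>j<n. g (?y j \<omega> /\<^sub>R u)) \<partial>M)"
      by (rule Bochner_Integration.integral_diff) (intro Bochner_Integration.integrable_sum ig; measurable)+
    also have "(\<integral>\<omega>. (\<Sum>j<n. g (?y j \<omega> /\<^sub>R u)) \<partial>M) = (\<Sum>j<n. \<integral>\<omega>. g (?y j \<omega> /\<^sub>R u) \<partial>M)"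
      by (rule Bochner_Integration.integral_sum) (intro ig; measurable)
    finally show ?thesis by simp
  qed
  also have "\<bar>\<dots>\<bar> \<le> (\<integral>\<omega>. \<bar>g (X \<omega> /\<^sub>R u) - (\<Sum>j<n. g (?y j \<omega> /\<^sub>R u))\<bar> \<partial>M)" by (rule integral_abs_bound)
  also have "\<dots> \<le> (\<integral>\<omega>. ?h \<omega> \<partial>M)" by (intro integral_mono integrable_abs id ih pw)
  also have "\<dots> = (real n + 1) * G * (\<Sum>j<n. \<Sum>i<j. M.prob {\<omega> \<in> space M. ?P i j \<omega>})
      + G * M.prob {\<omega> \<in> space M. ?R \<omega>} + w * (\<Sum>j<n. M.prob {\<omega> \<in> space M. ?Q j \<omega>})"
    by (simp only: Bochner_Integration.integral_add Bochner_Integration.integral_sum integral_mult_right_zero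
        Bochner_Integration.integrable_add integrable_mult_right Bochner_Integration.integrable_sum ob [OF P] ob [OF R] ob [OF Q])
  finally show ?thesis .
qed

text \<open>Five errors of size e / 5: pairs of large terms, the remainder, the modulus of g, the
  limits of n single terms and the tail of the series of limits. The order of choice matters: w and
  \<rho> precede n, which works because \<open>K0\<close> bounds the sum of the single jump
  probabilities relative to T(u) for all n at once; \<tau> follows n.\<close>

lemma series_limit:
  assumes sm: "AE \<omega> in M. summable (\<lambda>j. A j \<omega> *v Z j \<omega>)" and neg: "negligible_tails A"
  shows "((\<lambda>u. (\<integral>\<omega>. g (X \<omega> /\<^sub>R u) \<partial>M) / T u) \<longlongrightarrow> (\<Sum>j. L j)) at_top"
proof (rule tendstoI)
  fix e :: real assume e: "e > 0"
  define K0 where "K0 = C * (1 / (\<delta> / 2)) powr (\<alpha> + \<eta>) * (\<Sum>j. S j)"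
  have K0: "0 \<le> K0" using CU(1) S_nonneg S_summable by (simp add: K0_def suminf_nonneg)
  define w where "w = e / (5 * (K0 + 1))"
  have w: "0 < w" "w * K0 < e / 5" using e K0 by (simp_all add: w_def field_simps)
  obtain \<rho>0 where \<rho>0: "\<rho>0 > 0" "\<And>y y'. dist y' y < \<rho>0 \<Longrightarrow> dist (g y') (g y) < w"
    using g_cont w(1) unfolding uniformly_continuous_on_def by (metis UNIV_I)
  define \<rho> where "\<rho> = min (\<rho>0 / 3) (\<delta> / 4)"
  have \<rho>: "0 < \<rho>" "2 * \<rho> < \<rho>0" "4 * \<rho> \<le> \<delta>" "\<rho> \<le> 1"
    using \<rho>0(1) \<delta>_pos \<delta>_le by (auto simp: \<rho>_def min_def)
  have mod: "\<bar>g y - g y'\<bar> \<le> w" if "norm (y - y') \<le> 2 * \<rho>" for y y'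
    using \<rho>0(2) [of y y'] that \<rho>(2) by (simp add: dist_norm dist_real_def)
  \<comment> \<open>Since \<open>T (\<rho> * u)\<close> is eventually below
    \<open>2 * \<rho> powr - \<alpha> * T u\<close>, the remainder costs at most e / 5 after
    multiplication by G.\<close>
  define e' where "e' = e / (10 * G * \<rho> powr - \<alpha>)"
  have \<rho>p: "0 < \<rho> powr - \<alpha>" using \<rho> by simp
  have e': "0 < e'" using e G_pos \<rho>p by (simp add: e'_def)
  have "\<forall>\<^sub>F n in sequentially. \<bar>(\<Sum>j<n. L j) - (\<Sum>j. L j)\<bar> < e / 5"
    using tendstoD [OF summable_LIMSEQ [OF L_summable], of "e / 5"] e by (simp add: dist_real_def)
  moreover have "\<forall>\<^sub>F n in sequentially. \<forall>\<^sub>F u in at_top. \<forall>m.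
      emeasure M {\<omega> \<in> space M. norm (psum (delay n A) m \<omega>) > u} \<le> ennreal (e' * T u)"
    using neg e' by (simp add: negligible_tails_def)
  ultimately have "\<forall>\<^sub>F n in sequentially. \<bar>(\<Sum>j<n. L j) - (\<Sum>j. L j)\<bar> < e / 5 \<and> (\<forall>\<^sub>F u in at_top. \<forall>m.
      emeasure M {\<omega> \<in> space M. norm (psum (delay n A) m \<omega>) > u} \<le> ennreal (e' * T u))"
    by (rule eventually_conj)
  then obtain n where n: "\<bar>(\<Sum>j<n. L j) - (\<Sum>j. L j)\<bar> < e / 5"
    "\<forall>\<^sub>F u in at_top. \<forall>m. emeasure M {\<omega> \<in> space M. norm (psum (delay n A) m \<omega>) > u} \<le> ennreal (e' * T u)"
    using eventually_happens by fastforce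
  define \<tau> where "\<tau> = \<rho> / (real n + 1)"
  have \<tau>: "0 < \<tau>" "\<tau> \<le> \<rho>" "real n * \<tau> \<le> \<rho>" "\<tau> \<le> 1"
  proof -
    show "0 < \<tau>" using \<rho> by (simp add: \<tau>_def)
    show t: "\<tau> \<le> \<rho>" using \<rho> by (simp add: \<tau>_def divide_le_eq)
    show "real n * \<tau> \<le> \<rho>" using \<rho> by (simp add: \<tau>_def divide_le_eq mult.commute)
    show "\<tau> \<le> 1" using t \<rho> by linarith
  qed
  let ?pp = "\<lambda>u. \<Sum>j<n. \<Sum>i<j. M.prob {\<omega> \<in> space M. norm (A i \<omega> *v Z i \<omega>) > \<tau> * u \<and> norm (A j \<omega> *v Z j \<omega>) > \<tau> * u}"
  have "((\<lambda>u. (real n + 1) * G * (\<Sum>j<n. \<Sum>i<j. M.prob {\<omega> \<in> space M. norm (A i \<omega> *v Z i \<omega>) > \<tau> * u \<and> norm (A j \<omega> *v Z j \<omega>) > \<tau> * u} / T u))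
      \<longlongrightarrow> (real n + 1) * G * (\<Sum>j<n. \<Sum>i<j. 0)) at_top"
    by (intro tendsto_mult tendsto_const tendsto_sum pair_prob \<tau>) simp
  then have "((\<lambda>u. (real n + 1) * G * (?pp u / T u)) \<longlongrightarrow> 0) at_top"
    by (simp add: sum_divide_distrib)
  then have ev1: "\<forall>\<^sub>F u in at_top. (real n + 1) * G * (?pp u / T u) < e / 5"
    by (rule order_tendstoD(2)) (use e in simp)
  have "((\<lambda>u. \<Sum>j<n. (\<integral>\<omega>. g ((A j \<omega> *v Z j \<omega>) /\<^sub>R u) \<partial>M) / T u) \<longlongrightarrow> (\<Sum>j<n. L j)) at_top"
    by (intro tendsto_sum breiman)
  from tendstoD [OF this, of "e / 5"] have ev2: "\<forall>\<^sub>F u in at_top. \<bar>(\<Sum>j<n. (\<integral>\<omega>. g ((A j \<omega> *v Z j \<omega>) /\<^sub>R u) \<partial>M) / T u) - (\<Sum>j<n. L j)\<bar> < e / 5"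
    using e by (simp add: dist_real_def)
  have "filterlim (\<lambda>u. \<rho> * u) at_top at_top"
    using \<rho>(1) by (intro filterlim_tendsto_pos_mult_at_top [OF tendsto_const] filterlim_ident)
  then have ev3: "\<forall>\<^sub>F u in at_top. \<forall>m. emeasure M {\<omega> \<in> space M. norm (psum (delay n A) m \<omega>) > \<rho> * u} \<le> ennreal (e' * T (\<rho> * u))"
    using n(2) unfolding filterlim_iff by blast
  have ev4: "\<forall>\<^sub>F u in at_top. T (\<rho> * u) / T u < 2 * \<rho> powr - \<alpha>"
    using \<rho>p by (intro order_tendstoD(2) [OF tail_ratio [OF \<rho>(1)]]) simp
  show "\<forall>\<^sub>F u in at_top. dist ((\<integral>\<omega>. g (X \<omega> /\<^sub>R u) \<partial>M) / T u) (\<Sum>j. L j) < e"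
    using ev1 ev2 ev3 ev4 eventually_ge_at_top [of U]
  proof eventually_elim
    case (elim u)
    have u: "u > 0" using elim(5) CU(2) by linarith
    have Tu: "0 < T u" by (rule tail_pos)
    let ?E = "\<integral>\<omega>. g (X \<omega> /\<^sub>R u) \<partial>M" and ?Ej = "\<lambda>j. \<integral>\<omega>. g ((A j \<omega> *v Z j \<omega>) /\<^sub>R u) \<partial>M"
    let ?r = "M.prob {\<omega> \<in> space M. norm (X \<omega> - psum A n \<omega>) > \<rho> * u}"
    let ?q = "\<Sum>j<n. M.prob {\<omega> \<in> space M. norm (A j \<omega> *v Z j \<omega>) > \<delta> / 2 * u}"
    have main: "\<bar>?E - (\<Sum>j<n. ?Ej j)\<bar> \<le> (real n + 1) * G * ?pp u + G * ?r + w * ?q"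
      using w(1) by (intro expectation_bound mod \<tau> \<rho> u) auto
    have "emeasure M {\<omega> \<in> space M. norm (X \<omega> - psum A n \<omega>) > \<rho> * u} \<le> ennreal (e' * T (\<rho> * u))"
      using elim(3) by (intro remainder_bound [OF sm]) blast
    then have r: "?r \<le> e' * T (\<rho> * u)"
      unfolding M.emeasure_eq_measure
      by (rule ennreal_le_iff [THEN iffD1, rotated]) (intro mult_nonneg_nonneg less_imp_le [OF e'] less_imp_le [OF tail_pos])
    have "T (\<rho> * u) \<le> 2 * \<rho> powr - \<alpha> * T u" using elim(4) Tu by (simp add: divide_less_eq)
    then have "e' * T (\<rho> * u) \<le> e' * (2 * \<rho> powr - \<alpha> * T u)" using e' by (intro mult_left_mono) auto
    with r have "G * ?r \<le> G * (e' * (2 * \<rho> powr - \<alpha> * T u))" using G_pos by (intro mult_left_mono) auto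
    also have "\<dots> = e / 5 * T u" using G_pos \<rho>p by (simp add: e'_def field_simps)
    finally have r: "G * ?r \<le> e / 5 * T u" .
    have "?q \<le> (\<Sum>j<n. C * T u * ((1 / (\<delta> / 2)) powr (\<alpha> + \<eta>) * S j))"
      using \<delta>_pos \<delta>_le by (intro sum_mono jump_prob elim) auto
    also have "\<dots> = C * T u * (1 / (\<delta> / 2)) powr (\<alpha> + \<eta>) * (\<Sum>j<n. S j)"
      unfolding sum_distrib_left by (intro sum.cong) (simp_all only: mult_ac)
    also have "\<dots> \<le> C * T u * (1 / (\<delta> / 2)) powr (\<alpha> + \<eta>) * (\<Sum>j. S j)"
      using CU(1) Tu S_nonneg by (intro mult_left_mono sum_le_suminf S_summable) auto
    also have "\<dots> = K0 * T u" by (simp add: K0_def mult_ac)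
    finally have "w * ?q \<le> w * (K0 * T u)" using w(1) by (intro mult_left_mono) auto
    also have "\<dots> = (w * K0) * T u" by simp
    also have "\<dots> \<le> e / 5 * T u" using w(2) Tu by (intro mult_right_mono) auto
    finally have q: "w * ?q \<le> e / 5 * T u" .
    have p: "(real n + 1) * G * ?pp u < e / 5 * T u" using elim(1) Tu by (simp add: divide_less_eq)
    have "\<bar>?E - (\<Sum>j<n. ?Ej j)\<bar> < 3 * (e / 5) * T u" using main p q r by linarith
    then have "\<bar>?E - (\<Sum>j<n. ?Ej j)\<bar> / T u < 3 * (e / 5)" using Tu by (simp only: divide_less_eq if_True)
    moreover have "\<bar>?E - (\<Sum>j<n. ?Ej j)\<bar> / T u = \<bar>?E / T u - (\<Sum>j<n. ?Ej j / T u)\<bar>"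
      using Tu by (simp add: sum_divide_distrib [symmetric] diff_divide_distrib [symmetric] abs_of_pos [OF Tu])
    ultimately show ?case using elim(2) n(1) unfolding dist_real_def by linarith
  qed
qed

end

section \<open>Integrals with respect to the limit measure\<close>

text \<open>\<open>R j\<close> is the image of \<open>M \<Otimes>\<^sub>M N\<close> under (\<omega>,
  z) -> A_j(\<omega>) z with the mass at the origin dropped. The limit measure is the sum of the
  \<open>R j\<close>, so integrals against it are computed term by term with Fubini's
  theorem.\<close>

context
  fixes M :: "'a measure" and \<mu> :: "(ereal ^ 'p) measure" and A :: "nat \<Rightarrow> 'a \<Rightarrow> real ^ 'p ^ 'd"
    and N :: "(real ^ 'p) measure" and \<nu> :: "(ereal ^ 'd) measure" and R :: "nat \<Rightarrow> (ereal ^ 'd) measure"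
  assumes rad: "radon_on punctured \<mu>" and null: "emeasure \<mu> (punctured - range ext_vec) = 0"
    and A: "\<And>j. A j \<in> borel_measurable M"
  defines "N \<equiv> distr \<mu> borel fin_part" and "\<nu> \<equiv> limit_measure M \<mu> A"
    and "R \<equiv> \<lambda>j. restrict_space (distr (M \<Otimes>\<^sub>M N) borel (\<lambda>p. ext_vec (A j (fst p) *v snd p))) punctured"
begin

lemma lm_sets: "sets \<nu> = sets (restrict_space borel punctured)" "sets (R j) = sets \<nu>"
proof -
  show 1: "sets \<nu> = sets (restrict_space borel punctured)"
    unfolding \<nu>_def by (rule limit_measure_eval(1) [OF rad null A])
  show "sets (R j) = sets \<nu>" unfolding 1 R_def by (rule sets_restrict_space_cong) simp
qed

lemma lm_space: "space \<nu> = punctured" "space (R j) = punctured"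
  using sets_eq_imp_space_eq [OF lm_sets(1)] sets_eq_imp_space_eq [OF lm_sets(2)]
  by (simp_all add: space_restrict_space)

lemma lm_sets_iff: "B \<in> sets \<nu> \<longleftrightarrow> B \<in> sets borel \<and> B \<subseteq> punctured"
  unfolding lm_sets(1) by (subst sets_restrict_space_iff) auto

lemma sigma_finite_N': "sigma_finite_measure N"
  unfolding N_def by (rule radon_distr_fin_part(1) [OF rad null])

lemma map_measurable: "(\<lambda>p. ext_vec (A j (fst p) *v snd p)) \<in> borel_measurable (M \<Otimes>\<^sub>M N)"
proof -
  have [measurable_cong]: "sets N = sets borel" by (simp add: N_def)
  note A [measurable]
  show ?thesis by measurable
qed

lemma emeasure_lm:
  assumes B: "B \<in> sets \<nu>"
  shows "emeasure \<nu> B = (\<Sum>j. emeasure (R j) B)"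
proof -
  interpret N: sigma_finite_measure N by (rule sigma_finite_N')
  have B': "B \<in> sets borel" "B \<subseteq> punctured" "0 \<notin> B" using B by (auto simp: lm_sets_iff punctured_def)
  let ?q = "\<lambda>j. (\<lambda>p. ext_vec (A j (fst p) *v snd p)) -` B \<inter> space (M \<Otimes>\<^sub>M N)"
  have q: "?q j \<in> sets (M \<Otimes>\<^sub>M N)" for j by (rule measurable_sets [OF map_measurable B'(1)])
  have sl: "emeasure N (Pair \<omega> -` ?q j) = preimage_mass \<mu> (A j \<omega>) B" if "\<omega> \<in> space M" for \<omega> j
  proof -
    have "Pair \<omega> -` ?q j = {z. ext_vec (A j \<omega> *v z) \<in> B}"
      using that by (auto simp: space_pair_measure N_def)
    then show ?thesis
      using radon_distr_fin_part(2) [OF rad null B'(3,1), of "A j \<omega>"] by (simp add: N_def)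
  qed
  have R: "emeasure (R j) B = (\<integral>\<^sup>+\<omega>. preimage_mass \<mu> (A j \<omega>) B \<partial>M)" for j
  proof -
    have "emeasure (R j) B = emeasure (distr (M \<Otimes>\<^sub>M N) borel (\<lambda>p. ext_vec (A j (fst p) *v snd p))) B"
      unfolding R_def using B' by (intro emeasure_restrict_space) auto
    also have "\<dots> = emeasure (M \<Otimes>\<^sub>M N) (?q j)" by (rule emeasure_distr [OF map_measurable B'(1)])
    also have "\<dots> = (\<integral>\<^sup>+\<omega>. emeasure N (Pair \<omega> -` ?q j) \<partial>M)" by (rule N.emeasure_pair_measure_alt [OF q])
    also have "\<dots> = (\<integral>\<^sup>+\<omega>. preimage_mass \<mu> (A j \<omega>) B \<partial>M)" by (rule nn_integral_cong) (rule sl)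
    finally show ?thesis .
  qed
  have "(\<lambda>\<omega>. preimage_mass \<mu> (A j \<omega>) B) \<in> borel_measurable M" for j
    using N.measurable_emeasure_Pair [OF q, of j] sl by (simp cong: measurable_cong)
  then have "(\<integral>\<^sup>+\<omega>. (\<Sum>j. preimage_mass \<mu> (A j \<omega>) B) \<partial>M) = (\<Sum>j. \<integral>\<^sup>+\<omega>. preimage_mass \<mu> (A j \<omega>) B \<partial>M)"
    by (rule nn_integral_suminf)
  then show ?thesis
    unfolding R \<nu>_def using limit_measure_eval(2) [OF rad null A B'(1,2)] by simp
qed

lemma nn_integral_lm:
  assumes "h \<in> borel_measurable \<nu>"
  shows "(\<integral>\<^sup>+x. h x \<partial>\<nu>) = (\<Sum>j. \<integral>\<^sup>+x. h x \<partial>R j)"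
  using assms
proof (induction h rule: borel_measurable_induct)
  case (cong f g)
  have "(\<integral>\<^sup>+x. g x \<partial>\<nu>) = (\<integral>\<^sup>+x. f x \<partial>\<nu>)" using cong(3) by (intro nn_integral_cong) simp
  moreover have "(\<integral>\<^sup>+x. g x \<partial>R j) = (\<integral>\<^sup>+x. f x \<partial>R j)" for j
    using cong(3) by (intro nn_integral_cong) (simp add: lm_space)
  ultimately show ?case using cong(4) by simp
next
  case (set B)
  then show ?case by (simp add: emeasure_lm lm_sets(2))
next
  case (mult f c)
  have "f \<in> borel_measurable (R j)" for j using mult(2) by (simp add: measurable_cong_sets [OF lm_sets(2) refl])
  then show ?case using mult by (simp add: nn_integral_cmult)
next
  case (add f g)
  have "f \<in> borel_measurable (R j)" "g \<in> borel_measurable (R j)" for j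
    using add(1,3) by (simp_all add: measurable_cong_sets [OF lm_sets(2) refl])
  then show ?case using add by (simp add: nn_integral_add suminf_add [OF summableI summableI, symmetric])
next
  case (seq U)
  have m: "U i \<in> borel_measurable (R j)" for i j
    using seq(1) by (simp add: measurable_cong_sets [OF lm_sets(2) refl])
  have "(\<integral>\<^sup>+x. (SUP i. U i x) \<partial>\<nu>) = (SUP i. \<integral>\<^sup>+x. U i x \<partial>\<nu>)"
    by (rule nn_integral_monotone_convergence_SUP [OF seq(3,1)])
  also have "\<dots> = (SUP i. \<Sum>j. \<integral>\<^sup>+x. U i x \<partial>R j)" by (simp only: seq.IH)
  also have "\<dots> = (\<Sum>j. SUP i. \<integral>\<^sup>+x. U i x \<partial>R j)"
    using seq(3) by (intro ennreal_suminf_SUP_eq [symmetric] incseq_nn_integral)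
  also have "\<dots> = (\<Sum>j. \<integral>\<^sup>+x. (SUP i. U i x) \<partial>R j)"
    by (simp add: nn_integral_monotone_convergence_SUP [OF seq(3) m])
  finally show ?case by (simp add: image_comp)
qed

lemma nn_integral_lm_test:
  assumes f: "f \<in> test_functions punctured" and nn: "\<And>x. 0 \<le> f x"
  shows "f \<in> borel_measurable \<nu>"
    "(\<integral>\<^sup>+x. ennreal (f x) \<partial>\<nu>) = (\<Sum>j. \<integral>\<^sup>+\<omega>. \<integral>\<^sup>+z. ennreal (pull f (A j \<omega> *v z)) \<partial>N \<partial>M)"
proof -
  interpret N: sigma_finite_measure N by (rule sigma_finite_N')
  let ?f = "\<lambda>x. if x = 0 then 0 else f x"
  have f0 [measurable]: "?f \<in> borel_measurable borel"
    by (intro borel_measurable_continuous_onI test_function_extend f)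
  show fm: "f \<in> borel_measurable \<nu>"
  proof -
    have "?f \<in> borel_measurable \<nu>"
      by (subst measurable_cong_sets [OF lm_sets(1) refl]) (intro measurable_restrict_space1 f0)
    then show ?thesis by (rule measurable_cong [THEN iffD1, rotated]) (auto simp: lm_space punctured_def)
  qed
  have "(\<integral>\<^sup>+x. ennreal (f x) \<partial>R j) = (\<integral>\<^sup>+\<omega>. \<integral>\<^sup>+z. ennreal (pull f (A j \<omega> *v z)) \<partial>N \<partial>M)" for j
  proof -
    let ?D = "distr (M \<Otimes>\<^sub>M N) borel (\<lambda>p. ext_vec (A j (fst p) *v snd p))"
    have "(\<integral>\<^sup>+x. ennreal (f x) \<partial>R j) = (\<integral>\<^sup>+x. ennreal (f x) * indicator punctured x \<partial>?D)"
      unfolding R_def by (rule nn_integral_restrict_space) simp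
    also have "\<dots> = (\<integral>\<^sup>+x. ennreal (?f x) \<partial>?D)"
      by (intro nn_integral_cong) (simp add: indicator_def punctured_def)
    also have "\<dots> = (\<integral>\<^sup>+p. ennreal (?f (ext_vec (A j (fst p) *v snd p))) \<partial>(M \<Otimes>\<^sub>M N))"
      by (rule nn_integral_distr [OF map_measurable]) measurable
    also have "\<dots> = (\<integral>\<^sup>+p. ennreal (pull f (A j (fst p) *v snd p)) \<partial>(M \<Otimes>\<^sub>M N))"
      by (simp only: pull_eq)
    also have "\<dots> = (\<integral>\<^sup>+\<omega>. \<integral>\<^sup>+z. ennreal (pull f (A j \<omega> *v z)) \<partial>N \<partial>M)"
    proof -
      have "(\<lambda>p. ?f (ext_vec (A j (fst p) *v snd p))) \<in> borel_measurable (M \<Otimes>\<^sub>M N)"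
        by (rule measurable_compose [OF map_measurable f0])
      then have "(\<lambda>p. ennreal (pull f (A j (fst p) *v snd p))) \<in> borel_measurable (M \<Otimes>\<^sub>M N)"
        unfolding pull_eq by (rule measurable_compose) simp
      from N.nn_integral_fst [OF this] show ?thesis by simp
    qed
    finally show ?thesis .
  qed
  then show "(\<integral>\<^sup>+x. ennreal (f x) \<partial>\<nu>) = (\<Sum>j. \<integral>\<^sup>+\<omega>. \<integral>\<^sup>+z. ennreal (pull f (A j \<omega> *v z)) \<partial>N \<partial>M)"
    using nn_integral_lm [of "\<lambda>x. ennreal (f x)"] fm by simp
qed

text \<open>A compact subset of the punctured space lies where some coordinate exceeds a \<delta> >
  0, so its mass is bounded by the masses of the vectors whose images are longer than
  \<delta>.\<close>

lemma radon_lm: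
  assumes fin: "\<And>\<delta>. \<delta> > 0 \<Longrightarrow> (\<Sum>j. \<integral>\<^sup>+\<omega>. emeasure N {z. norm (A j \<omega> *v z) > \<delta>} \<partial>M) < \<infinity>"
  shows "radon_on punctured \<nu>"
  unfolding radon_on_def
proof (intro conjI allI impI lm_sets(1))
  interpret N: sigma_finite_measure N by (rule sigma_finite_N')
  fix K :: "(ereal ^ 'd) set" assume K: "compact K \<and> K \<subseteq> punctured"
  obtain \<delta> where d: "\<delta> > 0" "K \<subseteq> {x. \<exists>i. ereal \<delta> < \<bar>x $ i\<bar>}"
    using compact_punctured_far [of K] K by blast
  let ?U = "{x :: ereal ^ 'd. \<exists>i. ereal \<delta> < \<bar>x $ i\<bar>}"
  have U: "?U \<in> sets \<nu>"
    unfolding lm_sets_iff using d(1) borel_open [OF open_far] by (auto simp: punctured_def)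
  then have U': "?U \<in> sets borel" "0 \<notin> ?U" using d(1) by (auto simp: lm_sets_iff)
  have UP: "?U \<subseteq> punctured" using U by (simp add: lm_sets_iff)
  have "emeasure \<nu> K \<le> emeasure \<nu> ?U" by (rule emeasure_mono [OF d(2) U])
  also have "\<dots> = (\<integral>\<^sup>+\<omega>. (\<Sum>j. preimage_mass \<mu> (A j \<omega>) ?U) \<partial>M)"
    unfolding \<nu>_def by (rule limit_measure_eval(2) [OF rad null A U'(1) UP])
  also have "\<dots> \<le> (\<integral>\<^sup>+\<omega>. (\<Sum>j. emeasure N {z. norm (A j \<omega> *v z) > \<delta>}) \<partial>M)"
  proof (intro nn_integral_mono suminf_le summableI)
    fix \<omega> j
    have "preimage_mass \<mu> (A j \<omega>) ?U = emeasure N {z. ext_vec (A j \<omega> *v z) \<in> ?U}"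
      unfolding N_def by (rule radon_distr_fin_part(2) [OF rad null U'(2,1), symmetric])
    also have "\<dots> \<le> emeasure N {z. norm (A j \<omega> *v z) > \<delta>}"
    proof (rule emeasure_mono)
      show "{z. ext_vec (A j \<omega> *v z) \<in> ?U} \<subseteq> {z. norm (A j \<omega> *v z) > \<delta>}"
        using far_ext_vec by blast
      have "open {z. norm (A j \<omega> *v z) > \<delta>}"
        by (intro open_Collect_less continuous_intros matrix_vector_mult_linear_continuous_on)
      then show "{z. norm (A j \<omega> *v z) > \<delta>} \<in> sets N" by (simp add: N_def)
    qed
    finally show "preimage_mass \<mu> (A j \<omega>) ?U \<le> emeasure N {z. norm (A j \<omega> *v z) > \<delta>}" .
  qed
  also have "\<dots> = (\<Sum>j. \<integral>\<^sup>+\<omega>. emeasure N {z. norm (A j \<omega> *v z) > \<delta>} \<partial>M)"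
  proof (rule nn_integral_suminf)
    fix j
    have [measurable_cong]: "sets N = sets borel" by (simp add: N_def)
    note A [measurable]
    have q: "{p \<in> space (M \<Otimes>\<^sub>M N). norm (A j (fst p) *v snd p) > \<delta>} \<in> sets (M \<Otimes>\<^sub>M N)" by measurable
    have "emeasure N (Pair \<omega> -` {p \<in> space (M \<Otimes>\<^sub>M N). norm (A j (fst p) *v snd p) > \<delta>})
        = emeasure N {z. norm (A j \<omega> *v z) > \<delta>}" if "\<omega> \<in> space M" for \<omega>
      using that by (intro arg_cong [where f = "emeasure N"]) (auto simp: space_pair_measure N_def)
    then show "(\<lambda>\<omega>. emeasure N {z. norm (A j \<omega> *v z) > \<delta>}) \<in> borel_measurable M"
      using N.measurable_emeasure_Pair [OF q] by (simp cong: measurable_cong)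
  qed
  also have "\<dots> < \<infinity>" by (rule fin [OF d(1)])
  finally show "emeasure \<nu> K < \<infinity>" .
qed

end

section \<open>The moment conditions and the theorem\<close>

lemma powr_between:
  fixes a :: real
  assumes "0 \<le> a" "p \<le> s" "s \<le> q"
  shows "a powr s \<le> a powr p + a powr q"
proof (cases "a \<le> 1")
  case True
  then have "a powr s \<le> a powr p" using assms by (intro powr_mono') auto
  then show ?thesis by (simp add: add_increasing2)
next
  case False
  then have "a powr s \<le> a powr q" using assms by (intro powr_mono) auto
  then show ?thesis by (simp add: add_increasing)
qed

lemma le_one_plus_ennreal_powr:
  assumes "1 \<le> r"
  shows "W \<le> 1 + ennreal_powr W r"
proof (cases "W = \<infinity>")
  case False
  define w where "w = enn2real W"
  have w: "W = ennreal w" "0 \<le> w" using False by (simp_all add: w_def less_top [symmetric])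
  have "w powr 1 \<le> w powr 0 + w powr r" using w(2) assms by (intro powr_between) auto
  also have "\<dots> \<le> 1 + w powr r" by simp
  finally have "ennreal w \<le> ennreal (1 + w powr r)" using w(2) by (intro ennreal_leI) simp
  also have "\<dots> = 1 + ennreal_powr W r" using False by (simp add: ennreal_powr_def w_def)
  finally show ?thesis using w by simp
qed (simp add: ennreal_powr_def)

text \<open>Each entry is at most the total w, so its power of order r is at most w^(r - 1) times
  the entry, and summing the entries gives w^r.\<close>

lemma suminf_powr_le_ennreal_powr:
  assumes b: "\<And>j. 0 \<le> b j" and r: "1 \<le> r"
  shows "(\<Sum>j. ennreal (b j powr r)) \<le> ennreal_powr (\<Sum>j. ennreal (b j)) r"
proof (cases "(\<Sum>j. ennreal (b j)) = \<infinity>")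
  case False
  let ?W = "\<Sum>j. ennreal (b j)"
  define w where "w = enn2real ?W"
  have w: "?W = ennreal w" "0 \<le> w" using False by (simp_all add: w_def less_top [symmetric])
  have bw: "b j \<le> w" for j
    using term_le_suminf_ennreal [of "\<lambda>j. ennreal (b j)" j] w by simp
  have "(\<Sum>j. ennreal (b j powr r)) \<le> (\<Sum>j. ennreal (w powr (r - 1)) * ennreal (b j))"
  proof (intro suminf_le summableI)
    fix j
    have "b j powr r = b j powr (r - 1) * b j"
      using b [of j] by (cases "b j = 0") (simp_all add: powr_diff)
    also have "\<dots> \<le> w powr (r - 1) * b j"
      using b [of j] bw r by (intro mult_right_mono powr_mono2) auto
    finally show "ennreal (b j powr r) \<le> ennreal (w powr (r - 1)) * ennreal (b j)"
      using b [of j] by (simp add: ennreal_mult [symmetric] ennreal_leI)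
  qed
  also have "\<dots> = ennreal (w powr (r - 1)) * ennreal w" unfolding w(1) [symmetric] by (rule ennreal_suminf_cmult)
  also have "\<dots> = ennreal (w powr r)"
    using w(2) by (cases "w = 0") (simp_all add: ennreal_mult [symmetric] powr_diff)
  also have "\<dots> = ennreal_powr ?W r" using False by (simp add: ennreal_powr_def w_def)
  finally show ?thesis .
qed (simp add: ennreal_powr_def)

text \<open>By independence the joint law of the identity map into G and of Y agrees with the
  product law on rectangles, hence everywhere; the formula is Fubini's theorem for this
  product.\<close>

lemma freezing:
  assumes "prob_space M" and G: "subalgebra M G" and Y: "Y \<in> borel_measurable M"
    and ind: "prob_space.indep_set M (sets G) S"
    and S: "\<And>B. B \<in> sets borel \<Longrightarrow> Y -` B \<inter> space M \<in> S"
    and \<phi>: "\<phi> \<in> borel_measurable (G \<Otimes>\<^sub>M borel)"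
  shows "(\<integral>\<^sup>+\<omega>. \<phi> (\<omega>, Y \<omega>) \<partial>M) = (\<integral>\<^sup>+\<omega>. \<integral>\<^sup>+z. \<phi> (\<omega>, z) \<partial>distr M borel Y \<partial>M)"
proof -
  interpret prob_space M by fact
  interpret Y: prob_space "distr M borel Y" by (rule prob_space_distr [OF Y])
  have spG: "space G = space M" and sG: "sets G \<subseteq> events" using G by (auto simp: subalgebra_def)
  have id: "(\<lambda>\<omega>. \<omega>) \<in> measurable M G"
    using measurable_from_subalg [OF G measurable_ident] by (simp add: id_def)
  interpret G: prob_space "distr M G (\<lambda>\<omega>. \<omega>)" by (rule prob_space_distr [OF id])
  have pm: "(\<lambda>\<omega>. (\<omega>, Y \<omega>)) \<in> measurable M (G \<Otimes>\<^sub>M borel)" by (rule measurable_Pair [OF id Y])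
  have eq: "distr M G (\<lambda>\<omega>. \<omega>) \<Otimes>\<^sub>M distr M borel Y = distr M (G \<Otimes>\<^sub>M borel) (\<lambda>\<omega>. (\<omega>, Y \<omega>))"
  proof (rule pair_measure_eqI)
    show "sigma_finite_measure (distr M G (\<lambda>\<omega>. \<omega>))" "sigma_finite_measure (distr M borel Y)"
      by (rule G.sigma_finite_measure_axioms Y.sigma_finite_measure_axioms)+
    show "sets (distr M G (\<lambda>\<omega>. \<omega>) \<Otimes>\<^sub>M distr M borel Y) = sets (distr M (G \<Otimes>\<^sub>M borel) (\<lambda>\<omega>. (\<omega>, Y \<omega>)))"
      by (simp cong: sets_pair_measure_cong)
    fix a B assume "a \<in> sets (distr M G (\<lambda>\<omega>. \<omega>))" "B \<in> sets (distr M borel Y)"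
    then have a: "a \<in> sets G" and B: "B \<in> sets borel" by simp_all
    have as: "a \<subseteq> space M" using sets.sets_into_space [OF a] spG by simp
    have "emeasure (distr M (G \<Otimes>\<^sub>M borel) (\<lambda>\<omega>. (\<omega>, Y \<omega>))) (a \<times> B) = emeasure M ((\<lambda>\<omega>. (\<omega>, Y \<omega>)) -` (a \<times> B) \<inter> space M)"
      by (rule emeasure_distr [OF pm pair_measureI [OF a B]])
    also have "(\<lambda>\<omega>. (\<omega>, Y \<omega>)) -` (a \<times> B) \<inter> space M = a \<inter> (Y -` B \<inter> space M)" using as by blast
    also have "emeasure M \<dots> = ennreal (prob a * prob (Y -` B \<inter> space M))"
      unfolding emeasure_eq_measure indep_setD [OF ind a S [OF B]] ..
    also have "\<dots> = emeasure M a * emeasure M (Y -` B \<inter> space M)"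
      by (simp add: emeasure_eq_measure ennreal_mult)
    also have "\<dots> = emeasure (distr M G (\<lambda>\<omega>. \<omega>)) a * emeasure (distr M borel Y) B"
      using as by (simp add: emeasure_distr [OF id a] emeasure_distr [OF Y B] Int_absorb2)
    finally show "emeasure (distr M G (\<lambda>\<omega>. \<omega>)) a * emeasure (distr M borel Y) B
        = emeasure (distr M (G \<Otimes>\<^sub>M borel) (\<lambda>\<omega>. (\<omega>, Y \<omega>))) (a \<times> B)" ..
  qed
  have \<phi>': "\<phi> \<in> borel_measurable (distr M G (\<lambda>\<omega>. \<omega>) \<Otimes>\<^sub>M distr M borel Y)"
    unfolding eq using \<phi> by simp
  have "(\<integral>\<^sup>+\<omega>. \<phi> (\<omega>, Y \<omega>) \<partial>M) = (\<integral>\<^sup>+p. \<phi> p \<partial>distr M (G \<Otimes>\<^sub>M borel) (\<lambda>\<omega>. (\<omega>, Y \<omega>)))"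
    by (rule nn_integral_distr [OF pm, symmetric]) (simp add: \<phi>)
  also have "\<dots> = (\<integral>\<^sup>+p. \<phi> p \<partial>(distr M G (\<lambda>\<omega>. \<omega>) \<Otimes>\<^sub>M distr M borel Y))" unfolding eq ..
  also have "\<dots> = (\<integral>\<^sup>+\<omega>. \<integral>\<^sup>+z. \<phi> (\<omega>, z) \<partial>distr M borel Y \<partial>distr M G (\<lambda>\<omega>. \<omega>))"
    by (rule Y.nn_integral_fst [OF \<phi>', symmetric])
  also have "\<dots> = (\<integral>\<^sup>+\<omega>. \<integral>\<^sup>+z. \<phi> (\<omega>, z) \<partial>distr M borel Y \<partial>M)"
    by (rule nn_integral_distr [OF id]) (rule Y.borel_measurable_nn_integral_fst [OF \<phi>'])
  finally show ?thesis .
qed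

section \<open>From the moment conditions to convergence and negligible tails\<close>

context noise
begin

lemma summable_wt:
  fixes A :: "nat \<Rightarrow> 'a \<Rightarrow> real ^ 'p ^ 'd"
  assumes A: "predictable A" and p: "p \<le> \<alpha> - \<eta>" "\<alpha> + \<eta> \<le> q" "0 \<le> \<eta>"
    and fp: "(\<Sum>j. \<integral>\<^sup>+\<omega>. ennreal (op_norm (A j \<omega>) powr p) \<partial>M) < \<infinity>"
    and fq: "(\<Sum>j. \<integral>\<^sup>+\<omega>. ennreal (op_norm (A j \<omega>) powr q) \<partial>M) < \<infinity>"
  shows "(\<Sum>j. \<integral>\<^sup>+\<omega>. ennreal (wt \<eta> (op_norm (A j \<omega>))) \<partial>M) < \<infinity>"
proof -
  have [measurable]: "A j \<in> borel_measurable M" for j using A by (rule predictable_M)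
  have "(\<integral>\<^sup>+\<omega>. ennreal (wt \<eta> (op_norm (A j \<omega>))) \<partial>M) \<le>
      2 * ((\<integral>\<^sup>+\<omega>. ennreal (op_norm (A j \<omega>) powr p) \<partial>M) + (\<integral>\<^sup>+\<omega>. ennreal (op_norm (A j \<omega>) powr q) \<partial>M))" for j
  proof -
    have "(\<integral>\<^sup>+\<omega>. ennreal (wt \<eta> (op_norm (A j \<omega>))) \<partial>M) \<le>
        (\<integral>\<^sup>+\<omega>. 2 * (ennreal (op_norm (A j \<omega>) powr p) + ennreal (op_norm (A j \<omega>) powr q)) \<partial>M)"
    proof (rule nn_integral_mono)
      fix \<omega>
      let ?a = "op_norm (A j \<omega>)"
      have "?a powr (\<alpha> - \<eta>) \<le> ?a powr p + ?a powr q" "?a powr (\<alpha> + \<eta>) \<le> ?a powr p + ?a powr q"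
        using p by (intro powr_between; simp)+
      from add_mono [OF this] have "wt \<eta> ?a \<le> 2 * (?a powr p + ?a powr q)" by (simp add: wt_def)
      then have "ennreal (wt \<eta> ?a) \<le> ennreal (2 * (?a powr p + ?a powr q))" by (rule ennreal_leI)
      then show "ennreal (wt \<eta> ?a) \<le> 2 * (ennreal (?a powr p) + ennreal (?a powr q))"
        by (simp add: ennreal_mult)
    qed
    also have "\<dots> = 2 * ((\<integral>\<^sup>+\<omega>. ennreal (op_norm (A j \<omega>) powr p) \<partial>M) + (\<integral>\<^sup>+\<omega>. ennreal (op_norm (A j \<omega>) powr q) \<partial>M))"
      by (simp add: nn_integral_cmult nn_integral_add)
    finally show ?thesis .
  qed
  then have "(\<Sum>j. \<integral>\<^sup>+\<omega>. ennreal (wt \<eta> (op_norm (A j \<omega>))) \<partial>M) \<le>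
      (\<Sum>j. 2 * ((\<integral>\<^sup>+\<omega>. ennreal (op_norm (A j \<omega>) powr p) \<partial>M) + (\<integral>\<^sup>+\<omega>. ennreal (op_norm (A j \<omega>) powr q) \<partial>M)))"
    by (intro suminf_le summableI)
  also have "\<dots> = 2 * ((\<Sum>j. \<integral>\<^sup>+\<omega>. ennreal (op_norm (A j \<omega>) powr p) \<partial>M) + (\<Sum>j. \<integral>\<^sup>+\<omega>. ennreal (op_norm (A j \<omega>) powr q) \<partial>M))"
    by (simp add: suminf_add [OF summableI summableI, symmetric] ennreal_suminf_cmult)
  also have "\<dots> < \<infinity>" using fp fq by (simp add: ennreal_mult_less_top)
  finally show ?thesis .
qed

text \<open>Let W be the sum inside the moment and r = q / \<gamma> \<ge> 1. Then W \<le> 1 + W^r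
  gives the first bound, and the inequality between the sum of r-th powers and W^r the second;
  \<open>summable_wt\<close> interpolates between the two exponents.\<close>

lemma power_sum_moments:
  fixes A :: "nat \<Rightarrow> 'a \<Rightarrow> real ^ 'p ^ 'd"
  assumes A: "predictable A" and \<gamma>: "0 < \<gamma>" "\<gamma> \<le> q"
    and fin: "(\<integral>\<^sup>+\<omega>. ennreal_powr (\<Sum>j. ennreal (op_norm (A j \<omega>) powr \<gamma>)) (q / \<gamma>) \<partial>M) < \<infinity>"
  shows "(\<Sum>j. \<integral>\<^sup>+\<omega>. ennreal (op_norm (A j \<omega>) powr \<gamma>) \<partial>M) < \<infinity>"
    "(\<Sum>j. \<integral>\<^sup>+\<omega>. ennreal (op_norm (A j \<omega>) powr q) \<partial>M) < \<infinity>"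
proof -
  have [measurable]: "A j \<in> borel_measurable M" for j using A by (rule predictable_M)
  let ?W = "\<lambda>\<omega>. \<Sum>j. ennreal (op_norm (A j \<omega>) powr \<gamma>)"
  have r: "1 \<le> q / \<gamma>" using \<gamma> by simp
  have W: "?W \<in> borel_measurable M" by measurable
  note [measurable] = ennreal_powr_measurable [OF W]
  have "(\<Sum>j. \<integral>\<^sup>+\<omega>. ennreal (op_norm (A j \<omega>) powr \<gamma>) \<partial>M) = (\<integral>\<^sup>+\<omega>. ?W \<omega> \<partial>M)"
    by (rule nn_integral_suminf [symmetric]) measurable
  also have "\<dots> \<le> (\<integral>\<^sup>+\<omega>. 1 + ennreal_powr (?W \<omega>) (q / \<gamma>) \<partial>M)"
    by (intro nn_integral_mono le_one_plus_ennreal_powr r)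
  also have "\<dots> = 1 + (\<integral>\<^sup>+\<omega>. ennreal_powr (?W \<omega>) (q / \<gamma>) \<partial>M)"
    by (subst nn_integral_add) (simp_all add: M.emeasure_space_1)
  also have "\<dots> < \<infinity>" using fin by simp
  finally show "(\<Sum>j. \<integral>\<^sup>+\<omega>. ennreal (op_norm (A j \<omega>) powr \<gamma>) \<partial>M) < \<infinity>" .
  have "(\<Sum>j. \<integral>\<^sup>+\<omega>. ennreal (op_norm (A j \<omega>) powr q) \<partial>M) = (\<integral>\<^sup>+\<omega>. (\<Sum>j. ennreal (op_norm (A j \<omega>) powr q)) \<partial>M)"
    by (rule nn_integral_suminf [symmetric]) measurable
  also have "\<dots> \<le> (\<integral>\<^sup>+\<omega>. ennreal_powr (?W \<omega>) (q / \<gamma>) \<partial>M)"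
  proof (rule nn_integral_mono)
    fix \<omega>
    show "(\<Sum>j. ennreal (op_norm (A j \<omega>) powr q)) \<le> ennreal_powr (?W \<omega>) (q / \<gamma>)"
      using suminf_powr_le_ennreal_powr [of "\<lambda>j. op_norm (A j \<omega>) powr \<gamma>", OF powr_ge_zero r] \<gamma>
      by (simp add: powr_powr)
  qed
  finally show "(\<Sum>j. \<integral>\<^sup>+\<omega>. ennreal (op_norm (A j \<omega>) powr q) \<partial>M) < \<infinity>" using fin by (rule order_le_less_trans)
qed

definition good_series :: "(nat \<Rightarrow> 'a \<Rightarrow> real ^ 'p ^ 'd) \<Rightarrow> bool" where
  "good_series A \<longleftrightarrow> predictable A \<and> (AE \<omega> in M. summable (\<lambda>j. A j \<omega> *v Z j \<omega>)) \<and> negligible_tails A \<and>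
    (\<exists>\<eta>. 0 < \<eta> \<and> \<eta> < \<alpha> \<and> (\<Sum>j. \<integral>\<^sup>+\<omega>. ennreal (wt \<eta> (op_norm (A j \<omega>))) \<partial>M) < \<infinity>)"

lemma good_regular:
  fixes A :: "nat \<Rightarrow> 'a \<Rightarrow> real ^ 'p ^ 'd"
  assumes A: "predictable A" and \<alpha>: "\<alpha> < 1 \<or> 1 < \<alpha> \<and> \<alpha> < 2 \<and> mean_zero" and \<epsilon>: "0 < \<epsilon>" "\<epsilon> < \<alpha>"
    and f: "(\<Sum>j. \<integral>\<^sup>+\<omega>. ennreal (op_norm (A j \<omega>) powr (\<alpha> - \<epsilon>)) \<partial>M) < \<infinity>"
      "(\<Sum>j. \<integral>\<^sup>+\<omega>. ennreal (op_norm (A j \<omega>) powr (\<alpha> + \<epsilon>)) \<partial>M) < \<infinity>"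
  shows "good_series A"
proof -
  \<comment> \<open>Halving the distances to 1 and 2 keeps \<alpha> - \<eta> and \<alpha> + \<eta>
    on the required sides of these numbers, and \<eta> \<le> \<epsilon> keeps them between the
    exponents of the moment conditions.\<close>
  define \<eta> where "\<eta> = (if \<alpha> < 1 then min \<epsilon> ((1 - \<alpha>) / 2) else min \<epsilon> (min ((\<alpha> - 1) / 2) ((2 - \<alpha>) / 2)))"
  have \<eta>: "0 < \<eta>" "\<eta> < \<alpha>" "\<eta> \<le> \<epsilon>" using \<epsilon> \<alpha> by (auto simp: \<eta>_def min_def)
  have "\<alpha> + \<eta> < 1" if "\<alpha> < 1" using that by (simp add: \<eta>_def min_def field_simps)
  moreover have "1 < \<alpha> - \<eta> \<and> \<alpha> + \<eta> < 2" if "1 < \<alpha>" "\<alpha> < 2" using that by (simp add: \<eta>_def min_def field_simps)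
  ultimately have cs: "\<alpha> + \<eta> < 1 \<or> 1 < \<alpha> - \<eta> \<and> \<alpha> + \<eta> < 2 \<and> mean_zero" using \<alpha> by auto
  have fin: "(\<Sum>j. \<integral>\<^sup>+\<omega>. ennreal (wt \<eta> (op_norm (A j \<omega>))) \<partial>M) < \<infinity>"
    by (rule summable_wt [OF A _ _ _ f]) (use \<eta> in simp_all)
  show ?thesis
    unfolding good_series_def using A \<eta>(1,2) fin regular_case [OF A \<eta>(1,2) cs fin] by blast
qed

lemma good_power:
  fixes A :: "nat \<Rightarrow> 'a \<Rightarrow> real ^ 'p ^ 'd"
  assumes A: "predictable A" and \<gamma>: "0 < \<gamma>" "\<gamma> < \<alpha>" "\<gamma> \<le> 2" "\<gamma> \<le> 1 \<or> mean_zero" and \<epsilon>: "0 < \<epsilon>"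
    and f: "(\<integral>\<^sup>+\<omega>. ennreal_powr (\<Sum>j. ennreal (op_norm (A j \<omega>) powr \<gamma>)) ((\<alpha> + \<epsilon>) / \<gamma>) \<partial>M) < \<infinity>"
  shows "good_series A"
proof -
  \<comment> \<open>Puts both exponents of the weight between \<gamma> and \<alpha> + \<epsilon>,
    the exponents supplied by \<open>power_sum_moments\<close>.\<close>
  define \<eta> where "\<eta> = min (\<alpha> - \<gamma>) \<epsilon>"
  have \<eta>: "0 < \<eta>" "\<eta> < \<alpha>" "\<gamma> \<le> \<alpha> - \<eta>" "\<eta> \<le> \<epsilon>" using \<gamma> \<epsilon> by (auto simp: \<eta>_def)
  have q: "\<gamma> \<le> \<alpha> + \<epsilon>" "\<alpha> < \<alpha> + \<epsilon>" using \<gamma> \<epsilon> by auto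
  note m = power_sum_moments [OF A \<gamma>(1) q(1) f]
  have fin: "(\<Sum>j. \<integral>\<^sup>+\<omega>. ennreal (wt \<eta> (op_norm (A j \<omega>))) \<partial>M) < \<infinity>"
    by (rule summable_wt [OF A _ _ _ m]) (use \<eta> in simp_all)
  show ?thesis
    unfolding good_series_def
    using A \<eta>(1,2) fin power_case_summable [OF A \<eta>(1,2) \<gamma> fin m(1)] power_case_tails [OF A \<eta>(1,2) \<gamma> q(2) fin f]
    by blast
qed

text \<open>Homogeneity of \<open>N\<close> gives exactly the power of order \<alpha> of the
  operator norm, which lies below the weight.\<close>

lemma N_mv_far:
  fixes B :: "real ^ 'p ^ 'd"
  assumes \<delta>: "\<delta> > 0" and \<eta>: "0 \<le> \<eta>"
  shows "emeasure N {z. norm (B *v z) > \<delta>} \<le> ennreal (\<delta> powr - \<alpha> * wt \<eta> (op_norm B))"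
proof -
  have sub: "{z. norm (B *v z) > \<delta>} \<subseteq> {z. op_norm B * norm z > \<delta>}"
    by (rule Collect_mono) (rule impI, rule order_less_le_trans [OF _ norm_mv_le])
  have o: "{z. op_norm B * norm z > \<delta>} \<in> sets N" by measurable
  have "emeasure N {z. norm (B *v z) > \<delta>} \<le> emeasure N {z. op_norm B * norm z > \<delta>}"
    by (rule emeasure_mono [OF sub o])
  also have "\<dots> \<le> ennreal (\<delta> powr - \<alpha> * wt \<eta> (op_norm B))"
  proof (cases "op_norm B = 0")
    case True
    then show ?thesis using \<delta> by simp
  next
    case False
    then have b: "0 < op_norm B" using op_norm_nonneg [of B] by linarith
    have "{z :: real ^ 'p. op_norm B * norm z > \<delta>} = {z. norm z > \<delta> / op_norm B}"
      using b by (simp add: divide_less_eq mult.commute)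
    then have "emeasure N {z. op_norm B * norm z > \<delta>} = ennreal ((\<delta> / op_norm B) powr - \<alpha>)"
      using N_far [of "\<delta> / op_norm B"] b \<delta> by simp
    also have "(\<delta> / op_norm B) powr - \<alpha> = \<delta> powr - \<alpha> * op_norm B powr \<alpha>"
      using b \<delta> by (simp add: powr_divide powr_minus divide_simps)
    also have "\<dots> \<le> \<delta> powr - \<alpha> * wt \<eta> (op_norm B)"
      unfolding wt_def using \<eta> by (intro mult_left_mono powr_between) auto
    finally show ?thesis by (simp add: ennreal_leI)
  qed
  finally show ?thesis .
qed

end

lemma (in series_test) nn_integral_L:
  "(\<integral>\<^sup>+\<omega>. \<integral>\<^sup>+z. ennreal (g (A j \<omega> *v z)) \<partial>N \<partial>M) = ennreal (L j)"
proof -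
  have "(\<integral>\<^sup>+z. ennreal (g (A j \<omega> *v z)) \<partial>N) = ennreal (\<Phi> (A j \<omega>))" for \<omega>
    unfolding \<Phi>_def by (rule nn_integral_eq_integral [OF g_mv_integrable_N]) (simp add: g_nonneg)
  then show ?thesis
    unfolding L_def by (simp add: nn_integral_eq_integral [OF \<Phi>_integrable] \<Phi>_bounds)
qed

section \<open>Passage to vague convergence\<close>

lemma radon_scaled_law:
  assumes "prob_space M" "X \<in> borel_measurable M"
  shows "radon_on punctured (scaled_law M X c u)"
  unfolding radon_on_def
proof (intro conjI allI impI)
  let ?R = "restrict_space (distr M borel (\<lambda>\<omega>. ext_vec (X \<omega> /\<^sub>R u))) punctured"
  have m: "(\<lambda>\<omega>. ext_vec (X \<omega> /\<^sub>R u)) \<in> borel_measurable M" using assms(2) by measurable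
  show "sets (scaled_law M X c u) = sets (restrict_space borel punctured)"
    unfolding scaled_law_def sets_scale_measure by (rule sets_restrict_space_cong) simp
  fix K
  have "emeasure ?R K \<le> emeasure ?R (space ?R)" by (rule emeasure_space)
  also have "\<dots> = emeasure (distr M borel (\<lambda>\<omega>. ext_vec (X \<omega> /\<^sub>R u))) punctured"
    by (subst emeasure_restrict_space) (simp_all add: space_restrict_space)
  also have "\<dots> \<le> 1" by (rule prob_space.emeasure_le_1 [OF prob_space.prob_space_distr [OF assms(1) m]])
  finally have "emeasure ?R K < \<infinity>" using order_le_less_trans by fastforce
  then show "emeasure (scaled_law M X c u) K < \<infinity>"
    unfolding scaled_law_def by (simp add: ennreal_mult_less_top)
qed

text \<open>Nonnegative test functions fit both \<open>single_big_jump\<close> and the evaluation of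
  the limit as an iterated nonnegative integral; the general case is a difference of two of
  them.\<close>

lemma vague_limit_nonneg:
  fixes M :: "'a measure" and Z :: "nat \<Rightarrow> 'a \<Rightarrow> real ^ 'p" and A :: "nat \<Rightarrow> 'a \<Rightarrow> real ^ 'p ^ 'd"
  assumes rv: "prob_space M" "regularly_varying M (Z 0) \<mu> \<alpha>"
    and noise: "noise (distr M borel (Z 0)) (distr \<mu> borel fin_part) \<alpha> M F Z"
    and good: "noise.good_series (distr M borel (Z 0)) \<alpha> M F Z A"
    and f: "f \<in> test_functions punctured" and nn: "\<And>x. 0 \<le> f x"
  shows "integrable (limit_measure M \<mu> A) f"
    "((\<lambda>u. integral\<^sup>L (scaled_law M (\<lambda>\<omega>. \<Sum>j. A j \<omega> *v Z j \<omega>) (norm_tail M (Z 0) u) u) f)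
      \<longlongrightarrow> integral\<^sup>L (limit_measure M \<mu> A) f) at_top"
proof -
  let ?D = "distr M borel (Z 0)" and ?N = "distr \<mu> borel fin_part :: (real ^ 'p) measure"
  interpret noise ?D ?N \<alpha> M F Z by (rule noise)
  obtain \<eta> where pr: "predictable A" and sm: "AE \<omega> in M. summable (\<lambda>j. A j \<omega> *v Z j \<omega>)"
    and neg: "negligible_tails A" and \<eta>: "0 < \<eta>" "\<eta> < \<alpha>"
    and fin: "(\<Sum>j. \<integral>\<^sup>+\<omega>. ennreal (wt \<eta> (op_norm (A j \<omega>))) \<partial>M) < \<infinity>"
    using good unfolding good_series_def by blast
  obtain G where G: "G > 0" "\<And>z. \<bar>pull f z\<bar> \<le> G" by (rule bounded_pull [OF f]) blast
  obtain \<delta> where \<delta>: "\<delta> > 0" "\<And>z. norm z \<le> \<delta> \<Longrightarrow> pull f z = 0" by (rule pull_vanishes [OF f]) blast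
  have pn: "0 \<le> pull f z" for z using nn by (simp add: pull_def)
  \<comment> \<open>The radius is capped at 1 because \<open>prob_scaled\<close> treats factors of
    at most 1.\<close>
  interpret series_test ?D ?N \<alpha> M F Z "pull f" G "min \<delta> 1" A \<eta>
  proof (unfold_locales)
    show "pull f y \<le> G" for y using G(2) [of y] by simp
  qed (use uniformly_continuous_pull [OF f] pn \<delta> G(1) pr \<eta> fin in auto)
  have Am: "\<And>j. A j \<in> borel_measurable M" by (rule A_measurable)
  note eq = nn_integral_lm_test [OF rv_radon [OF rv] rv_null [OF rv] Am f nn]
  have "(\<integral>\<^sup>+x. ennreal (f x) \<partial>limit_measure M \<mu> A) = (\<Sum>j. ennreal (L j))"
    unfolding eq(2) nn_integral_L ..
  also have "\<dots> = ennreal (\<Sum>j. L j)" by (rule suminf_ennreal2 [OF L_bounds(1) L_summable])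
  finally have int: "(\<integral>\<^sup>+x. ennreal (f x) \<partial>limit_measure M \<mu> A) = ennreal (\<Sum>j. L j)" .
  show "integrable (limit_measure M \<mu> A) f"
    by (rule integrableI_nonneg [OF eq(1)]) (simp_all add: nn int)
  have "integral\<^sup>L (limit_measure M \<mu> A) f = enn2real (\<integral>\<^sup>+x. ennreal (f x) \<partial>limit_measure M \<mu> A)"
    by (rule integral_eq_nn_integral [OF eq(1)]) (simp add: nn)
  then have lim: "integral\<^sup>L (limit_measure M \<mu> A) f = (\<Sum>j. L j)"
    unfolding int using suminf_nonneg [OF L_summable L_bounds(1)] by simp
  have "integral\<^sup>L (scaled_law M (\<lambda>\<omega>. \<Sum>j. A j \<omega> *v Z j \<omega>) (norm_tail M (Z 0) u) u) f
      = (\<integral>\<omega>. pull f (X \<omega> /\<^sub>R u) \<partial>M) / T u" for u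
    using integral_scaled_law [OF X_measurable _ f, of "T u" u] tail_pos [of u]
    unfolding X_def [abs_def] tail_eq [OF rv] by simp
  then show "((\<lambda>u. integral\<^sup>L (scaled_law M (\<lambda>\<omega>. \<Sum>j. A j \<omega> *v Z j \<omega>) (norm_tail M (Z 0) u) u) f)
      \<longlongrightarrow> integral\<^sup>L (limit_measure M \<mu> A) f) at_top"
    unfolding lim using series_limit [OF sm neg] by simp
qed

lemma test_function_parts:
  assumes "f \<in> test_functions E"
  shows "(\<lambda>x. max (f x) 0) \<in> test_functions E" "(\<lambda>x. max (- f x) 0) \<in> test_functions E"
proof -
  obtain K where K: "compact K" "K \<subseteq> E" "\<forall>x\<in>E - K. f x = 0" and c: "continuous_on E f"
    using assms unfolding test_functions_def by blast
  have "continuous_on E (\<lambda>x. max (f x) 0)" "continuous_on E (\<lambda>x. max (- f x) 0)"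
    by (intro continuous_on_max continuous_on_minus continuous_on_const c)+
  then show "(\<lambda>x. max (f x) 0) \<in> test_functions E" "(\<lambda>x. max (- f x) 0) \<in> test_functions E"
    unfolding test_functions_def using K by (intro CollectI conjI exI [of _ K]; simp)+
qed

lemma integrable_scaled_law:
  assumes "prob_space M" and X: "X \<in> borel_measurable M" and f: "f \<in> test_functions punctured"
  shows "integrable (scaled_law M X c u) f"
proof -
  let ?L = "distr M borel (\<lambda>\<omega>. ext_vec (X \<omega> /\<^sub>R u))" let ?S = "scaled_law M X c u"
  have m: "(\<lambda>\<omega>. ext_vec (X \<omega> /\<^sub>R u)) \<in> borel_measurable M" using X by measurable
  have sets: "sets ?S = sets (restrict_space borel punctured)"
    using radon_scaled_law [OF assms(1) X] by (simp add: radon_on_def)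
  have space: "space ?S = punctured"
    using sets_eq_imp_space_eq [OF sets] by (simp add: space_restrict_space)
  have "emeasure (restrict_space ?L punctured) punctured \<le> 1"
    by (subst emeasure_restrict_space)
      (simp_all add: prob_space.emeasure_le_1 [OF prob_space.prob_space_distr [OF assms(1) m]])
  then have "emeasure ?S (space ?S) < \<infinity>"
    unfolding space unfolding scaled_law_def by (simp add: ennreal_mult_less_top order_le_less_trans [of _ 1])
  then interpret S: finite_measure ?S by (intro finite_measureI) simp
  obtain G where G: "\<And>z. \<bar>(\<lambda>x. if x = 0 then 0 else f x) z\<bar> \<le> G"
  proof -
    have "bounded ((\<lambda>x. if x = 0 then 0 else f x) ` UNIV)"
      by (intro compact_imp_bounded compact_continuous_image test_function_extend f compact_ereal_vec)
    then obtain a where "\<forall>x\<in>(\<lambda>x. if x = 0 then 0 else f x) ` UNIV. norm x \<le> a" unfolding bounded_iff ..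
    then show ?thesis by (intro that [of a]) simp
  qed
  have "(\<lambda>x. if x = 0 then 0 else f x) \<in> borel_measurable ?S"
    by (subst measurable_cong_sets [OF sets refl])
      (intro measurable_restrict_space1 borel_measurable_continuous_onI test_function_extend f)
  then have fm: "f \<in> borel_measurable ?S"
    by (rule measurable_cong [THEN iffD1, rotated]) (auto simp: space punctured_def)
  show ?thesis
  proof (rule S.integrable_const_bound [OF _ fm])
    show "AE x in ?S. norm (f x) \<le> G"
    proof (rule AE_I2)
      fix x assume "x \<in> space ?S"
      then show "norm (f x) \<le> G" using G [of x] by (simp add: space punctured_def)
    qed
  qed
qed

text \<open>The events that Z j lies in a Borel set are among the generators of the future
  \<sigma>-algebra, so \<open>freezing\<close> applies with G = F j; identical distribution then
  replaces the law of Z j by that of Z 0.\<close>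

lemma noise_of_filtration:
  fixes M :: "'a measure" and Z :: "nat \<Rightarrow> 'a \<Rightarrow> real ^ 'p"
  assumes prob: "prob_space M" and law: "\<And>j. distr M borel (Z j) = distr M borel (Z 0)"
    and filt: "coefficient_filtration M F A Z" and rv: "regularly_varying M (Z 0) \<mu> \<alpha>"
  shows "noise (distr M borel (Z 0)) (distr \<mu> borel fin_part) \<alpha> M F Z"
proof (intro noise.intro noise_axioms.intro rv_tail_law [OF prob rv] prob)
  have fl: "filtration (space M) F" and sub: "\<And>j. subalgebra M (F j)"
    and Zm: "\<And>j. Z j \<in> borel_measurable (F (Suc j))"
    and ind: "\<And>j. prob_space.indep_set M (sets (F j))
        (sigma_sets (space M) (\<Union>i\<in>{j..}. sets (vimage_algebra (space M) (Z i) borel)))"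
    using filt unfolding coefficient_filtration_def by blast+
  show "subalgebra M (F j)" for j by (rule sub)
  show "sets (F i) \<subseteq> sets (F j)" if "i \<le> j" for i j by (rule filtration.sets_F_mono [OF fl that])
  show "Z j \<in> borel_measurable (F (Suc j))" for j by (rule Zm)
  show "(\<integral>\<^sup>+\<omega>. \<phi> (\<omega>, Z j \<omega>) \<partial>M) = (\<integral>\<^sup>+\<omega>. \<integral>\<^sup>+z. \<phi> (\<omega>, z) \<partial>distr M borel (Z 0) \<partial>M)"
    if "\<phi> \<in> borel_measurable (F j \<Otimes>\<^sub>M borel)" for \<phi> j
    unfolding law [of j, symmetric]
  proof (rule freezing [OF prob sub measurable_from_subalg [OF sub Zm] ind _ that])
    fix B :: "(real ^ 'p) set" assume "B \<in> sets borel"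
    then have "Z j -` B \<inter> space M \<in> sets (vimage_algebra (space M) (Z j) borel)" by (rule in_vimage_algebra)
    then show "Z j -` B \<inter> space M \<in> sigma_sets (space M) (\<Union>i\<in>{j..}. sets (vimage_algebra (space M) (Z i) borel))"
      by (intro sigma_sets.Basic UN_I [of j]) simp_all
  qed
qed

theorem theorem3p1:
  fixes M :: "'a measure"
    and Z :: "nat \<Rightarrow> 'a \<Rightarrow> real ^ 'p"
    and A :: "nat \<Rightarrow> 'a \<Rightarrow> real ^ 'p ^ 'd"
    and F :: "nat \<Rightarrow> 'a measure"
    and \<mu> :: "(ereal ^ 'p) measure"
    and \<alpha> \<epsilon> :: real
  assumes "prob_space M"
    and "prob_space.indep_vars M (\<lambda>_. borel) Z UNIV"
    and "\<And>j. distr M borel (Z j) = distr M borel (Z 0)"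
    and "coefficient_filtration M F A Z"
    and "regularly_varying M (Z 0) \<mu> \<alpha>"
    and "\<alpha> > 1 \<Longrightarrow> integrable M (Z 0) \<and> prob_space.expectation M (Z 0) = 0"
    and "measure M {\<omega> \<in> space M. \<forall>j. op_norm (A j \<omega>) = 0} = 0"
    and "0 < \<epsilon>" and "\<epsilon> < \<alpha>"
    and "\<alpha> \<in> {0<..<1} \<union> {1<..<2} \<Longrightarrow>
           (\<Sum>j. \<integral>\<^sup>+\<omega>. ennreal (op_norm (A j \<omega>) powr (\<alpha> - \<epsilon>)) \<partial>M) < \<infinity> \<and>
           (\<Sum>j. \<integral>\<^sup>+\<omega>. ennreal (op_norm (A j \<omega>) powr (\<alpha> + \<epsilon>)) \<partial>M) < \<infinity>"
    and "\<alpha> \<in> {1, 2} \<Longrightarrow>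
           (\<integral>\<^sup>+\<omega>. ennreal_powr (\<Sum>j. ennreal (op_norm (A j \<omega>) powr (\<alpha> - \<epsilon>)))
                     ((\<alpha> + \<epsilon>) / (\<alpha> - \<epsilon>)) \<partial>M) < \<infinity>"
    and "\<alpha> > 2 \<Longrightarrow>
           (\<integral>\<^sup>+\<omega>. ennreal_powr (\<Sum>j. ennreal (op_norm (A j \<omega>) ^ 2))
                     ((\<alpha> + \<epsilon>) / 2) \<partial>M) < \<infinity>"
  shows "(AE \<omega> in M. summable (\<lambda>j. A j \<omega> *v Z j \<omega>)) \<and>
         vague_convergence punctured
           (\<lambda>u. scaled_law M (\<lambda>\<omega>. \<Sum>j. A j \<omega> *v Z j \<omega>) (norm_tail M (Z 0) u) u)
           (limit_measure M \<mu> A) at_top"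
proof -
  note prob = assms(1) and rv = assms(5)
  let ?D = "distr M borel (Z 0)" and ?N = "distr \<mu> borel fin_part :: (real ^ 'p) measure"
  have noise: "noise ?D ?N \<alpha> M F Z" by (rule noise_of_filtration [OF assms(1,3,4,5)])
  interpret noise ?D ?N \<alpha> M F Z by (rule noise)
  have A: "predictable A"
    using assms(4) unfolding coefficient_filtration_def predictable_def by blast
  have Am: "A j \<in> borel_measurable M" for j using A by (rule predictable_M)
  have mz: mean_zero if "\<alpha> > 1"
    using assms(6) [OF that] unfolding mean_zero_def
    by (simp add: integrable_distr_eq [OF Z_measurable] integral_distr [OF Z_measurable])
  have good: "good_series A"
  proof -
    consider "\<alpha> < 1 \<or> 1 < \<alpha> \<and> \<alpha> < 2" | "\<alpha> = 1 \<or> \<alpha> = 2" | "\<alpha> > 2" by linarith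
    then show ?thesis
    proof cases
      case 1
      have r: "\<alpha> < 1 \<or> 1 < \<alpha> \<and> \<alpha> < 2 \<and> mean_zero" using 1 mz by blast
      have "\<alpha> \<in> {0<..<1} \<union> {1<..<2}"
        using 1 alpha_pos by (simp only: Un_iff greaterThanLessThan_iff) blast
      from assms(10) [OF this] show ?thesis by (elim conjE) (rule good_regular [OF A r assms(8,9)])
    next
      case 2
      have r: "0 < \<alpha> - \<epsilon>" "\<alpha> - \<epsilon> < \<alpha>" "\<alpha> - \<epsilon> \<le> 2" using 2 assms(8,9) by linarith+
      \<comment> \<open>For \<alpha> = 1 the compensator is estimated below the truncation level;
        for \<alpha> = 2 the zero mean is at hand.\<close>
      have "\<alpha> - \<epsilon> \<le> 1 \<or> mean_zero"
      proof (cases "\<alpha> = 1")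
        case True
        then show ?thesis using assms(8) by linarith
      next
        case False
        then have "\<alpha> > 1" using 2 by linarith
        then show ?thesis using mz by blast
      qed
      note c = this
      have "\<alpha> \<in> {1, 2}" using 2 by (simp only: insert_iff empty_iff simp_thms)
      from good_power [OF A r c assms(8) assms(11) [OF this]] show ?thesis .
    next
      case 3
      have r: "0 < (2 :: real)" "2 < \<alpha>" "(2 :: real) \<le> 2" "(2 :: real) \<le> 1 \<or> mean_zero"
        using 3 mz by simp_all
      from good_power [OF A r assms(8)] assms(12) [OF 3] show ?thesis
        by (simp only: powr_two [OF op_norm_nonneg])
    qed
  qed
  let ?X = "\<lambda>\<omega>. \<Sum>j. A j \<omega> *v Z j \<omega>" let ?S = "\<lambda>u. scaled_law M ?X (norm_tail M (Z 0) u) u"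
  let ?\<nu> = "limit_measure M \<mu> A"
  have Xm: "?X \<in> borel_measurable M"
    using Am by (intro borel_measurable_suminf mv_measurable Z_measurable)
  have sm: "AE \<omega> in M. summable (\<lambda>j. A j \<omega> *v Z j \<omega>)" using good by (simp add: good_series_def)
  obtain \<eta> where \<eta>: "0 < \<eta>" "(\<Sum>j. \<integral>\<^sup>+\<omega>. ennreal (wt \<eta> (op_norm (A j \<omega>))) \<partial>M) < \<infinity>"
    using good unfolding good_series_def by blast
  have rad: "radon_on punctured ?\<nu>"
  proof (rule radon_lm [OF rv_radon [OF prob rv] rv_null [OF prob rv] Am])
    fix \<delta> :: real assume \<delta>: "\<delta> > 0"
    have "(\<Sum>j. \<integral>\<^sup>+\<omega>. emeasure ?N {z. norm (A j \<omega> *v z) > \<delta>} \<partial>M)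
        \<le> (\<Sum>j. \<integral>\<^sup>+\<omega>. ennreal (\<delta> powr - \<alpha> * wt \<eta> (op_norm (A j \<omega>))) \<partial>M)"
      using \<eta>(1) by (intro suminf_le nn_integral_mono N_mv_far \<delta> summableI) simp
    also have "\<dots> = ennreal (\<delta> powr - \<alpha>) * (\<Sum>j. \<integral>\<^sup>+\<omega>. ennreal (wt \<eta> (op_norm (A j \<omega>))) \<partial>M)"
      by (simp add: nn_integral_wt_cmult [OF A powr_ge_zero wt_measurable wt_nonneg])
    also have "\<dots> < \<infinity>" using \<eta>(2) by (simp add: ennreal_mult_less_top)
    finally show "(\<Sum>j. \<integral>\<^sup>+\<omega>. emeasure ?N {z. norm (A j \<omega> *v z) > \<delta>} \<partial>M) < \<infinity>" .
  qed
  have lim: "((\<lambda>u. integral\<^sup>L (?S u) f) \<longlongrightarrow> integral\<^sup>L ?\<nu> f) at_top" if f: "f \<in> test_functions punctured" for f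
  proof -
    let ?p = "\<lambda>x. max (f x) 0" and ?m = "\<lambda>x. max (- f x) 0"
    note parts = test_function_parts [OF f]
    note vp = vague_limit_nonneg [OF prob rv noise good parts(1) max.cobounded2]
    note vm = vague_limit_nonneg [OF prob rv noise good parts(2) max.cobounded2]
    have split: "integral\<^sup>L Q f = integral\<^sup>L Q ?p - integral\<^sup>L Q ?m" if "integrable Q ?p" "integrable Q ?m" for Q
    proof -
      have "integral\<^sup>L Q f = (\<integral>x. ?p x - ?m x \<partial>Q)" by (intro Bochner_Integration.integral_cong) auto
      then show ?thesis using that by (simp only: Bochner_Integration.integral_diff)
    qed
    have "integral\<^sup>L (?S u) f = integral\<^sup>L (?S u) ?p - integral\<^sup>L (?S u) ?m" for u
      by (intro split integrable_scaled_law prob Xm parts)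
    moreover have "integral\<^sup>L ?\<nu> f = integral\<^sup>L ?\<nu> ?p - integral\<^sup>L ?\<nu> ?m" by (intro split vp(1) vm(1))
    ultimately show ?thesis using tendsto_diff [OF vp(2) vm(2)] by simp
  qed
  show ?thesis
    unfolding vague_convergence_def
    by (intro conjI always_eventually allI ballI sm rad lim radon_scaled_law [OF prob Xm])
qed

end
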